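(* Let $n \geq 3$, let $\Omega \subset \mathbb{R}^n$ be bounded, open, and connected, and let $Q = Q(x)$ be an $n\times n$ self-adjoint, measurable, uniformly elliptic matrix function on $\Omega$. Let $q > \frac{n}{2}$ and $A(t) = t^{\frac{n}{2}} \log(e+t)^q$ for $t\ge 0$. Then there exists a constant $C$, independent of $u$ and $f$, such that for every $f \in L^A(\Omega)$ and every non-negative weak solution $u$ of the Dirichlet problem \[ -\operatorname{Div}(Q\nabla u) = f \ \text{ in } \Omega, \qquad u = 0 \ \text{ on } \partial\Omega, \] we have \[ \|u\|_{L^\infty(\Omega)} \leq C \|f\|_{L^A(\Omega)}. \]
   Context: Uniformly elliptic means that there exist constants $0 < \lambda \leq \Lambda < \infty$ such that $\lambda |\xi|^2 \leq \langle Q(x)\xi, \xi\rangle \leq \Lambda |\xi|^2$ for all $\xi \in \mathbb{R}^n$ and almost every $x \in \Omega$. For a Young function $A:[0,\infty)\to[0,\infty)$ (increasing, convex, $A(0)=0$, $A(t)/t\to\infty$ as $t\to\infty$), the Orlicz space $L^A(\Omega)$ consists of all measurable functions $f$ on $\Omega$ such that \[ \|f\|_{L^A(\Omega)} = \inf\left\{ \mu > 0 : \int_\Omega A\left(\frac{|f(x)|}{\mu}\right) dx \leq 1 \right\} < \infty. \] Let $\mathrm{Lip}_0(\Omega)$ denote the Lipschitz functions with compact support in $\Omega$. A weak solution of the Dirichlet problem is a function $u$ in the closure of $\mathrm{Lip}_0(\Omega)$ with respect to the norm \[ \|\psi\| = \left(\int_\Omega |\psi|^2\,dx\right)^{1/2}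 + \left(\int_\Omega |\sqrt{Q}\,\nabla\psi|^2\,dx\right)^{1/2} \] (since $Q$ is uniformly elliptic, this closure is the usual Sobolev space $H^1_0(\Omega)$, and $\nabla u$ is the weak gradient) such that \[ \int_\Omega \nabla\psi(x)\cdot Q(x)\nabla u(x)\,dx = \int_\Omega f(x)\psi(x)\,dx \] for every $\psi\in \mathrm{Lip}_0(\Omega)$. Non-negative means $u\ge 0$ almost everywhere in $\Omega$. *)

theory Defs
  imports "HOL-Analysis.Analysis" "HOL-Probability.Essential_Supremum"
begin

text \<open>
  A function on \<open>\<Omega>\<close> is represented by a function on the whole space whose values outside \<open>\<Omega>\<close>
  are irrelevant: integrals, measurability and almost-everywhere statements all refer to the
  measure \<open>lebesgue_on \<Omega>\<close>.
\<close>

subsection \<open>Matrix functions\<close>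

definition uniformly_elliptic :: "(real ^ 'n) set \<Rightarrow> (real ^ 'n \<Rightarrow> real ^ 'n ^ 'n) \<Rightarrow> bool" where
  "uniformly_elliptic \<Omega> Q \<longleftrightarrow>
     (\<exists>l L. 0 < l \<and> l \<le> L \<and>
        (AE x in lebesgue_on \<Omega>. \<forall>\<xi>. l * (norm \<xi>)\<^sup>2 \<le> (Q x *v \<xi>) \<bullet> \<xi> \<and> (Q x *v \<xi>) \<bullet> \<xi> \<le> L * (norm \<xi>)\<^sup>2))"

text \<open>
  For a symmetric positive semidefinite \<open>M\<close> there is exactly one matrix with the three properties
  below, so the choice operator does not introduce any ambiguity.
\<close>

definition matrix_sqrt :: "real ^ 'n ^ 'n \<Rightarrow> real ^ 'n ^ 'n" where
  "matrix_sqrt M = (SOME S. transpose S = S \<and> (\<forall>\<xi>. 0 \<le> (S *v \<xi>) \<bullet> \<xi>) \<and> S ** S = M)"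


subsection \<open>Orlicz spaces\<close>

text \<open>The infimum is taken in \<open>[0,\<infinity>]\<close>, so it is \<open>\<infinity>\<close> if no \<open>\<mu>\<close> is admissible.\<close>

definition orlicz_norm :: "(real ^ 'n) set \<Rightarrow> (real \<Rightarrow> real) \<Rightarrow> (real ^ 'n \<Rightarrow> real) \<Rightarrow> ennreal" where
  "orlicz_norm \<Omega> A f =
     Inf {ennreal \<mu> | \<mu>. 0 < \<mu> \<and> (\<integral>\<^sup>+ x. ennreal (A (\<bar>f x\<bar> / \<mu>)) \<partial>lebesgue_on \<Omega>) \<le> 1}"

definition orlicz_space :: "(real ^ 'n) set \<Rightarrow> (real \<Rightarrow> real) \<Rightarrow> (real ^ 'n \<Rightarrow> real) set" where
  "orlicz_space \<Omega> A = {f \<in> borel_measurable (lebesgue_on \<Omega>). orlicz_norm \<Omega> A f < \<infinity>}"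

definition Linf_norm :: "(real ^ 'n) set \<Rightarrow> (real ^ 'n \<Rightarrow> real) \<Rightarrow> ennreal" where
  "Linf_norm \<Omega> u = esssup (lebesgue_on \<Omega>) (\<lambda>x. ennreal \<bar>u x\<bar>)"


subsection \<open>The energy space and weak solutions\<close>

definition Lip0 :: "(real ^ 'n) set \<Rightarrow> (real ^ 'n \<Rightarrow> real) set" where
  "Lip0 \<Omega> = {\<psi>. (\<exists>L. L-lipschitz_on \<Omega> \<psi>) \<and>
       compact (closure (support_on \<Omega> \<psi>)) \<and> closure (support_on \<Omega> \<psi>) \<subseteq> \<Omega>}"

text \<open>
  The classical gradient. A function in \<open>Lip0 \<Omega>\<close> is differentiable almost everywhere in \<open>\<Omega>\<close>
  (Rademacher), so the value \<open>0\<close> at the remaining points does not affect any integral.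
\<close>

definition gradient :: "(real ^ 'n \<Rightarrow> real) \<Rightarrow> real ^ 'n \<Rightarrow> real ^ 'n" where
  "gradient \<psi> x = (if \<psi> differentiable (at x) then (THE D. GDERIV \<psi> x :> D) else 0)"

text \<open>
  The norm \<open>(\<integral>|w|\<^sup>2)\<^sup>1\<^sup>/\<^sup>2 + (\<integral>|\<surd>Q v|\<^sup>2)\<^sup>1\<^sup>/\<^sup>2\<close> of a function \<open>w\<close> with gradient field \<open>v\<close>.
  It is meaningful only when both integrands are integrable.
\<close>

definition energy_norm ::
    "(real ^ 'n) set \<Rightarrow> (real ^ 'n \<Rightarrow> real ^ 'n ^ 'n) \<Rightarrow> (real ^ 'n \<Rightarrow> real) \<Rightarrow> (real ^ 'n \<Rightarrow> real ^ 'n) \<Rightarrow> real"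
  where "energy_norm \<Omega> Q w v =
     sqrt (\<integral>x. (w x)\<^sup>2 \<partial>lebesgue_on \<Omega>) + sqrt (\<integral>x. (norm (matrix_sqrt (Q x) *v v x))\<^sup>2 \<partial>lebesgue_on \<Omega>)"

text \<open>
  \<open>u\<close> lies in the closure of \<open>Lip0 \<Omega>\<close> for the energy norm, with gradient \<open>g\<close>: the pair \<open>(u, g)\<close>
  has finite energy and is the limit of pairs \<open>(\<psi>, \<nabla>\<psi>)\<close> with \<open>\<psi> \<in> Lip0 \<Omega>\<close>. For uniformly elliptic
  \<open>Q\<close>, the field \<open>g\<close> is the weak gradient of \<open>u\<close>; it is determined by \<open>u\<close> almost everywhere.
\<close>

definition in_Lip0_closure ::
    "(real ^ 'n) set \<Rightarrow> (real ^ 'n \<Rightarrow> real ^ 'n ^ 'n) \<Rightarrow> (real ^ 'n \<Rightarrow> real) \<Rightarrow> (real ^ 'n \<Rightarrow> real ^ 'n) \<Rightarrow> bool"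
  where "in_Lip0_closure \<Omega> Q u g \<longleftrightarrow>
     u \<in> borel_measurable (lebesgue_on \<Omega>) \<and> g \<in> borel_measurable (lebesgue_on \<Omega>) \<and>
     integrable (lebesgue_on \<Omega>) (\<lambda>x. (u x)\<^sup>2) \<and>
     integrable (lebesgue_on \<Omega>) (\<lambda>x. (norm (matrix_sqrt (Q x) *v g x))\<^sup>2) \<and>
     (\<exists>\<psi> :: nat \<Rightarrow> real ^ 'n \<Rightarrow> real. (\<forall>k. \<psi> k \<in> Lip0 \<Omega>) \<and>
        (\<lambda>k. energy_norm \<Omega> Q (\<lambda>x. \<psi> k x - u x) (\<lambda>x. gradient (\<psi> k) x - g x)) \<longlonglongrightarrow> 0)"

text \<open>\<open>u\<close> is a weak solution of \<open>-Div (Q \<nabla>u) = f\<close> in \<open>\<Omega>\<close>, \<open>u = 0\<close> on the boundary of \<open>\<Omega>\<close>.\<close>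

definition weak_solution ::
    "(real ^ 'n) set \<Rightarrow> (real ^ 'n \<Rightarrow> real ^ 'n ^ 'n) \<Rightarrow> (real ^ 'n \<Rightarrow> real) \<Rightarrow> (real ^ 'n \<Rightarrow> real) \<Rightarrow> bool"
  where "weak_solution \<Omega> Q f u \<longleftrightarrow>
     (\<exists>g. in_Lip0_closure \<Omega> Q u g \<and>
        (\<forall>\<psi>\<in>Lip0 \<Omega>. (\<integral>x. gradient \<psi> x \<bullet> (Q x *v g x) \<partial>lebesgue_on \<Omega>) = (\<integral>x. f x * \<psi> x \<partial>lebesgue_on \<Omega>)))"

end

theory Submission
  imports Defs
begin

text \<open>
  Let \<open>\<mu> > 0\<close> be admissible in the Orlicz norm of \<open>f\<close>, put \<open>p = n / 2\<close> and \<open>a k = |{u > k}|\<close>. Testing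
  the equation with the truncation of \<open>u\<close> to the slab between the heights \<open>k\<close> and \<open>k + \<tau>\<close> bounds
  the energy of that truncation by a multiple of \<open>\<tau> \<integral>\<^sub>{\<^sub>u\<^sub>>\<^sub>k\<^sub>} |f|\<close>. The truncation equals \<open>\<tau>\<close>
  on \<open>{u > k + \<tau>}\<close>, so Sobolev's inequality gives
  \<open>a (k + \<tau>) \<le> C (\<tau>\<^sup>-\<^sup>1 \<integral>\<^sub>{\<^sub>u\<^sub>>\<^sub>k\<^sub>} |f|)\<^sup>\<sigma>\<close> with \<open>\<sigma> = n / (n - 2)\<close> (\<open>level_set_decay\<close>).
  The Orlicz condition says that \<open>f\<close> is slightly better than \<open>L\<^sup>p\<close>: if \<open>a k \<le> exp (- y)\<close> and \<open>1 \<le> y\<close>, the integral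
  is at most a multiple of \<open>\<mu> exp (- y / \<sigma>)\<close> times \<open>y\<close> to the power \<open>- q / p\<close>
  (\<open>log_young_small_set_bound\<close>). The exponential factor is exactly what lets \<open>a\<close> shrink by
  the factor \<open>exp (- 1)\<close> from one level to the next, and the power of \<open>y\<close> is the admissible
  height \<open>\<tau>\<close> of that step, up to a multiple of \<open>\<mu>\<close>. As \<open>q / p > 1\<close>, the heights for \<open>y = 1, 2, 3, \<dots>\<close> add up
  to a finite multiple of \<open>\<mu>\<close>, above which \<open>a\<close> vanishes (\<open>level_iteration\<close>).

  Sobolev's inequality enters in its weak-type form, because a truncation is compared with a
  constant on one set. For a Lipschitz function \<open>f\<close> with bounded support it follows from the
  mean \<open>\<Phi> r\<close> of \<open>f\<close> over the ball of radius \<open>r\<close> about a point \<open>x\<close>: \<open>\<Phi>\<close> runs from a multiple of \<open>f x\<close>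
  at \<open>r = 0\<close> to \<open>0\<close> at infinity, and \<open>|\<Phi>' r|\<close> is at most the mean of \<open>|\<nabla>f|\<close> over that ball. Where
  \<open>|f x|\<close> is large, the gradient must therefore be large on some ball about \<open>x\<close>, and the Vitali
  covering lemma adds up these balls (\<open>weak_Sobolev_inequality\<close>).

  The gradient of a Lipschitz function is defined pointwise, so everything depends on Rademacher's
  theorem. On a line it follows by comparing the Stieltjes measure of the function with
  multiples of Lebesgue measure on fine coverings by intervals. Tonelli's theorem turns this into the
  existence of directional derivatives almost everywhere, whose additivity in the direction is seen after
  integration over boxes; a countable dense set of directions then gives differentiability.

  The solution \<open>u\<close> is only a limit of Lipschitz functions. The energy estimate is proved for the truncations of
  these approximants, with an error that tends to \<open>0\<close>; only the sizes of level sets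
  and the integrals of \<open>f\<close> against the truncations pass to the limit. So the chain rule is applied to Lipschitz functions,
  at points where both the function and its truncation are differentiable.
\<close>

section \<open>Comparison of measures on fine coverings by balls\<close>

text \<open>
  Vitali's theorem covers almost all of \<open>E\<close> by disjoint balls on which \<open>\<mu> \<le> \<nu>\<close> and which stay inside an open
  set barely larger than \<open>E\<close>. Both measures are dominated by Lebesgue measure, so the part of \<open>E\<close> that
  is missed and the excess of the open set contribute arbitrarily little.
\<close>

lemma Vitali_measure_compare:
  fixes E :: "'a::euclidean_space set" and \<mu> \<nu> :: "'a measure"
  assumes \<mu>: "sets \<mu> = sets borel" "\<And>B. B \<in> sets borel \<Longrightarrow> emeasure \<mu> B \<le> ennreal c * emeasure lborel B"
    and \<nu>: "sets \<nu> = sets borel" "\<And>B. B \<in> sets borel \<Longrightarrow> emeasure \<nu> B \<le> ennreal c * emeasure lborel B"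
    and E: "E \<in> sets borel" and c: "0 < c"
    and fine: "\<And>x d. x \<in> E \<Longrightarrow> 0 < d \<Longrightarrow>
      \<exists>a r. 0 < r \<and> r < d \<and> x \<in> cball a r \<and> emeasure \<mu> (cball a r) \<le> emeasure \<nu> (cball a r)"
  shows "emeasure \<mu> E \<le> emeasure \<nu> E"
proof (rule ennreal_le_epsilon)
  fix e :: real assume e: "0 < e"
  have "E \<in> sets lebesgue" using E by auto
  then obtain U where U: "open U" "E \<subseteq> U" "U - E \<in> lmeasurable" "emeasure lebesgue (U - E) < ennreal (e / c)"
    using sets_lebesgue_outer_open[of E "e / c"] e c by (metis divide_pos_pos)
  have mU: "U \<in> sets borel" using U by auto
  define K where "K = {(a, r). 0 < r \<and> cball a r \<subseteq> U \<and> emeasure \<mu> (cball a r) \<le> emeasure \<nu> (cball a r)}"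
  have cov: "\<exists>i. i \<in> K \<and> x \<in> cball (fst i) (snd i) \<and> snd i < d" if x: "x \<in> E" and d: "0 < d" for x d
  proof -
    obtain s where s: "0 < s" "ball x s \<subseteq> U" using U x by (meson openE subsetD)
    obtain a r where r: "0 < r" "r < min d (s / 2)" "x \<in> cball a r" "emeasure \<mu> (cball a r) \<le> emeasure \<nu> (cball a r)"
      using fine[OF x, of "min d (s / 2)"] s d by auto
    have "cball a r \<subseteq> ball x s"
    proof
      fix y assume "y \<in> cball a r"
      then have "dist a y \<le> r" "dist a x \<le> r" using r by auto
      then show "y \<in> ball x s" using r dist_triangle3[of x y a] by auto
    qed
    then show ?thesis using r s unfolding K_def by (intro exI[of _ "(a,r)"]) auto
  qed
  have pos: "0 < snd i" if "i \<in> K" for i using that unfolding K_def by auto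
  obtain C where C: "countable C" "C \<subseteq> K"
     "pairwise (\<lambda>i j. disjnt (cball (fst i) (snd i)) (cball (fst j) (snd j))) C"
     "negligible (E - (\<Union>i\<in>C. cball (fst i) (snd i)))"
    by (rule Vitali_covering_theorem_cballs[of K snd E fst, OF pos cov])
  let ?B = "\<lambda>i::'a \<times> real. cball (fst i) (snd i)"
  have dis: "disjoint_family_on ?B C"
    using C(3) unfolding disjoint_family_on_def pairwise_def disjnt_def by auto
  have sum: "emeasure M (\<Union>i\<in>C. ?B i) = (\<integral>\<^sup>+i. emeasure M (?B i) \<partial>count_space C)" if "sets M = sets borel" for M
    using C(1) dis that by (intro emeasure_UN_countable) auto
  have mC: "(\<Union>i\<in>C. ?B i) \<in> sets borel" using C(1) by (intro sets.countable_UN') auto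
  have "emeasure lborel (E - (\<Union>i\<in>C. ?B i)) = 0"
    using C(4) mC E by (simp add: negligible_iff_emeasure0)
  then have z: "emeasure \<mu> (E - (\<Union>i\<in>C. ?B i)) = 0"
    using \<mu>(2)[of "E - (\<Union>i\<in>C. ?B i)"] mC E by auto
  have "emeasure \<mu> E \<le> emeasure \<mu> ((\<Union>i\<in>C. ?B i) \<union> (E - (\<Union>i\<in>C. ?B i)))"
    using mC E \<mu>(1) by (intro emeasure_mono) auto
  also have "\<dots> \<le> emeasure \<mu> (\<Union>i\<in>C. ?B i) + emeasure \<mu> (E - (\<Union>i\<in>C. ?B i))"
    using mC E \<mu>(1) by (intro emeasure_subadditive) auto
  also have "\<dots> = emeasure \<mu> (\<Union>i\<in>C. ?B i)" using z by simp
  also have "\<dots> \<le> emeasure \<nu> (\<Union>i\<in>C. ?B i)"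
    unfolding sum[OF \<mu>(1)] sum[OF \<nu>(1)]
    using C(2) unfolding K_def by (intro nn_integral_mono) auto
  also have "\<dots> \<le> emeasure \<nu> (E \<union> (U - E))"
  proof -
    have "?B i \<subseteq> U" if "i \<in> C" for i using C(2) that unfolding K_def by (auto simp: case_prod_unfold)
    then show ?thesis using mU E \<nu>(1) by (intro emeasure_mono) auto
  qed
  also have "\<dots> \<le> emeasure \<nu> E + emeasure \<nu> (U - E)"
    using mU E \<nu>(1) by (intro emeasure_subadditive) auto
  also have "emeasure \<nu> (U - E) \<le> ennreal c * ennreal (e / c)"
    using \<nu>(2)[of "U - E"] U(4) mU E by (auto intro!: order_trans[OF \<nu>(2)] mult_left_mono)
  also have "\<dots> = ennreal e" using c e by (simp flip: ennreal_mult)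
  finally show "emeasure \<mu> E \<le> emeasure \<nu> E + ennreal e" by simp
qed

section \<open>Lipschitz functions on the line\<close>

text \<open>
  Rational thresholds make the points without a limit a countable union of sets on which the quotients
  cross a fixed gap infinitely often.
\<close>

lemma limit_exists_iff_not_oscillating:
  fixes Q :: "real \<Rightarrow> real"
  assumes b: "\<And>s. \<bar>Q s\<bar> \<le> L"
  shows "(\<exists>l. (Q \<longlongrightarrow> l) (at 0)) \<longleftrightarrow>
    \<not> (\<exists>p\<in>\<rat>. \<exists>q\<in>\<rat>. p < q \<and> (\<exists>\<^sub>F s in at 0. Q s < p) \<and> (\<exists>\<^sub>F s in at 0. q < Q s))"
proof
  assume "\<exists>l. (Q \<longlongrightarrow> l) (at 0)"
  then obtain l where l: "(Q \<longlongrightarrow> l) (at 0)" by blast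
  show "\<not> (\<exists>p\<in>\<rat>. \<exists>q\<in>\<rat>. p < q \<and> (\<exists>\<^sub>F s in at 0. Q s < p) \<and> (\<exists>\<^sub>F s in at 0. q < Q s))"
  proof (clarify)
    fix p q :: real assume pq: "p < q" and 1: "\<exists>\<^sub>F s in at 0. Q s < p" and 2: "\<exists>\<^sub>F s in at 0. q < Q s"
    show False
    proof (cases "p < l")
      case True
      then have "\<forall>\<^sub>F s in at 0. p < Q s" using l by (simp add: order_tendstoD)
      then show ?thesis using 1 unfolding frequently_def by (auto elim!: eventually_mono notE)
    next
      case False
      then have "\<forall>\<^sub>F s in at 0. Q s < q" using l pq by (simp add: order_tendstoD)
      then show ?thesis using 2 unfolding frequently_def by (auto elim!: eventually_mono notE)
    qed
  qed
next
  assume R: "\<not> (\<exists>p\<in>\<rat>. \<exists>q\<in>\<rat>. p < q \<and> (\<exists>\<^sub>F s in at 0. Q s < p) \<and> (\<exists>\<^sub>F s in at 0. q < Q s))"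
  let ?Q = "\<lambda>s. ereal (Q s)"
  have "\<not> Liminf (at 0) ?Q < Limsup (at 0) ?Q"
  proof
    assume less: "Liminf (at 0) ?Q < Limsup (at 0) ?Q"
    obtain p' where p': "Liminf (at 0) ?Q < ereal p'" "ereal p' < Limsup (at 0) ?Q"
      using ereal_dense2[OF less] by auto
    obtain p where p: "p \<in> \<rat>" "Liminf (at 0) ?Q < ereal p" "ereal p < ereal p'"
    proof -
      obtain a where a: "Liminf (at 0) ?Q < ereal a" "ereal a < ereal p'" using ereal_dense2[OF p'(1)] by auto
      then obtain p where "p \<in> \<rat>" "a < p" "p < p'" using Rats_dense_in_real[of a p'] by auto
      then show ?thesis using that[of p] a(1) by (meson less_ereal.simps(1) order_less_trans)
    qed
    obtain q where q: "q \<in> \<rat>" "ereal p' < ereal q" "ereal q < Limsup (at 0) ?Q"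
    proof -
      obtain a where a: "ereal p' < ereal a" "ereal a < Limsup (at 0) ?Q" using ereal_dense2[OF p'(2)] by auto
      then obtain p where "p \<in> \<rat>" "p' < p" "p < a" using Rats_dense_in_real[of p' a] by auto
      then show ?thesis using that[of p] a(2) by (meson less_ereal.simps(1) order_less_trans)
    qed
    have "\<exists>\<^sub>F s in at 0. Q s < p"
    proof (rule ccontr)
      assume "\<not> (\<exists>\<^sub>F s in at 0. Q s < p)"
      then have "\<forall>\<^sub>F s in at 0. ereal p \<le> ?Q s" by (simp add: not_frequently not_less)
      then show False using p(2) Liminf_bounded[of "ereal p" ?Q "at 0"] by auto
    qed
    moreover have "\<exists>\<^sub>F s in at 0. q < Q s"
    proof (rule ccontr)
      assume "\<not> (\<exists>\<^sub>F s in at 0. q < Q s)"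
      then have "\<forall>\<^sub>F s in at 0. ?Q s \<le> ereal q" by (simp add: not_frequently not_less)
      then show False using q(3) Limsup_bounded[of ?Q "ereal q" "at 0"] by auto
    qed
    moreover have "p < q" using p q by simp
    ultimately show False using R p q by blast
  qed
  moreover have "Liminf (at (0::real)) ?Q \<le> Limsup (at 0) ?Q"
    by (rule Liminf_le_Limsup) (simp add: trivial_limit_at)
  ultimately have eq: "Liminf (at 0) ?Q = Limsup (at 0) ?Q" by simp
  have l: "ereal (-L) \<le> Liminf (at 0) ?Q"
    using abs_le_D2[OF b] by (intro Liminf_bounded always_eventually allI) (simp add: minus_le_iff)
  have u: "Limsup (at 0) ?Q \<le> ereal L"
    using abs_le_D1[OF b] by (intro Limsup_bounded always_eventually allI) simp
  obtain r where r: "Limsup (at 0) ?Q = ereal r"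
    using l u eq by (cases "Limsup (at 0) ?Q") auto
  then have "(?Q \<longlongrightarrow> ereal r) (at 0)"
    using eq by (intro Liminf_eq_Limsup) (auto simp: trivial_limit_at)
  then show "\<exists>l. (Q \<longlongrightarrow> l) (at 0)" by auto
qed

lemma frequently_at_0_iff:
  "(\<exists>\<^sub>F s in at (0::real). P s) \<longleftrightarrow> (\<forall>n::nat. \<exists>s. s \<noteq> 0 \<and> \<bar>s\<bar> < 1 / Suc n \<and> P s)"
proof -
  have "(\<exists>\<^sub>F s in at (0::real). P s) \<longleftrightarrow> (\<forall>d>0. \<exists>s. s \<noteq> 0 \<and> \<bar>s\<bar> < d \<and> P s)"
    unfolding frequently_def eventually_at by (auto simp: dist_norm)
  also have "\<dots> \<longleftrightarrow> (\<forall>n::nat. \<exists>s. s \<noteq> 0 \<and> \<bar>s\<bar> < 1 / Suc n \<and> P s)"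
  proof (intro iffI allI impI)
    fix d :: real assume *: "\<forall>n::nat. \<exists>s. s \<noteq> 0 \<and> \<bar>s\<bar> < 1 / Suc n \<and> P s" and "0 < d"
    then obtain n where "1 / Suc n < d" using nat_approx_posE by blast
    then show "\<exists>s. s \<noteq> 0 \<and> \<bar>s\<bar> < d \<and> P s" using * by (meson less_trans)
  qed auto
  finally show ?thesis .
qed

text \<open>
  For each \<open>n\<close> the union over the uncountably many \<open>s\<close> is open, hence harmless.
\<close>

lemma borel_frequently_at_0:
  fixes Q :: "real \<Rightarrow> 'a::topological_space \<Rightarrow> real"
  assumes "\<And>s. s \<noteq> 0 \<Longrightarrow> continuous_on UNIV (Q s)"
  shows "{x. \<exists>\<^sub>F s in at 0. Q s x < p} \<in> sets borel" "{x. \<exists>\<^sub>F s in at 0. p < Q s x} \<in> sets borel"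
proof -
  have "{x. \<exists>\<^sub>F s in at 0. Q s x < p} = (\<Inter>n::nat. \<Union>s\<in>{s. s \<noteq> 0 \<and> \<bar>s\<bar> < 1 / Suc n}. {x. Q s x < p})"
    unfolding frequently_at_0_iff by auto
  moreover have "open (\<Union>s\<in>{s. s \<noteq> 0 \<and> \<bar>s\<bar> < 1 / Suc n}. {x. Q s x < p})" for n :: nat
    using assms by (auto intro!: open_UN open_Collect_less)
  ultimately show "{x. \<exists>\<^sub>F s in at 0. Q s x < p} \<in> sets borel" by auto
  have "{x. \<exists>\<^sub>F s in at 0. p < Q s x} = (\<Inter>n::nat. \<Union>s\<in>{s. s \<noteq> 0 \<and> \<bar>s\<bar> < 1 / Suc n}. {x. p < Q s x})"
    unfolding frequently_at_0_iff by auto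
  moreover have "open (\<Union>s\<in>{s. s \<noteq> 0 \<and> \<bar>s\<bar> < 1 / Suc n}. {x. p < Q s x})" for n :: nat
    using assms by (auto intro!: open_UN open_Collect_less)
  ultimately show "{x. \<exists>\<^sub>F s in at 0. p < Q s x} \<in> sets borel" by auto
qed

lemma limit_nonexistence_set:
  fixes Q :: "real \<Rightarrow> 'a::topological_space \<Rightarrow> real"
  assumes "\<And>s x. \<bar>Q s x\<bar> \<le> L"
  shows "{x. \<nexists>l. ((\<lambda>s. Q s x) \<longlongrightarrow> l) (at 0)} =
    (\<Union>p\<in>\<rat>. \<Union>q\<in>{q\<in>\<rat>. p < q}. {x. \<exists>\<^sub>F s in at 0. Q s x < p} \<inter> {x. \<exists>\<^sub>F s in at 0. q < Q s x})"
proof (rule set_eqI)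
  fix x
  have "(\<nexists>l. ((\<lambda>s. Q s x) \<longlongrightarrow> l) (at 0)) \<longleftrightarrow>
      (\<exists>p\<in>\<rat>. \<exists>q\<in>\<rat>. p < q \<and> (\<exists>\<^sub>F s in at 0. Q s x < p) \<and> (\<exists>\<^sub>F s in at 0. q < Q s x))"
    using limit_exists_iff_not_oscillating[of "\<lambda>s. Q s x" L, OF assms] by argo
  then show "x \<in> {x. \<nexists>l. ((\<lambda>s. Q s x) \<longlongrightarrow> l) (at 0)} \<longleftrightarrow> x \<in> (\<Union>p\<in>\<rat>. \<Union>q\<in>{q\<in>\<rat>. p < q}. {x. \<exists>\<^sub>F s in at 0. Q s x < p} \<inter> {x. \<exists>\<^sub>F s in at 0. q < Q s x})"
    by blast
qed

lemma borel_limit_nonexistence: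
  fixes Q :: "real \<Rightarrow> 'a::topological_space \<Rightarrow> real"
  assumes "\<And>s x. \<bar>Q s x\<bar> \<le> L" and "\<And>s. s \<noteq> 0 \<Longrightarrow> continuous_on UNIV (Q s)"
  shows "{x. \<nexists>l. ((\<lambda>s. Q s x) \<longlongrightarrow> l) (at 0)} \<in> sets borel"
proof -
  have "(\<Union>q\<in>{q\<in>\<rat>. p < q}. {x. \<exists>\<^sub>F s in at 0. Q s x < p} \<inter> {x. \<exists>\<^sub>F s in at 0. q < Q s x}) \<in> sets borel" for p
  proof (rule sets.countable_UN')
    show "countable {q \<in> \<rat>. p < q}" by (rule countable_subset[OF _ countable_rat]) auto
  qed (use borel_frequently_at_0[of Q, OF assms(2)] in blast)
  then show ?thesis
    unfolding limit_nonexistence_set[OF assms(1)]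
    by (intro sets.countable_UN' countable_rat) auto
qed

text \<open>
  The function \<open>c x - h x\<close> is monotone as well, and its Stieltjes measure and that of \<open>h\<close> add up to \<open>c\<close> times
  Lebesgue measure.
\<close>

lemma emeasure_interval_measure_lipschitz:
  fixes h :: "real \<Rightarrow> real"
  assumes mono: "\<And>x y. x \<le> y \<Longrightarrow> h x \<le> h y" and lip: "\<And>x y. x \<le> y \<Longrightarrow> h y - h x \<le> c * (y - x)" and c: "0 \<le> c"
    and cont: "continuous_on UNIV h" and B: "B \<in> sets borel"
  shows "emeasure (interval_measure h) B \<le> ennreal c * emeasure lborel B"
proof -
  have rc: "continuous (at_right a) h" for a
    using cont by (simp add: continuous_on_eq_continuous_at continuous_at_imp_continuous_within)
  let ?k = "\<lambda>x. c * x - h x"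
  have km: "?k x \<le> ?k y" if "x \<le> y" for x y using lip[OF that] by (simp add: algebra_simps)
  have kc: "continuous (at_right a) ?k" for a using rc by (intro continuous_intros)
  let ?M = "\<lambda>A. emeasure (interval_measure h) A + emeasure (interval_measure ?k) A"
  define N where "N = measure_of UNIV (sets borel) ?M"
  have N: "emeasure N A = ?M A" if "A \<in> sets borel" for A
    unfolding N_def
  proof (rule emeasure_measure_of_sigma)
    show "sigma_algebra UNIV (sets (borel :: real measure))"
      using sets.sigma_algebra_axioms[of "borel :: real measure"] by simp
    show "positive (sets borel) ?M" by (simp add: positive_def)
    show "countably_additive (sets borel) ?M"
    proof (rule countably_additiveI)
      fix A :: "nat \<Rightarrow> real set"
      assume A: "range A \<subseteq> sets borel" "disjoint_family A"
      then have "(\<Sum>i. emeasure (interval_measure h) (A i)) = emeasure (interval_measure h) (\<Union>(range A))"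
        "(\<Sum>i. emeasure (interval_measure ?k) (A i)) = emeasure (interval_measure ?k) (\<Union>(range A))"
        by (auto intro!: suminf_emeasure)
      then show "(\<Sum>i. ?M (A i)) = ?M (\<Union>(range A))"
        by (subst suminf_add[symmetric]) (auto intro: summableI)
    qed
  qed (use that in auto)
  have "N = scale_measure (ennreal c) lborel"
  proof (rule measure_eqI_generator_eq[where E="range (\<lambda>(a, b::real). {a<..b})" and \<Omega>=UNIV
         and A="\<lambda>n::nat. {- real n <.. real n}"])
    show "Int_stable (range (\<lambda>(a, b::real). {a<..b}))"
      by (auto simp: Int_stable_def Int_greaterThanAtMost)
    show "sets N = sigma_sets UNIV (range (\<lambda>(a, b::real). {a<..b}))"
      unfolding N_def by (simp add: borel_sigma_sets_Ioc sigma_sets_sigma_sets_eq)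
    show "sets (scale_measure (ennreal c) lborel) = sigma_sets UNIV (range (\<lambda>(a, b::real). {a<..b}))"
      by (simp add: borel_sigma_sets_Ioc)
    fix X :: "real set" assume "X \<in> range (\<lambda>(a, b). {a<..b})"
    then obtain a b where X: "X = {a<..b}" by auto
    show "emeasure N X = emeasure (scale_measure (ennreal c) lborel) X"
    proof (cases "a \<le> b")
      case True
      have "emeasure N X = ennreal (h b - h a) + ennreal (?k b - ?k a)"
        using True emeasure_interval_measure_Ioc[of a b h] emeasure_interval_measure_Ioc[of a b ?k]
          mono km rc kc unfolding X by (subst N) auto
      also have "\<dots> = ennreal (c * (b - a))"
        using mono[OF True] km[OF True] by (subst ennreal_plus[symmetric]) (auto simp: algebra_simps)
      also have "\<dots> = emeasure (scale_measure (ennreal c) lborel) X"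
        using True c by (simp add: X ennreal_mult)
      finally show ?thesis .
    qed (simp add: X)
  next
    show "(\<Union>i::nat. {- real i<..real i}) = UNIV"
    proof (intro UNIV_eq_I[symmetric] UNIV_eq_I)
      fix x :: real
      obtain n where "\<bar>x\<bar> < real n" using reals_Archimedean2 by blast
      then show "x \<in> (\<Union>i::nat. {- real i<..real i})" by (intro UN_I[of n]) auto
    qed
    show "emeasure N {- real i<..real i} \<noteq> \<infinity>" for i
      using emeasure_interval_measure_Ioc[of "-real i" "real i" h] emeasure_interval_measure_Ioc[of "-real i" "real i" ?k]
          mono km rc kc by (subst N) (auto simp: )
  qed auto
  then have "?M B = ennreal c * emeasure lborel B" using N[OF B] B by simp
  then show ?thesis by (metis add_increasing2 order_refl zero_le)
qed

text \<open>
  After adding \<open>L x\<close> the function is increasing and has a Stieltjes measure \<open>\<mu>\<close>. On a set where difference quotients are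
  frequently below \<open>p\<close> and frequently above \<open>q > p\<close>, comparison on intervals gives both \<open>\<mu> \<le> p \<lambda>\<close> and
  \<open>q \<lambda> \<le> \<mu>\<close> for Lebesgue measure \<open>\<lambda>\<close>; so the set is null.
\<close>

lemma lipschitz_real_derivative_exists_AE:
  fixes f :: "real \<Rightarrow> real"
  assumes lip: "L-lipschitz_on UNIV f"
  shows "AE x in lborel. \<exists>l. ((\<lambda>s. (f (x + s) - f x) / s) \<longlongrightarrow> l) (at 0)"
proof -
  have L0: "0 \<le> L" using lip by (rule lipschitz_on_nonneg)
  have lip': "\<bar>f y - f x\<bar> \<le> L * \<bar>y - x\<bar>" for x y
    using lipschitz_onD[OF lip, of y x] by (simp add: dist_real_def)
  have cont: "continuous_on UNIV f" using lip by (rule lipschitz_on_continuous_on)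
  \<comment> \<open>The slopes of \<open>h\<close> lie between \<open>0\<close> and \<open>2 L\<close>; the summand \<open>1\<close> makes the bound positive.\<close>
  define c where "c = 2 * L + 1"
  define h where "h x = f x + L * x" for x
  have mono: "h x \<le> h y" if "x \<le> y" for x y
    using lip'[of y x] that by (simp add: h_def algebra_simps)
  have lipu: "h y - h x \<le> c * (y - x)" if "x \<le> y" for x y
    using lip'[of y x] that by (simp add: h_def c_def algebra_simps)
  have hc: "continuous_on UNIV h" unfolding h_def using cont by (intro continuous_intros)
  define Q where "Q s x = (h (x + s) - h x) / s" for s x
  have Qc: "continuous_on UNIV (Q s)" if "s \<noteq> 0" for s
    unfolding Q_def using that
    by (intro continuous_intros continuous_on_compose2[OF hc]) auto
  have Q0: "0 \<le> Q s x" "Q s x \<le> c" if "s \<noteq> 0" for s x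
    using mono[of x "x+s"] mono[of "x+s" x] lipu[of x "x+s"] lipu[of "x+s" x] that
    by (cases "s > 0"; simp add: Q_def field_simps)+
  have Qb: "\<bar>Q s x\<bar> \<le> c" for s x
    using Q0[of s x] L0 by (cases "s = 0") (auto simp: Q_def c_def)
  let ?\<mu> = "interval_measure h"
  have \<mu>: "emeasure ?\<mu> B \<le> ennreal c * emeasure lborel B" if "B \<in> sets borel" for B
    using emeasure_interval_measure_lipschitz[OF mono lipu _ hc that] L0 by (simp add: c_def)
  have int: "\<exists>a r. 0 < r \<and> r < d \<and> x \<in> cball a r \<and> emeasure lborel (cball a r) = ennreal \<bar>s\<bar> \<and>
      emeasure ?\<mu> (cball a r) = ennreal (Q s x * \<bar>s\<bar>)" if s: "s \<noteq> 0" "\<bar>s\<bar> < d" for s x d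
  proof -
    have eq: "cball (x + s / 2) (\<bar>s\<bar> / 2) = {min x (x + s) .. max x (x + s)}"
      unfolding cball_eq_atLeastAtMost by (auto simp: min_def max_def abs_if)
    have "emeasure ?\<mu> {min x (x + s) .. max x (x + s)} = ennreal (h (max x (x+s)) - h (min x (x+s)))"
      using mono hc by (intro emeasure_interval_measure_Icc) auto
    also have "h (max x (x+s)) - h (min x (x+s)) = Q s x * \<bar>s\<bar>"
      using s by (auto simp: Q_def max_def min_def abs_if)
    finally have 1: "emeasure ?\<mu> (cball (x + s / 2) (\<bar>s\<bar> / 2)) = ennreal (Q s x * \<bar>s\<bar>)"
      using eq by simp
    have 2: "emeasure lborel (cball (x + s / 2) (\<bar>s\<bar> / 2)) = ennreal \<bar>s\<bar>"
      unfolding eq by (auto simp: min_def max_def abs_if)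
    show ?thesis
      using 1 2 s by (intro exI[of _ "x + s/2"] exI[of _ "\<bar>s\<bar>/2"]) (auto simp: dist_real_def)
  qed
  have null: "{x. \<exists>\<^sub>F s in at 0. Q s x < p} \<inter> {x. \<exists>\<^sub>F s in at 0. q < Q s x} \<in> null_sets lborel"
    (is "?E \<in> _") if pq: "p < q" for p q
  proof -
    have E: "?E \<in> sets borel" using Qc by (intro sets.Int borel_frequently_at_0)
    show ?thesis
    proof (cases "?E = {}")
      case False
      then obtain x where x: "\<exists>\<^sub>F s in at 0. Q s x < p" "\<exists>\<^sub>F s in at 0. q < Q s x" by auto
      obtain s where s: "s \<noteq> 0" "Q s x < p" using x(1) unfolding frequently_at_0_iff by blast
      obtain s' where s': "s' \<noteq> 0" "q < Q s' x" using x(2) unfolding frequently_at_0_iff by blast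
      have p0: "0 < p" using Q0[of s x] s by simp
      have qc: "q < c" using Q0[of s' x] s' by simp
      have fr: "\<exists>s. s \<noteq> 0 \<and> \<bar>s\<bar> < d \<and> P s" if 1: "\<exists>\<^sub>F s in at 0. P s" and 2: "0 < d" for P and d :: real
      proof -
        obtain n where "1 / Suc n < d" using nat_approx_posE[OF 2] by blast
        then show ?thesis using 1 unfolding frequently_at_0_iff by (meson less_trans)
      qed
      have sc: "emeasure (scale_measure (ennreal t) lborel) B \<le> ennreal c * emeasure lborel B"
        if "t \<le> c" for t and B :: "real set"
        using that by (simp add: mult_right_mono ennreal_leI)
      have bE: "?E \<inter> cball 0 (real N) \<in> sets borel" for N using E by auto
      have up: "emeasure ?\<mu> (?E \<inter> cball 0 (real N)) \<le> emeasure (scale_measure (ennreal p) lborel) (?E \<inter> cball 0 (real N))" for N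
      proof (rule Vitali_measure_compare[where c=c])
        fix x d :: real assume x: "x \<in> ?E \<inter> cball 0 (real N)" and d: "0 < d"
        then obtain s where s: "s \<noteq> 0" "\<bar>s\<bar> < d" "Q s x < p" using fr[of "\<lambda>s. Q s x < p"] by auto
        have "ennreal (Q s x * \<bar>s\<bar>) \<le> ennreal p * ennreal \<bar>s\<bar>"
          using s p0 by (subst ennreal_mult[symmetric]) (auto intro!: ennreal_leI mult_right_mono)
        then show "\<exists>a r. 0 < r \<and> r < d \<and> x \<in> cball a r \<and> emeasure ?\<mu> (cball a r) \<le> emeasure (scale_measure (ennreal p) lborel) (cball a r)"
          using int[OF s(1,2), of x] by (metis emeasure_scale_measure)
      qed (use bE \<mu> sc pq qc p0 in auto)
      have low: "emeasure (scale_measure (ennreal q) lborel) (?E \<inter> cball 0 (real N)) \<le> emeasure ?\<mu> (?E \<inter> cball 0 (real N))" for N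
      proof (rule Vitali_measure_compare[where c=c])
        fix x d :: real assume x: "x \<in> ?E \<inter> cball 0 (real N)" and d: "0 < d"
        then obtain s where s: "s \<noteq> 0" "\<bar>s\<bar> < d" "q < Q s x" using fr[of "\<lambda>s. q < Q s x"] by auto
        have "ennreal q * ennreal \<bar>s\<bar> \<le> ennreal (Q s x * \<bar>s\<bar>)"
          using s p0 pq by (subst ennreal_mult[symmetric]) (auto intro!: ennreal_leI mult_right_mono)
        then show "\<exists>a r. 0 < r \<and> r < d \<and> x \<in> cball a r \<and> emeasure (scale_measure (ennreal q) lborel) (cball a r) \<le> emeasure ?\<mu> (cball a r)"
          using int[OF s(1,2), of x] by (metis emeasure_scale_measure)
      qed (use bE \<mu> sc pq qc p0 in auto)
      have "?E \<inter> cball 0 (real N) \<in> null_sets lborel" for N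
      proof -
        have le: "ennreal q * emeasure lborel (?E \<inter> cball 0 (real N)) \<le> ennreal p * emeasure lborel (?E \<inter> cball 0 (real N))"
          using order_trans[OF low up] by simp
        have "emeasure lborel (?E \<inter> cball 0 (real N)) \<le> emeasure lborel (cball (0::real) (real N))"
          by (intro emeasure_mono) auto
        then have "emeasure lborel (?E \<inter> cball 0 (real N)) < \<infinity>"
          using emeasure_lborel_cball_finite[of "0::real" "real N"] by (simp add: le_less_trans)
        then obtain m where m: "emeasure lborel (?E \<inter> cball 0 (real N)) = ennreal m" "0 \<le> m"
          by (metis ennreal_cases infinity_ennreal_def less_irrefl)
        have "q * m \<le> p * m" using le m p0 pq by (simp flip: ennreal_mult)
        then have "m = 0" using pq m(2) by (meson mult_less_cancel_right_disj not_less order_less_le)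
        then show ?thesis using bE[of N] m by (auto simp: null_sets_def)
      qed
      then have "(\<Union>N. ?E \<inter> cball 0 (real N)) \<in> null_sets lborel" by (rule null_sets_UN)
      moreover have "(\<Union>N. ?E \<inter> cball 0 (real N)) = ?E"
        by (auto simp: dist_real_def intro: real_arch_simple)
      ultimately show ?thesis by simp
    qed simp
  qed
  have N: "{x. \<nexists>l. ((\<lambda>s. Q s x) \<longlongrightarrow> l) (at 0)} \<in> null_sets lborel"
    unfolding limit_nonexistence_set[OF Qb]
  proof (intro null_sets_UN' countable_rat)
    fix p :: real
    show "countable {q \<in> \<rat>. p < q}" by (rule countable_subset[OF _ countable_rat]) auto
  qed (use null in blast)
  have "AE x in lborel. \<exists>l. ((\<lambda>s. Q s x) \<longlongrightarrow> l) (at 0)"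
    by (rule AE_I'[OF N]) auto
  then show ?thesis
  proof eventually_elim
    case (elim x)
    then obtain l where l: "((\<lambda>s. Q s x) \<longlongrightarrow> l) (at 0)" by blast
    have "((\<lambda>s. Q s x - L) \<longlongrightarrow> l - L) (at 0)" by (intro tendsto_intros l)
    moreover have "\<forall>\<^sub>F s in at 0. Q s x - L = (f (x + s) - f x) / s"
      unfolding eventually_at by (intro exI[of _ 1]) (auto simp: Q_def h_def field_simps)
    ultimately have "((\<lambda>s. (f (x + s) - f x) / s) \<longlongrightarrow> l - L) (at 0)"
      by (rule Lim_transform_eventually)
    then show ?case by blast
  qed
qed

section \<open>Directional derivatives\<close>

definition diff_quot :: "('a::real_vector \<Rightarrow> real) \<Rightarrow> 'a \<Rightarrow> real \<Rightarrow> 'a \<Rightarrow> real" where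
  "diff_quot f v s x = (f (x + s *\<^sub>R v) - f x) / s"

lemma abs_diff_quot_le:
  fixes f :: "'a::euclidean_space \<Rightarrow> real"
  assumes "L-lipschitz_on UNIV f"
  shows "\<bar>diff_quot f v s x\<bar> \<le> L * norm v"
proof -
  have "\<bar>f (x + s *\<^sub>R v) - f x\<bar> \<le> L * norm v * \<bar>s\<bar>"
    using lipschitz_onD[OF assms, of "x + s *\<^sub>R v" x] by (simp add: dist_norm mult.commute mult.left_commute)
  then show ?thesis
    using lipschitz_on_nonneg[OF assms] by (cases "s = 0") (auto simp: diff_quot_def field_simps)
qed

lemma continuous_on_diff_quot:
  fixes f :: "'a::euclidean_space \<Rightarrow> real"
  assumes "L-lipschitz_on UNIV f"
  shows "continuous_on UNIV (diff_quot f v s)"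
proof -
  have c: "continuous_on UNIV f" using assms by (rule lipschitz_on_continuous_on)
  have "continuous_on UNIV (\<lambda>x. (f (x + s *\<^sub>R v) - f x) * inverse s)"
    by (intro continuous_intros continuous_on_compose2[OF c]) auto
  then show ?thesis by (simp add: diff_quot_def[abs_def] divide_inverse)
qed

lemma borel_measurable_diff_quot:
  fixes f :: "'a::euclidean_space \<Rightarrow> real"
  assumes "L-lipschitz_on UNIV f"
  shows "diff_quot f v s \<in> borel_measurable borel"
  using continuous_on_diff_quot[OF assms] by (rule borel_measurable_continuous_onI)

lemma nn_integral_lborel_translate:
  fixes c :: "'a::euclidean_space"
  assumes [measurable]: "f \<in> borel_measurable borel"
  shows "(\<integral>\<^sup>+x. f (c + x) \<partial>lborel) = (\<integral>\<^sup>+x. f x \<partial>lborel)"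
proof -
  have "(\<integral>\<^sup>+x. f x \<partial>lborel) = (\<integral>\<^sup>+x. f x \<partial>distr lborel borel ((+) c))" by (simp add: lborel_distr_plus)
  also have "\<dots> = (\<integral>\<^sup>+x. f (c + x) \<partial>lborel)" by (rule nn_integral_distr) auto
  finally show ?thesis by simp
qed

lemma integral_lborel_translate:
  fixes c :: "'a::euclidean_space" and f :: "'a \<Rightarrow> real"
  assumes [measurable]: "f \<in> borel_measurable borel"
  shows "(\<integral>x. f (c + x) \<partial>lborel) = (\<integral>x. f x \<partial>lborel)"
proof -
  have "(\<integral>x. f x \<partial>lborel) = (\<integral>x. f x \<partial>distr lborel borel ((+) c))" by (simp add: lborel_distr_plus)
  also have "\<dots> = (\<integral>x. f (c + x) \<partial>lborel)" by (rule integral_distr) auto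
  finally show ?thesis by simp
qed

text \<open>
  By translation invariance, the measure of \<open>N\<close> is the average over \<open>t\<close> in \<open>[0, 1]\<close> of the measures of its translates
  by \<open>t v\<close>; interchanging the integrals leaves integrals along lines in direction \<open>v\<close>.
\<close>

lemma null_set_if_null_on_parallel_lines:
  fixes N :: "'a::euclidean_space set"
  assumes N[measurable]: "N \<in> sets borel" and lines: "\<And>x. AE t in lborel. x + t *\<^sub>R v \<notin> N"
  shows "N \<in> null_sets lborel"
proof -
  let ?I = "indicator {0..1::real} :: real \<Rightarrow> ennreal"
  have "emeasure lborel N = (\<integral>\<^sup>+t. ?I t * emeasure lborel N \<partial>lborel)"
    by (subst nn_integral_multc) auto
  also have "\<dots> = (\<integral>\<^sup>+t. ?I t * (\<integral>\<^sup>+x. indicator N (t *\<^sub>R v + x) \<partial>lborel) \<partial>lborel)"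
    by (subst nn_integral_lborel_translate) auto
  also have "\<dots> = (\<integral>\<^sup>+t. (\<integral>\<^sup>+x. ?I t * indicator N (x + t *\<^sub>R v) \<partial>lborel) \<partial>lborel)"
    by (subst nn_integral_cmult) (auto simp: add.commute)
  also have "\<dots> = (\<integral>\<^sup>+x. (\<integral>\<^sup>+t. ?I t * indicator N (x + t *\<^sub>R v) \<partial>lborel) \<partial>lborel)"
    by (rule lborel_pair.Fubini') measurable
  also have "\<dots> = (\<integral>\<^sup>+x. 0 \<partial>(lborel :: 'a measure))"
  proof (rule nn_integral_cong)
    fix x :: 'a
    have "(\<integral>\<^sup>+t. ?I t * indicator N (x + t *\<^sub>R v) \<partial>lborel) = (\<integral>\<^sup>+t. 0 \<partial>(lborel :: real measure))"
      using lines[of x] by (intro nn_integral_cong_AE) (auto elim!: eventually_mono)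
    then show "(\<integral>\<^sup>+t. ?I t * indicator N (x + t *\<^sub>R v) \<partial>lborel) = 0" by simp
  qed
  finally show ?thesis using N by (auto simp: null_sets_def)
qed

lemma lipschitz_directional_derivative_exists_AE:
  fixes f :: "'a::euclidean_space \<Rightarrow> real"
  assumes lip: "L-lipschitz_on UNIV f"
  shows "AE x in lborel. \<exists>l. ((\<lambda>s. diff_quot f v s x) \<longlongrightarrow> l) (at 0)"
proof -
  let ?N = "{x. \<nexists>l. ((\<lambda>s. diff_quot f v s x) \<longlongrightarrow> l) (at 0)}"
  have B: "?N \<in> sets borel"
    by (rule borel_limit_nonexistence[OF abs_diff_quot_le[OF lip] continuous_on_diff_quot[OF lip]])
  have "?N \<in> null_sets lborel"
  proof (rule null_set_if_null_on_parallel_lines[OF B, of v])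
    fix x
    have "(L * norm v)-lipschitz_on UNIV (\<lambda>t. f (x + t *\<^sub>R v))"
    proof (rule lipschitz_onI)
      show "dist (f (x + t *\<^sub>R v)) (f (x + s *\<^sub>R v)) \<le> L * norm v * dist t s" for t s
        using lipschitz_onD[OF lip, of "x + t *\<^sub>R v" "x + s *\<^sub>R v"]
        by (simp add: dist_norm mult.assoc mult.commute[of "norm v"] flip: scaleR_diff_left)
    qed (use lipschitz_on_nonneg[OF lip] in auto)
    from lipschitz_real_derivative_exists_AE[OF this]
    show "AE t in lborel. x + t *\<^sub>R v \<notin> ?N"
      by eventually_elim (simp add: diff_quot_def scaleR_add_left add.assoc)
  qed
  then show ?thesis by (rule AE_I') auto
qed

text \<open>
  The limit is taken along \<open>1 / (n + 1)\<close> to obtain a Borel function that is defined everywhere; where the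
  directional derivative exists, it is equal to this limit.
\<close>

definition dir_deriv :: "('a::real_vector \<Rightarrow> real) \<Rightarrow> 'a \<Rightarrow> 'a \<Rightarrow> real" where
  "dir_deriv f v x = lim (\<lambda>n. diff_quot f v (1 / Suc n) x)"

lemma borel_measurable_dir_deriv:
  fixes f :: "'a::euclidean_space \<Rightarrow> real"
  assumes "L-lipschitz_on UNIV f"
  shows "dir_deriv f v \<in> borel_measurable borel"
  unfolding dir_deriv_def[abs_def]
  by (intro borel_measurable_lim_metric borel_measurable_diff_quot[OF assms])

lemma tendsto_inverse_Suc_at_0: "filterlim (\<lambda>n. 1 / real (Suc n)) (at 0) sequentially"
  unfolding filterlim_at using LIMSEQ_inverse_real_of_nat by (auto simp: inverse_eq_divide)

lemma dir_deriv_eqI: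
  assumes "((\<lambda>s. diff_quot f v s x) \<longlongrightarrow> l) (at 0)"
  shows "dir_deriv f v x = l"
  unfolding dir_deriv_def
  using filterlim_compose[OF assms tendsto_inverse_Suc_at_0] by (rule limI)

lemma tendsto_dir_deriv_AE:
  fixes f :: "'a::euclidean_space \<Rightarrow> real"
  assumes lip: "L-lipschitz_on UNIV f"
  shows "AE x in lborel. ((\<lambda>s. diff_quot f v s x) \<longlongrightarrow> dir_deriv f v x) (at 0)"
  using lipschitz_directional_derivative_exists_AE[OF lip, of v]
  by eventually_elim (use dir_deriv_eqI in blast)

section \<open>Linearity in the direction and differentiability\<close>

text \<open>
  The measures with the densities \<open>g + c\<close> and \<open>c\<close> agree on boxes, hence on all Borel sets.
\<close>

lemma AE_eq_0_if_box_integrals_0: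
  fixes g :: "'a::euclidean_space \<Rightarrow> real"
  assumes [measurable]: "g \<in> borel_measurable borel" and bound: "AE x in lborel. \<bar>g x\<bar> \<le> c" and c: "0 \<le> c"
    and 0: "\<And>a b. (\<integral>x. indicator (box a b) x * g x \<partial>lborel) = 0"
  shows "AE x in lborel. g x = 0"
proof -
  let ?M = "density lborel (\<lambda>x. ennreal (g x + c))" and ?N = "density lborel (\<lambda>x. ennreal c)"
  have fin: "emeasure lborel (box a b) < \<infinity>" for a b :: 'a
    by (rule order_le_less_trans[OF _ emeasure_lborel_cbox_finite[of a b]]) (intro emeasure_mono box_subset_cbox, auto)
  have box: "emeasure ?M (box a b) = emeasure ?N (box a b)" for a b
  proof -
    have ic: "integrable lborel (\<lambda>x. indicator (box a b) x * c)" for c :: real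
      using fin[of a b] by (intro integrable_mult_left integrable_real_indicator) auto
    have ig: "integrable lborel (\<lambda>x. indicator (box a b) x * g x)"
      by (rule Bochner_Integration.integrable_bound[OF ic[of c]])
        (use bound in \<open>auto elim!: eventually_mono simp: indicator_def\<close>)
    have "emeasure ?M (box a b) = (\<integral>\<^sup>+x. ennreal (indicator (box a b) x * g x + indicator (box a b) x * c) \<partial>lborel)"
      by (subst emeasure_density) (auto intro!: nn_integral_cong simp: indicator_def)
    also have "\<dots> = ennreal (\<integral>x. indicator (box a b) x * g x + indicator (box a b) x * c \<partial>lborel)"
      using ig ic bound by (intro nn_integral_eq_integral) (auto elim!: eventually_mono simp: indicator_def)
    also have "\<dots> = ennreal (\<integral>x. indicator (box a b) x * c \<partial>lborel)"
      using ig ic 0 by simp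
    also have "\<dots> = (\<integral>\<^sup>+x. ennreal (indicator (box a b) x * c) \<partial>lborel)"
      using ic c by (intro nn_integral_eq_integral[symmetric]) auto
    also have "\<dots> = emeasure ?N (box a b)"
      by (subst emeasure_density) (auto intro!: nn_integral_cong simp: indicator_def)
    finally show ?thesis .
  qed
  have "?M = ?N"
  proof (rule measure_eqI_generator_eq[where E="range (\<lambda>(a, b::'a). box a b)" and \<Omega>=UNIV
         and A="\<lambda>n::nat. box (- real n *\<^sub>R One) (real n *\<^sub>R One)"])
    show "Int_stable (range (\<lambda>(a, b::'a). box a b))"
      by (auto simp: Int_stable_def box_Int_box)
    show "emeasure ?M X = emeasure ?N X" if "X \<in> range (\<lambda>(a, b::'a). box a b)" for X using box that by auto
    show "(\<Union>i::nat. box (- real i *\<^sub>R One) (real i *\<^sub>R One)) = (UNIV :: 'a set)"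
      using UN_box_eq_UNIV by simp
    show "emeasure ?M (box (- real i *\<^sub>R One) (real i *\<^sub>R One)) \<noteq> \<infinity>" for i
    proof -
      have "emeasure ?N (box a b) = ennreal c * emeasure lborel (box a b)" for a b :: 'a
        by (simp add: emeasure_density nn_integral_cmult)
      then have "emeasure ?N (box a b) < \<infinity>" for a b :: 'a using fin[of a b] by (simp add: ennreal_mult_less_top)
      then show ?thesis unfolding box by (simp add: less_top)
    qed
  qed (auto simp: borel_eq_box)
  then have "AE x in lborel. ennreal (g x + c) = ennreal c"
    by (intro sigma_finite_measure.density_unique[OF sigma_finite_lborel]) auto
  with bound show ?thesis by eventually_elim (use c in auto)
qed

text \<open>
  The shift by \<open>u / (n + 1)\<close> lets the differences along \<open>u + v\<close> be split into two steps. It is moved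
  to the indicator of the box, which converges off the boundary of the box, and dominated convergence applies.
\<close>

lemma tendsto_integral_diff_quot:
  fixes f :: "'a::euclidean_space \<Rightarrow> real"
  assumes lip: "L-lipschitz_on UNIV f"
  shows "(\<lambda>n. \<integral>x. indicator (box a b) x * diff_quot f v (1 / Suc n) (x + (1 / Suc n) *\<^sub>R u) \<partial>lborel)
     \<longlonglongrightarrow> (\<integral>x. indicator (box a b) x * dir_deriv f v x \<partial>lborel)"
proof -
  note [measurable] = borel_measurable_diff_quot[OF lip] borel_measurable_dir_deriv[OF lip]
  let ?s = "\<lambda>n. 1 / real (Suc n)"
  let ?B = "box a b"
  define F where "F n x = indicator ?B (x - ?s n *\<^sub>R u) * diff_quot f v (?s n) x" for n x
  obtain R where R: "\<And>x. x \<in> ?B \<Longrightarrow> norm x \<le> R" using bounded_box[of a b] bounded_iff by metis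
  have L0: "0 \<le> L" using lip by (rule lipschitz_on_nonneg)
  have "(\<lambda>n. \<integral>x. F n x \<partial>lborel) \<longlonglongrightarrow> (\<integral>x. indicator ?B x * dir_deriv f v x \<partial>lborel)"
  proof (rule integral_dominated_convergence[where w="\<lambda>x. indicator (cball (0::'a) (R + norm u)) x * (L * norm v)"])
    show "integrable lborel (\<lambda>x. indicator (cball (0::'a) (R + norm u)) x * (L * norm v))"
      using emeasure_lborel_cball_finite[of "0::'a" "R + norm u"]
      by (intro integrable_mult_left integrable_real_indicator) auto
    have fr: "frontier ?B \<in> null_sets lborel"
    proof -
      have "negligible (frontier ?B)" by (rule negligible_convex_frontier) (rule convex_box)
      then show ?thesis by (simp add: negligible_iff_null_sets null_sets_completion_iff)
    qed
    have "AE x in lborel. x \<notin> frontier ?B" by (rule AE_not_in[OF fr])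
    then show "AE x in lborel. (\<lambda>n. F n x) \<longlonglongrightarrow> indicator ?B x * dir_deriv f v x"
      using tendsto_dir_deriv_AE[OF lip, of v]
    proof eventually_elim
      case (elim x)
      have 1: "(\<lambda>n. diff_quot f v (?s n) x) \<longlonglongrightarrow> dir_deriv f v x"
        by (rule filterlim_compose[OF elim(2) tendsto_inverse_Suc_at_0])
      have "(\<lambda>n. x - ?s n *\<^sub>R u) \<longlonglongrightarrow> x - 0 *\<^sub>R u"
        using LIMSEQ_inverse_real_of_nat by (intro tendsto_intros) (simp add: inverse_eq_divide)
      then have l: "(\<lambda>n. x - ?s n *\<^sub>R u) \<longlonglongrightarrow> x" by simp
      have "\<forall>\<^sub>F n in sequentially. indicator ?B (x - ?s n *\<^sub>R u) = (indicator ?B x :: real)"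
      proof (cases "x \<in> ?B")
        case True
        with topological_tendstoD[OF l open_box True] show ?thesis
          by (auto elim!: eventually_mono simp: indicator_def)
      next
        case False
        then have "x \<in> - closure ?B" using elim(1) by (auto simp: frontier_def interior_open open_box)
        with topological_tendstoD[OF l, of "- closure ?B"]
        have "\<forall>\<^sub>F n in sequentially. x - ?s n *\<^sub>R u \<in> - closure ?B" by (simp only: open_Compl closed_closure)
        with False show ?thesis
          using closure_subset[of ?B] by (auto elim!: eventually_mono simp: indicator_def)
      qed
      then have 2: "(\<lambda>n. indicator ?B (x - ?s n *\<^sub>R u) :: real) \<longlonglongrightarrow> indicator ?B x"
        by (rule tendsto_eventually)
      show ?case unfolding F_def by (intro tendsto_mult 1 2)
    qed
    fix n
    show "F n \<in> borel_measurable lborel" unfolding F_def by measurable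
    show "AE x in lborel. norm (F n x) \<le> indicator (cball (0::'a) (R + norm u)) x * (L * norm v)"
    proof (rule AE_I2)
      fix x
      show "norm (F n x) \<le> indicator (cball (0::'a) (R + norm u)) x * (L * norm v)"
      proof (cases "x - ?s n *\<^sub>R u \<in> ?B")
        case True
        have "norm x \<le> norm (x - ?s n *\<^sub>R u) + norm (?s n *\<^sub>R u)" using norm_triangle_ineq[of "x - ?s n *\<^sub>R u" "?s n *\<^sub>R u"] by simp
        also have "norm (?s n *\<^sub>R u) \<le> norm u" using mult_left_le_one_le[of "norm u" "?s n"] by simp
        finally have "norm x \<le> R + norm u" using R[OF True] by linarith
        then show ?thesis using abs_diff_quot_le[OF lip, of v "?s n" x] using L0 by (simp add: F_def abs_mult indicator_def)
      qed (use L0 in \<open>simp add: F_def\<close>)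
    qed
  qed (measurable)
  moreover have "(\<integral>x. F n x \<partial>lborel) = (\<integral>x. indicator ?B x * diff_quot f v (?s n) (x + ?s n *\<^sub>R u) \<partial>lborel)" for n
  proof -
    have "F n \<in> borel_measurable borel" unfolding F_def by measurable
    from integral_lborel_translate[OF this, of "?s n *\<^sub>R u"] show ?thesis by (simp add: F_def add.commute)
  qed
  ultimately show ?thesis by simp
qed

lemma diff_quot_add:
  "diff_quot f (u + v) s x = diff_quot f v s (x + s *\<^sub>R u) + diff_quot f u s x"
  by (simp add: diff_quot_def scaleR_add_right add.assoc flip: add_divide_distrib)

lemma abs_dir_deriv_le_AE:
  fixes f :: "'a::euclidean_space \<Rightarrow> real"
  assumes lip: "L-lipschitz_on UNIV f"
  shows "AE x in lborel. \<bar>dir_deriv f v x\<bar> \<le> L * norm v"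
  using tendsto_dir_deriv_AE[OF lip, of v]
proof eventually_elim
  case (elim x)
  show ?case
    by (rule tendsto_upperbound[OF tendsto_rabs[OF elim]]) (auto intro!: always_eventually abs_diff_quot_le[OF lip])
qed

text \<open>
  An increment along \<open>u + v\<close> is an increment along \<open>u\<close> followed by one along \<open>v\<close> from a shifted point. Pointwise
  the shift could spoil the limit; after integration over a box it does not.
\<close>

lemma dir_deriv_add_AE:
  fixes f :: "'a::euclidean_space \<Rightarrow> real"
  assumes lip: "L-lipschitz_on UNIV f"
  shows "AE x in lborel. dir_deriv f (u + v) x = dir_deriv f u x + dir_deriv f v x"
proof -
  note [measurable] = borel_measurable_diff_quot[OF lip] borel_measurable_dir_deriv[OF lip]
  have L0: "0 \<le> L" using lip by (rule lipschitz_on_nonneg)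
  let ?s = "\<lambda>n. 1 / real (Suc n)"
  have int: "integrable lborel (\<lambda>x. indicator (box a b) x * h x)"
    if [measurable]: "h \<in> borel_measurable borel" and h: "AE x in lborel. \<bar>h x\<bar> \<le> c" and c: "0 \<le> c"
    for h :: "'a \<Rightarrow> real" and a b c
  proof (rule Bochner_Integration.integrable_bound)
    have "emeasure lborel (box a b) < \<infinity>"
      by (rule order_le_less_trans[OF _ emeasure_lborel_cbox_finite[of a b]]) (intro emeasure_mono box_subset_cbox, auto)
    then show "integrable lborel (\<lambda>x. indicator (box a b) x * c)"
      by (intro integrable_mult_left integrable_real_indicator) auto
    show "AE x in lborel. norm (indicator (box a b) x * h x) \<le> norm (indicator (box a b) x * c)"
      using h by eventually_elim (use c in \<open>auto simp: indicator_def\<close>)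
  qed measurable
  have iq: "integrable lborel (\<lambda>x. indicator (box a b) x * diff_quot f w s (x + z))" for a b w s z
    by (rule int[where c="L * norm w"]) (use abs_diff_quot_le[OF lip] L0 in auto)
  have id: "integrable lborel (\<lambda>x. indicator (box a b) x * dir_deriv f w x)" for a b w
    by (rule int[where c="L * norm w"]) (use abs_dir_deriv_le_AE[OF lip] L0 in auto)
  have "AE x in lborel. dir_deriv f (u + v) x - (dir_deriv f u x + dir_deriv f v x) = 0"
  proof (rule AE_eq_0_if_box_integrals_0[where c="L * norm (u + v) + (L * norm u + L * norm v)"])
    show "AE x in lborel. \<bar>dir_deriv f (u + v) x - (dir_deriv f u x + dir_deriv f v x)\<bar>
       \<le> L * norm (u + v) + (L * norm u + L * norm v)"
      using abs_dir_deriv_le_AE[OF lip, of u] abs_dir_deriv_le_AE[OF lip, of v] abs_dir_deriv_le_AE[OF lip, of "u + v"]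
      by eventually_elim linarith
    fix a b :: 'a
    let ?J = "\<lambda>h. \<integral>x. indicator (box a b) x * h x \<partial>lborel"
    have "(\<lambda>n. ?J (\<lambda>x. diff_quot f v (?s n) (x + ?s n *\<^sub>R u)) + ?J (\<lambda>x. diff_quot f u (?s n) x))
        \<longlonglongrightarrow> ?J (dir_deriv f v) + ?J (dir_deriv f u)"
      by (intro tendsto_add tendsto_integral_diff_quot[OF lip] tendsto_integral_diff_quot[OF lip, where u=0, unfolded scaleR_zero_right add_0_right])
    moreover have "?J (\<lambda>x. diff_quot f v (?s n) (x + ?s n *\<^sub>R u)) + ?J (\<lambda>x. diff_quot f u (?s n) x) =
        ?J (diff_quot f (u + v) (?s n))" for n
      using iq iq[where z=0, simplified]
      by (subst Bochner_Integration.integral_add[symmetric]) (auto simp: diff_quot_add distrib_left)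
    moreover have "(\<lambda>n. ?J (diff_quot f (u + v) (?s n))) \<longlonglongrightarrow> ?J (dir_deriv f (u + v))"
      by (rule tendsto_integral_diff_quot[OF lip, where u=0, unfolded scaleR_zero_right add_0_right])
    ultimately have "?J (dir_deriv f (u + v)) = ?J (dir_deriv f v) + ?J (dir_deriv f u)"
      by (metis (no_types, lifting) LIMSEQ_unique ext)
    then show "?J (\<lambda>x. dir_deriv f (u + v) x - (dir_deriv f u x + dir_deriv f v x)) = 0"
      using id by (simp add: right_diff_distrib distrib_left)
  qed (use L0 in auto)
  then show ?thesis by eventually_elim simp
qed

lemma dir_deriv_scale_AE:
  fixes f :: "'a::euclidean_space \<Rightarrow> real"
  assumes lip: "L-lipschitz_on UNIV f"
  shows "AE x in lborel. dir_deriv f (c *\<^sub>R v) x = c * dir_deriv f v x"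
  using tendsto_dir_deriv_AE[OF lip, of v]
proof eventually_elim
  case (elim x)
  show ?case
  proof (cases "c = 0")
    case False
    have "filterlim (\<lambda>s. s * c) (at 0) (at (0::real))"
      using False by (auto simp: filterlim_at eventually_at intro!: tendsto_mult_left_zero exI[of _ 1])
    from tendsto_mult_left[OF filterlim_compose[OF elim this], of c]
    have "((\<lambda>s. c * diff_quot f v (s * c) x) \<longlongrightarrow> c * dir_deriv f v x) (at 0)" .
    moreover have "c * diff_quot f v (s * c) x = diff_quot f (c *\<^sub>R v) s x" for s
      using False by (simp add: diff_quot_def)
    ultimately show ?thesis by (simp add: dir_deriv_eqI)
  qed (simp add: dir_deriv_eqI diff_quot_def)
qed

lemma dir_deriv_linear_AE:
  fixes f :: "'a::euclidean_space \<Rightarrow> real"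
  assumes lip: "L-lipschitz_on UNIV f"
  shows "AE x in lborel. dir_deriv f v x = (\<Sum>b\<in>Basis. dir_deriv f b x *\<^sub>R b) \<bullet> v"
proof -
  have "AE x in lborel. dir_deriv f (\<Sum>b\<in>S. (v \<bullet> b) *\<^sub>R b) x = (\<Sum>b\<in>S. (v \<bullet> b) * dir_deriv f b x)"
    if "finite S" for S
    using that
  proof (induction S)
    case (insert b S)
    from insert.IH dir_deriv_scale_AE[OF lip, of "v \<bullet> b" b]
      dir_deriv_add_AE[OF lip, of "(v \<bullet> b) *\<^sub>R b" "\<Sum>b\<in>S. (v \<bullet> b) *\<^sub>R b"]
    show ?case by eventually_elim (simp add: insert.hyps)
  qed (simp add: dir_deriv_eqI diff_quot_def)
  from this[OF finite_Basis] show ?thesis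
    by eventually_elim (simp add: euclidean_representation inner_sum_right inner_commute[of _ v] mult.commute)
qed

text \<open>
  At almost every point the directional derivatives in a countable dense set of directions are given by one vector
  \<open>G x\<close>. Finitely many of these directions approximate the whole unit sphere, and the Lipschitz bound
  controls the error made by replacing a direction by a nearby one.
\<close>

theorem Rademacher:
  fixes f :: "'a::euclidean_space \<Rightarrow> real"
  assumes lip: "L-lipschitz_on UNIV f"
  obtains G where "G \<in> borel_measurable borel" "AE x in lborel. (f has_derivative (\<lambda>h. G x \<bullet> h)) (at x)"
proof -
  define G where "G x = (\<Sum>b\<in>Basis. dir_deriv f b x *\<^sub>R b)" for x
  note [measurable] = borel_measurable_dir_deriv[OF lip]
  have "G \<in> borel_measurable borel" unfolding G_def by measurable
  moreover
  obtain D :: "'a set" where D: "countable D" "\<And>U. open U \<Longrightarrow> U \<noteq> {} \<Longrightarrow> \<exists>d\<in>D. d \<in> U"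
    using countable_dense_setE by blast
  have "AE x in lborel. \<forall>d\<in>D. ((\<lambda>s. diff_quot f d s x) \<longlongrightarrow> G x \<bullet> d) (at 0)"
  proof (rule AE_ball_countable'[OF _ D(1)])
    show "AE x in lborel. ((\<lambda>s. diff_quot f d s x) \<longlongrightarrow> G x \<bullet> d) (at 0)" for d
      using tendsto_dir_deriv_AE[OF lip, of d] dir_deriv_linear_AE[OF lip, of d]
      by eventually_elim (simp add: G_def)
  qed
  then have "AE x in lborel. (f has_derivative (\<lambda>h. G x \<bullet> h)) (at x)"
  proof eventually_elim
    case (elim x)
    show ?case unfolding has_derivative_at_alt
    proof (intro conjI allI impI bounded_linear_inner_right)
      fix e :: real assume e: "0 < e"
      \<comment> \<open>Replacing a direction by one at distance \<open>\<delta>\<close> changes both difference quotient and linear form by less than \<open>K \<delta> = e / 2\<close> in total.\<close>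
      define K where "K = L + norm (G x) + 1"
      have L0: "0 \<le> L" using lip by (rule lipschitz_on_nonneg)
      have K: "0 < K" unfolding K_def using L0 norm_ge_zero[of "G x"] by linarith
      define \<delta> where "\<delta> = e / (2 * K)"
      have \<delta>: "0 < \<delta>" using e K by (simp add: \<delta>_def)
      have "sphere 0 1 \<subseteq> (\<Union>d\<in>D. ball d \<delta>)"
      proof
        fix u :: 'a
        obtain d where "d \<in> D" "d \<in> ball u \<delta>" using D(2)[of "ball u \<delta>"] \<delta> by auto
        then show "u \<in> (\<Union>d\<in>D. ball d \<delta>)" by (auto simp: dist_commute)
      qed
      then obtain F where F: "F \<subseteq> D" "finite F" "sphere 0 1 \<subseteq> (\<Union>d\<in>F. ball d \<delta>)"
        using compactE_image[OF compact_sphere, of D "\<lambda>d. ball d \<delta>" "0::'a" 1] by (metis open_ball)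
      have "\<forall>\<^sub>F s in at 0. \<forall>d\<in>F. \<bar>diff_quot f d s x - G x \<bullet> d\<bar> < e / 2"
      proof (intro eventually_ball_finite F ballI)
        fix d assume "d \<in> F"
        then have "((\<lambda>s. diff_quot f d s x) \<longlongrightarrow> G x \<bullet> d) (at 0)" using elim F by blast
        from tendstoD[OF this, of "e / 2"] e
        show "\<forall>\<^sub>F s in at 0. \<bar>diff_quot f d s x - G x \<bullet> d\<bar> < e / 2" by (simp add: dist_real_def)
      qed
      then obtain r where r: "0 < r" "\<And>s d. s \<noteq> 0 \<Longrightarrow> \<bar>s\<bar> < r \<Longrightarrow> d \<in> F \<Longrightarrow> \<bar>diff_quot f d s x - G x \<bullet> d\<bar> < e / 2"
        unfolding eventually_at by (auto simp: dist_real_def)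
      show "\<exists>d>0. \<forall>y. norm (y - x) < d \<longrightarrow> norm (f y - f x - G x \<bullet> (y - x)) \<le> e * norm (y - x)"
      proof (intro exI[of _ r] conjI r allI impI)
        fix y assume y: "norm (y - x) < r"
        show "norm (f y - f x - G x \<bullet> (y - x)) \<le> e * norm (y - x)"
        proof (cases "y = x")
          case False
          define s where "s = norm (y - x)"
          define u where "u = (y - x) /\<^sub>R s"
          have s: "0 < s" "s < r" using False y by (auto simp: s_def)
          have yu: "y - x = s *\<^sub>R u" using s by (simp add: u_def)
          have "norm u = 1" using s by (simp add: u_def s_def)
          then obtain d where d: "d \<in> F" "norm (d - u) < \<delta>" using F(3) by (force simp: dist_norm)
          have 1: "\<bar>f y - f (x + s *\<^sub>R d)\<bar> \<le> L * (s * \<delta>)"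
          proof -
            have "y - (x + s *\<^sub>R d) = s *\<^sub>R (u - d)" using yu by (simp add: algebra_simps)
            then have "dist y (x + s *\<^sub>R d) \<le> s * \<delta>" using s d by (simp add: dist_norm norm_minus_commute)
            then have "L * dist y (x + s *\<^sub>R d) \<le> L * (s * \<delta>)" using L0 by (intro mult_left_mono) auto
            with lipschitz_onD[OF lip, of y "x + s *\<^sub>R d"] show ?thesis by (simp add: dist_real_def)
          qed
          have "\<bar>f (x + s *\<^sub>R d) - f x - s * (G x \<bullet> d)\<bar> = s * \<bar>diff_quot f d s x - G x \<bullet> d\<bar>"
            using s by (simp add: diff_quot_def abs_if field_simps)
          also have "\<dots> \<le> s * (e / 2)" using r(2)[of s d] s d by (intro mult_left_mono) auto
          finally have 2: "\<bar>f (x + s *\<^sub>R d) - f x - s * (G x \<bullet> d)\<bar> \<le> s * (e / 2)" .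
          have "\<bar>G x \<bullet> (d - u)\<bar> \<le> norm (G x) * \<delta>"
            using Cauchy_Schwarz_ineq2[of "G x" "d - u"] d mult_left_mono[of "norm (d - u)" \<delta> "norm (G x)"] by auto
          then have "s * \<bar>G x \<bullet> d - G x \<bullet> u\<bar> \<le> s * (norm (G x) * \<delta>)"
            using s by (intro mult_left_mono) (auto simp: inner_diff_right)
          then have 3: "\<bar>s * (G x \<bullet> d) - G x \<bullet> (y - x)\<bar> \<le> s * (norm (G x) * \<delta>)"
            using s by (simp add: yu abs_mult flip: right_diff_distrib)
          have "\<bar>f y - f x - G x \<bullet> (y - x)\<bar> \<le> L * (s * \<delta>) + s * (e / 2) + s * (norm (G x) * \<delta>)"
            using 1 2 3 by linarith
          also have "\<dots> = s * ((L + norm (G x)) * \<delta> + e / 2)" by (simp add: algebra_simps)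
          also have "\<dots> \<le> s * e"
          proof (intro mult_left_mono)
            have "(L + norm (G x)) * \<delta> \<le> K * \<delta>" using \<delta> by (intro mult_right_mono) (auto simp: K_def)
            also have "K * \<delta> = e / 2" using K by (simp add: \<delta>_def)
            finally show "(L + norm (G x)) * \<delta> + e / 2 \<le> e" by simp
          qed (use s in auto)
          finally show ?thesis by (simp add: s_def mult.commute)
        qed simp
      qed
    qed
  qed
  ultimately show ?thesis by (rule that)
qed

section \<open>Means over dilated balls\<close>

lemma cball_in_sets_borel [measurable]: "cball (a::'a::euclidean_space) r \<in> sets borel"
  by simp

lemma AE_lborel_affine:
  fixes x :: "'a::euclidean_space"
  assumes P: "AE z in lborel. P z" and r: "r \<noteq> 0"
  shows "AE y in lborel. P (x + r *\<^sub>R y)"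
proof -
  obtain N where N: "{z. \<not> P z} \<subseteq> N" "N \<in> null_sets lborel"
    using AE_E[OF P] by (auto simp: null_sets_def)
  let ?T = "\<lambda>y. x + r *\<^sub>R y"
  have [measurable]: "N \<in> sets borel" using N by (auto simp: null_sets_def)
  have "0 = emeasure (density (distr lborel borel ?T) (\<lambda>_. \<bar>r\<bar> ^ DIM('a))) N"
    using N(2) lborel_affine[OF r, of x] by (auto simp: null_sets_def)
  also have "\<dots> = ennreal (\<bar>r\<bar> ^ DIM('a)) * emeasure lborel (?T -` N)"
    by (simp add: emeasure_density nn_integral_cmult emeasure_distr)
  finally have "?T -` N \<in> null_sets lborel"
    using r measurable_sets[of ?T borel borel N] by (auto simp: null_sets_def)
  then show ?thesis by (rule AE_I') (use N(1) in auto)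
qed

lemma nn_integral_lborel_affine:
  fixes x :: "'a::euclidean_space"
  assumes [measurable]: "f \<in> borel_measurable borel" and r: "r \<noteq> 0"
  shows "(\<integral>\<^sup>+z. f z \<partial>lborel) = ennreal (\<bar>r\<bar> ^ DIM('a)) * (\<integral>\<^sup>+y. f (x + r *\<^sub>R y) \<partial>lborel)"
  by (subst lborel_affine[OF r, of x]) (simp add: nn_integral_density nn_integral_distr nn_integral_cmult)

lemma has_derivative_imp_tendsto_diff_quot:
  fixes f :: "'a::euclidean_space \<Rightarrow> real"
  assumes "(f has_derivative (\<lambda>h. g \<bullet> h)) (at x)"
  shows "((\<lambda>s. diff_quot f v s x) \<longlongrightarrow> g \<bullet> v) (at 0)"
proof -
  have "((\<lambda>s. x + s *\<^sub>R v) has_derivative (\<lambda>s. s *\<^sub>R v)) (at 0)"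
    by (auto intro!: derivative_eq_intros)
  from has_derivative_compose[OF this, of f "\<lambda>h. g \<bullet> h"] assms
  have "((\<lambda>s. f (x + s *\<^sub>R v)) has_derivative (\<lambda>s. s * (g \<bullet> v))) (at 0)" by simp
  then have "((\<lambda>s. f (x + s *\<^sub>R v)) has_field_derivative (g \<bullet> v)) (at 0)"
    by (simp add: has_field_derivative_def mult_commute_abs)
  then show ?thesis by (simp add: DERIV_def diff_quot_def)
qed

lemma norm_derivative_le_lipschitz:
  fixes f :: "'a::euclidean_space \<Rightarrow> real"
  assumes lip: "L-lipschitz_on UNIV f" and d: "(f has_derivative (\<lambda>h. g \<bullet> h)) (at x)"
  shows "norm g \<le> L"
proof -
  have "\<bar>g \<bullet> g\<bar> \<le> L * norm g"
    by (rule tendsto_upperbound[OF tendsto_rabs[OF has_derivative_imp_tendsto_diff_quot[OF d]]])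
      (auto intro!: always_eventually abs_diff_quot_le[OF lip])
  then have "norm g * norm g \<le> L * norm g" by (simp add: dot_square_norm power2_eq_square)
  then show ?thesis using lipschitz_on_nonneg[OF lip] by (cases "g = 0") auto
qed

lemma lipschitz_borel_measurable:
  fixes f :: "'a::euclidean_space \<Rightarrow> real"
  assumes "L-lipschitz_on UNIV f"
  shows "f \<in> borel_measurable borel"
  using assms by (intro borel_measurable_continuous_onI lipschitz_on_continuous_on)

text \<open>
  The integral over the ball of radius \<open>r\<close> about \<open>x\<close>, rescaled to the unit ball so that the
  domain does not depend on \<open>r\<close>; it is not divided by the volume of the unit ball.
\<close>

definition dilation_mean :: "('a::euclidean_space \<Rightarrow> real) \<Rightarrow> 'a \<Rightarrow> real \<Rightarrow> real" where
  "dilation_mean f x r = (\<integral>y. indicator (cball 0 1) y * f (x + r *\<^sub>R y) \<partial>lborel)"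

lemma integrable_indicator_cball_mult:
  fixes h :: "'a::euclidean_space \<Rightarrow> real"
  assumes [measurable]: "h \<in> borel_measurable borel" and h: "AE y in lborel. y \<in> cball 0 1 \<longrightarrow> \<bar>h y\<bar> \<le> c"
  shows "integrable lborel (\<lambda>y. indicator (cball 0 1) y * h y)"
proof (rule Bochner_Integration.integrable_bound)
  show "integrable lborel (\<lambda>y. indicator (cball (0::'a) 1) y * \<bar>c\<bar>)"
    using emeasure_lborel_cball_finite[of "0::'a" 1] by (intro integrable_mult_left integrable_real_indicator) auto
  show "AE y in lborel. norm (indicator (cball 0 1) y * h y) \<le> norm (indicator (cball 0 1) y * \<bar>c\<bar>)"
    using h by eventually_elim (auto simp: indicator_def)
qed measurable

context
  fixes f :: "'a::euclidean_space \<Rightarrow> real" and G L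
  assumes lip: "L-lipschitz_on UNIV f" and G[measurable]: "G \<in> borel_measurable borel"
    and der: "AE x in lborel. (f has_derivative (\<lambda>h. G x \<bullet> h)) (at x)"
begin

lemma integrable_dilation: "integrable lborel (\<lambda>y. indicator (cball 0 1) y * f (x + r *\<^sub>R y))"
proof -
  note [measurable] = lipschitz_borel_measurable[OF lip]
  show ?thesis
  proof (rule integrable_indicator_cball_mult)
  have "\<bar>f (x + r *\<^sub>R y)\<bar> \<le> \<bar>f x\<bar> + L * \<bar>r\<bar>" if "y \<in> cball 0 1" for y
  proof -
    have "\<bar>f (x + r *\<^sub>R y) - f x\<bar> \<le> L * (\<bar>r\<bar> * norm y)"
      using lipschitz_onD[OF lip, of "x + r *\<^sub>R y" x] by (simp add: dist_norm)
    also have "\<dots> \<le> L * (\<bar>r\<bar> * 1)"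
      using that lipschitz_on_nonneg[OF lip] by (intro mult_left_mono) auto
    finally show ?thesis by linarith
  qed
  then show "AE y in lborel. y \<in> cball 0 1 \<longrightarrow> \<bar>f (x + r *\<^sub>R y)\<bar> \<le> \<bar>f x\<bar> + L * \<bar>r\<bar>" by simp
  qed measurable
qed

text \<open>
  Dilations preserve null sets, so for every \<open>r \<noteq> 0\<close> the function is differentiable at \<open>x + r y\<close> for
  almost every \<open>y\<close>, and the difference quotients are bounded by the Lipschitz constant.
\<close>

lemma dilation_mean_has_derivative:
  assumes r: "r \<noteq> 0"
  shows "(dilation_mean f x has_field_derivative
    (\<integral>y. indicator (cball 0 1) y * (G (x + r *\<^sub>R y) \<bullet> y) \<partial>lborel)) (at r)"
  unfolding DERIV_def tendsto_at_iff_sequentially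
proof (intro allI impI)
  note [measurable] = lipschitz_borel_measurable[OF lip]
  fix X :: "nat \<Rightarrow> real" assume X0: "\<forall>i. X i \<in> UNIV - {0}" and X: "X \<longlonglongrightarrow> 0"
  have XF: "filterlim X (at 0) sequentially" using X X0 by (auto simp: filterlim_at)
  let ?q = "\<lambda>i y. indicator (cball 0 1) y * diff_quot f y (X i) (x + r *\<^sub>R y)"
  have "(\<lambda>i. \<integral>y. ?q i y \<partial>lborel) \<longlonglongrightarrow> (\<integral>y. indicator (cball 0 1) y * (G (x + r *\<^sub>R y) \<bullet> y) \<partial>lborel)"
  proof (rule integral_dominated_convergence[where w="\<lambda>y. indicator (cball 0 1) y * L"])
    show "integrable lborel (\<lambda>y. indicator (cball (0::'a) 1) y * L)"
      using emeasure_lborel_cball_finite[of "0::'a" 1] by (intro integrable_mult_left integrable_real_indicator) auto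
    show "AE y in lborel. (\<lambda>i. ?q i y) \<longlonglongrightarrow> indicator (cball 0 1) y * (G (x + r *\<^sub>R y) \<bullet> y)"
      using AE_lborel_affine[OF der r, of x]
      by eventually_elim (intro tendsto_mult_left filterlim_compose[OF has_derivative_imp_tendsto_diff_quot XF])
    fix i
    show "?q i \<in> borel_measurable lborel" unfolding diff_quot_def by measurable
    show "AE y in lborel. norm (?q i y) \<le> indicator (cball 0 1) y * L"
    proof (rule AE_I2)
      fix y :: 'a
      have "\<bar>diff_quot f y (X i) (x + r *\<^sub>R y)\<bar> \<le> L" if "norm y \<le> 1"
        using order_trans[OF abs_diff_quot_le[OF lip] mult_left_mono[OF that lipschitz_on_nonneg[OF lip]]] by simp
      then show "norm (?q i y) \<le> indicator (cball 0 1) y * L" by (auto simp: indicator_def)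
    qed
  qed measurable
  moreover have "(\<integral>y. ?q i y \<partial>lborel) = (dilation_mean f x (r + X i) - dilation_mean f x r) / X i" for i
  proof -
    have "?q i y = (indicator (cball 0 1) y * f (x + (r + X i) *\<^sub>R y) - indicator (cball 0 1) y * f (x + r *\<^sub>R y)) / X i" for y
      by (simp add: diff_quot_def scaleR_add_left add.assoc right_diff_distrib)
    then show ?thesis
      unfolding dilation_mean_def using integrable_dilation by simp
  qed
  ultimately show "((\<lambda>h. (dilation_mean f x (r + h) - dilation_mean f x r) / h) \<circ> X)
     \<longlonglongrightarrow> (\<integral>y. indicator (cball 0 1) y * (G (x + r *\<^sub>R y) \<bullet> y) \<partial>lborel)"
    by (simp add: comp_def)
qed

text \<open>
  The inequality \<open>s \<le> \<beta> / 2 + s\<^sup>2 / (2 \<beta>)\<close>, integrated over the ball, replaces the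
  Cauchy-Schwarz inequality at the cost of a constant.
\<close>

lemma dilation_mean_derivative_bound:
  assumes r: "0 < r" and \<beta>: "0 < \<beta>"
    and I: "(\<integral>\<^sup>+z. indicator (cball x r) z * ennreal ((norm (G z))\<^sup>2) \<partial>lborel) \<le> ennreal (\<beta>\<^sup>2 * r ^ DIM('a))"
  shows "\<bar>\<integral>y. indicator (cball 0 1) y * (G (x + r *\<^sub>R y) \<bullet> y) \<partial>lborel\<bar>
      \<le> \<beta> * (unit_ball_vol (DIM('a)) + 1) / 2"
proof -
  let ?B = "cball (0::'a) 1"
  let ?G = "\<lambda>y. G (x + r *\<^sub>R y)"
  have L: "AE y in lborel. norm (?G y) \<le> L"
    using AE_lborel_affine[OF der, of r x] r
    by (auto elim!: eventually_mono intro: norm_derivative_le_lipschitz[OF lip])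
  have int: "integrable lborel (\<lambda>y. indicator ?B y * (?G y \<bullet> y))"
  proof (rule integrable_indicator_cball_mult[where c=L])
    show "AE y in lborel. y \<in> ?B \<longrightarrow> \<bar>?G y \<bullet> y\<bar> \<le> L"
      using L
    proof eventually_elim
      case (elim y)
      show ?case
      proof
        assume "y \<in> ?B"
        then have "norm (?G y) * norm y \<le> L * 1" using elim lipschitz_on_nonneg[OF lip] by (intro mult_mono) auto
        then show "\<bar>?G y \<bullet> y\<bar> \<le> L" using Cauchy_Schwarz_ineq2[of "?G y" y] by linarith
      qed
    qed
  qed measurable
  have "ennreal (r ^ DIM('a)) * (\<integral>\<^sup>+y. indicator ?B y * ennreal ((norm (?G y))\<^sup>2) \<partial>lborel)
      = (\<integral>\<^sup>+z. indicator (cball x r) z * ennreal ((norm (G z))\<^sup>2) \<partial>lborel)"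
  proof -
    have "x + r *\<^sub>R y \<in> cball x r \<longleftrightarrow> y \<in> ?B" for y
      using r by (simp add: dist_norm)
    then have "indicator (cball x r) (x + r *\<^sub>R y) = (indicator ?B y :: ennreal)" for y
      by (simp add: indicator_def)
    moreover have "(\<lambda>z. indicator (cball x r) z * ennreal ((norm (G z))\<^sup>2)) \<in> borel_measurable borel"
      by measurable
    ultimately show ?thesis
      using nn_integral_lborel_affine[of "\<lambda>z. indicator (cball x r) z * ennreal ((norm (G z))\<^sup>2)" r x] r by simp
  qed
  then have "ennreal (r ^ DIM('a)) * (\<integral>\<^sup>+y. indicator ?B y * ennreal ((norm (?G y))\<^sup>2) \<partial>lborel)
      \<le> ennreal (r ^ DIM('a)) * ennreal (\<beta>\<^sup>2)"
    using I r by (simp add: mult.commute flip: ennreal_mult)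
  then have I1: "(\<integral>\<^sup>+y. indicator ?B y * ennreal ((norm (?G y))\<^sup>2) \<partial>lborel) \<le> ennreal (\<beta>\<^sup>2)"
    using r by (subst (asm) ennreal_mult_le_mult_iff) auto
  have "ennreal \<bar>\<integral>y. indicator ?B y * (?G y \<bullet> y) \<partial>lborel\<bar>
      \<le> (\<integral>\<^sup>+y. ennreal (norm (indicator ?B y * (?G y \<bullet> y))) \<partial>lborel)"
    using integral_norm_bound_ennreal[OF int] by simp
  also have "\<dots> \<le> (\<integral>\<^sup>+y. ennreal (\<beta> / 2) * indicator ?B y + ennreal (1 / (2 * \<beta>)) * (indicator ?B y * ennreal ((norm (?G y))\<^sup>2)) \<partial>lborel)"
  proof (rule nn_integral_mono)
    fix y :: 'a
    have "\<bar>?G y \<bullet> y\<bar> \<le> \<beta> / 2 + 1 / (2 * \<beta>) * (norm (?G y))\<^sup>2" if "norm y \<le> 1"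
    proof -
      have "\<bar>?G y \<bullet> y\<bar> \<le> norm (?G y) * 1"
        using order_trans[OF Cauchy_Schwarz_ineq2 mult_left_mono[OF that norm_ge_zero]] .
      moreover have "2 * \<beta> * norm (?G y) \<le> \<beta>\<^sup>2 + (norm (?G y))\<^sup>2"
        using sum_squares_bound[of \<beta> "norm (?G y)"] by simp
      then have "norm (?G y) \<le> \<beta> / 2 + 1 / (2 * \<beta>) * (norm (?G y))\<^sup>2"
        using \<beta> by (simp add: field_simps power2_eq_square)
      ultimately show ?thesis by simp
    qed
    then show "ennreal (norm (indicator ?B y * (?G y \<bullet> y))) \<le>
        ennreal (\<beta> / 2) * indicator ?B y + ennreal (1 / (2 * \<beta>)) * (indicator ?B y * ennreal ((norm (?G y))\<^sup>2))"
      using \<beta> by (auto simp: indicator_def simp flip: ennreal_mult ennreal_plus intro!: ennreal_leI)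
  qed
  also have "\<dots> = ennreal (\<beta> / 2) * emeasure lborel ?B + ennreal (1 / (2 * \<beta>)) * (\<integral>\<^sup>+y. indicator ?B y * ennreal ((norm (?G y))\<^sup>2) \<partial>lborel)"
    by (simp add: nn_integral_add nn_integral_cmult)
  also have "\<dots> \<le> ennreal (\<beta> / 2) * ennreal (unit_ball_vol (DIM('a))) + ennreal (1 / (2 * \<beta>)) * ennreal (\<beta>\<^sup>2)"
    using I1 by (intro add_mono mult_left_mono) (auto simp: emeasure_cball)
  also have "\<dots> = ennreal (\<beta> * (unit_ball_vol (DIM('a)) + 1) / 2)"
    using \<beta> by (simp flip: ennreal_mult ennreal_plus add: field_simps power2_eq_square)
  finally show ?thesis using \<beta> by (subst (asm) ennreal_le_iff) auto
qed

lemma dilation_mean_0: "dilation_mean f x 0 = unit_ball_vol (DIM('a)) * f x"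
  by (simp add: dilation_mean_def content_cball)

lemma dilation_mean_continuous: "continuous_on UNIV (dilation_mean f x)"
proof (rule lipschitz_on_continuous_on[where L="L * unit_ball_vol (DIM('a))"], rule lipschitz_onI)
  let ?B = "cball (0::'a) 1"
  have L0: "0 \<le> L" using lip by (rule lipschitz_on_nonneg)
  then show "0 \<le> L * unit_ball_vol (DIM('a))" by simp
  fix r s :: real
  have "\<bar>dilation_mean f x r - dilation_mean f x s\<bar> =
      \<bar>\<integral>y. indicator ?B y * f (x + r *\<^sub>R y) - indicator ?B y * f (x + s *\<^sub>R y) \<partial>lborel\<bar>"
    unfolding dilation_mean_def using integrable_dilation by simp
  also have "\<dots> \<le> (\<integral>y. \<bar>indicator ?B y * f (x + r *\<^sub>R y) - indicator ?B y * f (x + s *\<^sub>R y)\<bar> \<partial>lborel)"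
    by (rule integral_abs_bound)
  also have "\<dots> \<le> (\<integral>y. indicator ?B y * (L * \<bar>r - s\<bar>) \<partial>lborel)"
  proof (rule integral_mono)
    show "integrable lborel (\<lambda>y. indicator ?B y * (L * \<bar>r - s\<bar>))"
      using emeasure_lborel_cball_finite[of "0::'a" 1] by (intro integrable_mult_left integrable_real_indicator) auto
    show "integrable lborel (\<lambda>y. \<bar>indicator ?B y * f (x + r *\<^sub>R y) - indicator ?B y * f (x + s *\<^sub>R y)\<bar>)"
      by (intro integrable_abs Bochner_Integration.integrable_diff integrable_dilation)
    fix y :: 'a
    have "\<bar>f (x + r *\<^sub>R y) - f (x + s *\<^sub>R y)\<bar> \<le> L * \<bar>r - s\<bar>" if "norm y \<le> 1"
    proof -
      have "\<bar>f (x + r *\<^sub>R y) - f (x + s *\<^sub>R y)\<bar> \<le> L * (\<bar>r - s\<bar> * norm y)"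
        using lipschitz_onD[OF lip, of "x + r *\<^sub>R y" "x + s *\<^sub>R y"] by (simp add: dist_norm flip: scaleR_diff_left)
      also have "\<dots> \<le> L * (\<bar>r - s\<bar> * 1)" using that L0 by (intro mult_left_mono) auto
      finally show ?thesis by simp
    qed
    then show "\<bar>indicator ?B y * f (x + r *\<^sub>R y) - indicator ?B y * f (x + s *\<^sub>R y)\<bar> \<le> indicator ?B y * (L * \<bar>r - s\<bar>)"
      by (auto simp: indicator_def)
  qed
  also have "\<dots> = L * unit_ball_vol (DIM('a)) * \<bar>r - s\<bar>"
    by (simp add: content_cball)
  finally show "dist (dilation_mean f x r) (dilation_mean f x s) \<le> L * unit_ball_vol (DIM('a)) * dist r s"
    by (simp add: dist_real_def)
qed

lemma dilation_mean_tendsto_0: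
  assumes supp: "\<And>z. z \<notin> cball 0 \<rho> \<Longrightarrow> f z = 0"
  shows "(\<lambda>k. dilation_mean f x (real k)) \<longlonglongrightarrow> 0"
proof -
  note [measurable] = lipschitz_borel_measurable[OF lip]
  have "continuous_on (cball 0 \<rho>) f"
    using lip by (meson continuous_on_subset lipschitz_on_continuous_on subset_UNIV)
  then have "bounded (f ` cball 0 \<rho>)" by (intro compact_imp_bounded compact_continuous_image compact_cball)
  then obtain M where "\<forall>v\<in>f ` cball 0 \<rho>. norm v \<le> M" unfolding bounded_iff by blast
  then have "\<bar>f z\<bar> \<le> M" if "z \<in> cball 0 \<rho>" for z using that by auto
  then have M: "\<bar>f z\<bar> \<le> \<bar>M\<bar>" for z using supp[of z] by (cases "z \<in> cball 0 \<rho>") (auto intro: order_trans[OF _ abs_ge_self])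
  have "(\<lambda>k. dilation_mean f x (real k)) \<longlonglongrightarrow> (\<integral>y. 0 \<partial>(lborel :: 'a measure))"
    unfolding dilation_mean_def
  proof (rule integral_dominated_convergence[where w="\<lambda>y. indicator (cball 0 1) y * \<bar>M\<bar>"])
    show "integrable lborel (\<lambda>y. indicator (cball (0::'a) 1) y * \<bar>M\<bar>)"
      using emeasure_lborel_cball_finite[of "0::'a" 1] by (intro integrable_mult_left integrable_real_indicator) auto
    have "{0::'a} \<in> null_sets lborel" by auto
    from AE_not_in[OF this]
    show "AE y in lborel. (\<lambda>k. indicator (cball 0 1) y * f (x + real k *\<^sub>R y)) \<longlonglongrightarrow> 0"
    proof eventually_elim
      case (elim y)
      have "\<forall>\<^sub>F k in sequentially. (norm x + \<rho>) / norm y < real k"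
        by (metis filterlim_at_top_dense filterlim_real_sequentially)
      then have "\<forall>\<^sub>F k in sequentially. indicator (cball 0 1) y * f (x + real k *\<^sub>R y) = 0"
      proof eventually_elim
        case (elim k)
        then have "norm x + \<rho> < norm (real k *\<^sub>R y)" using \<open>y \<notin> {0}\<close> by (simp add: field_simps)
        then have "\<rho> < norm (x + real k *\<^sub>R y)"
          using norm_triangle_ineq4[of "x + real k *\<^sub>R y" x] by simp
        then show ?case using supp by simp
      qed
      then show ?case by (rule tendsto_eventually)
    qed
    fix k
    show "(\<lambda>y. indicator (cball 0 1) y * f (x + real k *\<^sub>R y)) \<in> borel_measurable lborel" by measurable
    show "AE y in lborel. norm (indicator (cball 0 1) y * f (x + real k *\<^sub>R y)) \<le> indicator (cball 0 1) y * \<bar>M\<bar>"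
      using M by (intro AE_I2) (auto simp: indicator_def)
  qed measurable
  then show ?thesis by simp
qed

text \<open>
  Otherwise the mean over the balls about \<open>x\<close> would change by at most \<open>\<omega> t / 4\<close> between the radii \<open>0\<close> and \<open>R\<close>, and again between
  \<open>R\<close> and infinity, where the global bound \<open>\<Gamma>\<close> is used. Its value at \<open>0\<close> is at least \<open>\<omega> t\<close> and its limit is \<open>0\<close>.
\<close>

lemma ball_with_large_gradient:
  fixes t \<Gamma> R b :: real
  defines "\<omega> \<equiv> unit_ball_vol (DIM('a))" and "m \<equiv> DIM('a) / 2 - 1"
  assumes dim: "3 \<le> DIM('a)" and supp: "\<And>z. z \<notin> cball 0 \<rho> \<Longrightarrow> f z = 0"
    and E: "(\<integral>\<^sup>+z. ennreal ((norm (G z))\<^sup>2) \<partial>lborel) \<le> ennreal (\<Gamma>\<^sup>2)" and \<Gamma>: "0 < \<Gamma>"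
    and R: "0 < R" and b: "0 < b" and t: "0 < t"
    and small: "(\<omega> + 1) / 2 * (b * R) \<le> \<omega> * t / 4" "(\<omega> + 1) / 2 * (\<Gamma> * R powr (- m) / m) \<le> \<omega> * t / 4"
    and x: "t \<le> \<bar>f x\<bar>"
  shows "\<exists>r. 0 < r \<and> r \<le> R \<and>
    ennreal (b\<^sup>2 * r ^ DIM('a)) \<le> (\<integral>\<^sup>+z. indicator (cball x r) z * ennreal ((norm (G z))\<^sup>2) \<partial>lborel)"
proof (rule ccontr)
  let ?I = "\<lambda>r. \<integral>\<^sup>+z. indicator (cball x r) z * ennreal ((norm (G z))\<^sup>2) \<partial>lborel"
  let ?\<Phi> = "dilation_mean f x" and ?\<kappa> = "(\<omega> + 1) / 2"
  let ?D = "\<lambda>r. \<integral>y. indicator (cball 0 1) y * (G (x + r *\<^sub>R y) \<bullet> y) \<partial>lborel"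
  assume "\<not> ?thesis"
  then have I1: "?I r \<le> ennreal (b\<^sup>2 * r ^ DIM('a))" if "0 < r" "r \<le> R" for r
    using that by (meson le_cases)
  have m: "0 < m" unfolding m_def using dim by simp
  have \<omega>: "0 < \<omega>" unfolding \<omega>_def by simp
  have der: "(?\<Phi> has_vector_derivative ?D r) (at r)" if "0 < r" for r
    using dilation_mean_has_derivative[of r x] that by (simp add: has_real_derivative_iff_has_vector_derivative)
  have cont: "continuous_on S ?\<Phi>" for S
    using dilation_mean_continuous by (meson continuous_on_subset subset_UNIV)
  have "norm (?\<Phi> R - ?\<Phi> 0) \<le> ?\<kappa> * b * R - ?\<kappa> * b * 0"
  proof (rule differentiable_bound_general[OF R cont _ der])
    show "((\<lambda>r. ?\<kappa> * b * r) has_vector_derivative ?\<kappa> * b) (at r)" for r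
      by (auto intro!: derivative_eq_intros simp flip: has_real_derivative_iff_has_vector_derivative)
    show "norm (?D r) \<le> ?\<kappa> * b" if "0 < r" "r < R" for r
      using dilation_mean_derivative_bound[OF that(1) b I1] that by (simp add: \<omega>_def mult.commute)
  qed (auto intro!: continuous_intros)
  then have 1: "\<bar>?\<Phi> R - ?\<Phi> 0\<bar> \<le> \<omega> * t / 4" using small(1) by (simp only: real_norm_def mult_zero_right diff_0_right mult.assoc)
  have "norm (?\<Phi> S - ?\<Phi> R) \<le> \<omega> * t / 4" if S: "R < S" for S
  proof -
    have "norm (?\<Phi> S - ?\<Phi> R) \<le> - (?\<kappa> * (\<Gamma> * S powr (- m) / m)) - - (?\<kappa> * (\<Gamma> * R powr (- m) / m))"
    proof (rule differentiable_bound_general[OF S cont _ der])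
      show "((\<lambda>r. - (?\<kappa> * (\<Gamma> * r powr (- m) / m))) has_vector_derivative ?\<kappa> * (\<Gamma> * r powr (- m - 1))) (at r)"
        if "R < r" for r
        unfolding has_real_derivative_iff_has_vector_derivative[symmetric]
        using m that R by (auto intro!: derivative_eq_intros simp: field_simps)
      show "norm (?D r) \<le> ?\<kappa> * (\<Gamma> * r powr (- m - 1))" if "R < r" for r
      proof -
        have r: "0 < r" using that R by simp
        have "(r powr (- m - 1))\<^sup>2 * r ^ DIM('a) = 1"
          using r by (simp add: power2_eq_square m_def flip: powr_realpow powr_add)
        then have eq: "(\<Gamma> * r powr (- m - 1))\<^sup>2 * r ^ DIM('a) = \<Gamma>\<^sup>2"
          by (simp add: power_mult_distrib mult.assoc)
        have "?I r \<le> (\<integral>\<^sup>+z. ennreal ((norm (G z))\<^sup>2) \<partial>lborel)"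
          by (intro nn_integral_mono) (auto simp: indicator_def)
        also note E
        finally have "?I r \<le> ennreal ((\<Gamma> * r powr (- m - 1))\<^sup>2 * r ^ DIM('a))" unfolding eq .
        from dilation_mean_derivative_bound[OF r _ this] show ?thesis
          using \<Gamma> r by (simp add: \<omega>_def mult.commute)
      qed
    qed (use R S m in \<open>auto intro!: continuous_intros\<close>)
    also have "\<dots> \<le> ?\<kappa> * (\<Gamma> * R powr (- m) / m)" using \<Gamma> m \<omega> by simp
    also note small(2)
    finally show ?thesis .
  qed
  then have "\<forall>\<^sub>F k in sequentially. \<bar>?\<Phi> (real k) - ?\<Phi> R\<bar> \<le> \<omega> * t / 4"
    using eventually_mono[OF filterlim_at_top_dense[THEN iffD1, OF filterlim_real_sequentially, rule_format, of R]] by auto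
  moreover have "(\<lambda>k. \<bar>?\<Phi> (real k) - ?\<Phi> R\<bar>) \<longlonglongrightarrow> \<bar>0 - ?\<Phi> R\<bar>"
    by (intro tendsto_intros dilation_mean_tendsto_0[OF supp])
  ultimately have 2: "\<bar>0 - ?\<Phi> R\<bar> \<le> \<omega> * t / 4"
    by (intro tendsto_upperbound[where F=sequentially]) auto
  have "\<bar>\<omega> * f x\<bar> \<le> \<omega> * t / 2" using 1 2 dilation_mean_0[of x, folded \<omega>_def] by linarith
  moreover have "\<omega> * t \<le> \<bar>\<omega> * f x\<bar>" using x \<omega> by (simp add: abs_mult)
  ultimately show False using \<omega> t mult_pos_pos[OF \<omega> t] by linarith
qed

end

section \<open>The weak-type Sobolev inequality\<close>

lemma emeasure_UN_countable_le:
  assumes [measurable]: "\<And>i. i \<in> I \<Longrightarrow> X i \<in> sets M" and I: "countable I"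
  shows "emeasure M (\<Union>i\<in>I. X i) \<le> (\<integral>\<^sup>+i. emeasure M (X i) \<partial>count_space I)"
proof -
  have "emeasure M (\<Union>i\<in>I. X i) = (\<integral>\<^sup>+x. indicator (\<Union>i\<in>I. X i) x \<partial>M)"
    using assms by (intro nn_integral_indicator[symmetric] sets.countable_UN') auto
  also have "\<dots> \<le> (\<integral>\<^sup>+x. \<integral>\<^sup>+i. indicator (X i) x \<partial>count_space I \<partial>M)"
  proof (rule nn_integral_mono)
    fix x
    show "indicator (\<Union>i\<in>I. X i) x \<le> (\<integral>\<^sup>+i. indicator (X i) x \<partial>count_space I)"
    proof (cases "x \<in> (\<Union>i\<in>I. X i)")
      case True
      then obtain j where "j \<in> I" "x \<in> X j" by auto
      then show ?thesis using nn_integral_ge_point[of j I "\<lambda>i. indicator (X i) x"] by (auto simp: indicator_def)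
    qed simp
  qed
  also have "\<dots> = (\<integral>\<^sup>+i. \<integral>\<^sup>+x. indicator (X i) x \<partial>M \<partial>count_space I)"
    by (intro nn_integral_count_space_nn_integral I) auto
  also have "\<dots> = (\<integral>\<^sup>+i. emeasure M (X i) \<partial>count_space I)"
    by (intro nn_integral_cong) auto
  finally show ?thesis .
qed

text \<open>
  Each point of the set \<open>{t \<le> |f|}\<close> has a ball \<open>cball x r\<close> with \<open>r \<le> R\<close> that carries a gradient integral of at least
  \<open>b\<^sup>2 r\<^sup>n\<close>. The Vitali covering lemma selects disjoint ones whose fivefold enlargements still cover; their total
  volume is at most a multiple of \<open>\<Gamma>\<^sup>2 / b\<^sup>2\<close>, and the choice of \<open>R\<close> turns this into the power of \<open>\<Gamma> / t\<close>.
\<close>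

theorem weak_Sobolev_inequality:
  assumes dim: "3 \<le> DIM('a::euclidean_space)"
  shows "\<exists>C>0. \<forall>(f :: 'a \<Rightarrow> real) G L \<rho> \<Gamma> t.
    L-lipschitz_on UNIV f \<and> (\<forall>z. z \<notin> cball 0 \<rho> \<longrightarrow> f z = 0) \<and>
    G \<in> borel_measurable borel \<and> (AE x in lborel. (f has_derivative (\<lambda>h. G x \<bullet> h)) (at x)) \<and>
    0 < \<Gamma> \<and> (\<integral>\<^sup>+z. ennreal ((norm (G z))\<^sup>2) \<partial>lborel) \<le> ennreal (\<Gamma>\<^sup>2) \<and> 0 < t \<longrightarrow>
    emeasure lborel {x. t \<le> \<bar>f x\<bar>} \<le> ennreal (C * (\<Gamma> / t) powr (2 * DIM('a) / (DIM('a) - 2)))"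
proof -
  let ?n = "DIM('a)"
  define \<omega> where "\<omega> = unit_ball_vol ?n"
  define m where "m = ?n / 2 - 1"
  define \<kappa> where "\<kappa> = (\<omega> + 1) / 2"
  define c where "c = 4 * \<kappa> / (m * \<omega>)"
  define C where "C = \<omega> * 5 ^ ?n * (4 * \<kappa> / \<omega>)\<^sup>2 * c powr (2 / m)"
  have m: "0 < m" unfolding m_def using dim by simp
  have \<omega>: "0 < \<omega>" unfolding \<omega>_def by simp
  have \<kappa>: "0 < \<kappa>" unfolding \<kappa>_def using \<omega> by simp
  have c: "0 < c" unfolding c_def using \<omega> \<kappa> m by simp
  have C: "0 < C" unfolding C_def using \<omega> \<kappa> c by simp
  show ?thesis
  proof (intro exI[of _ C] conjI C allI impI, elim conjE)
    fix f :: "'a \<Rightarrow> real" and G and L \<rho> \<Gamma> t :: real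
    assume lip: "L-lipschitz_on UNIV f" and supp: "\<forall>z. z \<notin> cball 0 \<rho> \<longrightarrow> f z = 0"
      and G[measurable]: "G \<in> borel_measurable borel"
      and der: "AE x in lborel. (f has_derivative (\<lambda>h. G x \<bullet> h)) (at x)"
      and \<Gamma>: "0 < \<Gamma>" and E: "(\<integral>\<^sup>+z. ennreal ((norm (G z))\<^sup>2) \<partial>lborel) \<le> ennreal (\<Gamma>\<^sup>2)" and t: "0 < t"
    \<comment> \<open>The radius at which the global bound on the gradient starts to control the means.\<close>
    define R where "R = (c * (\<Gamma> / t)) powr (1 / m)"
    \<comment> \<open>The largest \<open>b\<close> for which the means change by at most \<open>\<omega> t / 4\<close> up to the radius \<open>R\<close>.\<close>
    define b where "b = \<omega> * t / (4 * \<kappa> * R)"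
    have R: "0 < R" unfolding R_def using c \<Gamma> t by simp
    have b: "0 < b" unfolding b_def using \<omega> \<kappa> t R by simp
    have s1: "\<kappa> * (b * R) \<le> \<omega> * t / 4" using \<kappa> R by (simp add: b_def)
    have "R powr (- m) = inverse (c * (\<Gamma> / t))"
      using m c \<Gamma> t by (simp add: R_def powr_powr powr_minus)
    then have s2: "\<kappa> * (\<Gamma> * R powr (- m) / m) \<le> \<omega> * t / 4"
      using \<kappa> \<omega> m t \<Gamma> by (simp add: c_def field_simps)
    let ?I = "\<lambda>B. \<integral>\<^sup>+z. indicator B z * ennreal ((norm (G z))\<^sup>2) \<partial>lborel"
    define K where "K = {(x, r). 0 < r \<and> r \<le> R \<and> ennreal (b\<^sup>2 * r ^ ?n) \<le> ?I (cball x r)}"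
    let ?S = "{x. t \<le> \<bar>f x\<bar>}" and ?B = "\<lambda>i::'a \<times> real. cball (fst i) (snd i)"
    have cov: "?S \<subseteq> (\<Union>i\<in>K. ?B i)"
    proof
      fix x assume "x \<in> ?S"
      then obtain r where "0 < r" "r \<le> R" "ennreal (b\<^sup>2 * r ^ ?n) \<le> ?I (cball x r)"
        using ball_with_large_gradient[OF lip G der dim supp[rule_format] E \<Gamma> R b t, where x=x] s1 s2
        unfolding \<kappa>_def \<omega>_def m_def by auto
      then show "x \<in> (\<Union>i\<in>K. ?B i)" unfolding K_def by (intro UN_I[of "(x, r)"]) auto
    qed
    have rK: "0 < snd i \<and> snd i \<le> R" if "i \<in> K" for i using that unfolding K_def by auto
    obtain C' where C': "countable C'" "C' \<subseteq> K" "pairwise (\<lambda>i j. disjnt (?B i) (?B j)) C'"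
      "?S \<subseteq> (\<Union>i\<in>C'. cball (fst i) (5 * snd i))"
      by (rule Vitali_covering_lemma_cballs[OF cov rK])
    have dis: "disjoint_family_on ?B C'"
      using C'(3) unfolding disjoint_family_on_def pairwise_def disjnt_def by auto
    define M where "M = density lborel (\<lambda>z. ennreal ((norm (G z))\<^sup>2))"
    have M: "emeasure M B = ?I B" if "B \<in> sets borel" for B
      unfolding M_def using that by (subst emeasure_density) (auto simp: mult.commute)
    have five: "emeasure lborel (cball (fst i) (5 * snd i)) \<le> ennreal (\<omega> * 5 ^ ?n / b\<^sup>2) * emeasure M (?B i)" if "i \<in> C'" for i
    proof -
      have i: "0 < snd i" "ennreal (b\<^sup>2 * snd i ^ ?n) \<le> ?I (?B i)" using that C'(2) unfolding K_def by auto
      have "emeasure lborel (cball (fst i) (5 * snd i)) = ennreal (\<omega> * (5 * snd i) ^ ?n)"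
        using i by (simp add: emeasure_cball \<omega>_def)
      also have "\<dots> = ennreal (\<omega> * 5 ^ ?n / b\<^sup>2) * ennreal (b\<^sup>2 * snd i ^ ?n)"
        using i b \<omega> by (simp add: power_mult_distrib flip: ennreal_mult)
      also have "\<dots> \<le> ennreal (\<omega> * 5 ^ ?n / b\<^sup>2) * emeasure M (?B i)"
        using i(2) by (subst M) (auto intro: mult_left_mono)
      finally show ?thesis .
    qed
    have "emeasure lborel ?S \<le> emeasure lborel (\<Union>i\<in>C'. cball (fst i) (5 * snd i))"
      using C' by (intro emeasure_mono sets.countable_UN') auto
    also have "\<dots> \<le> (\<integral>\<^sup>+i. emeasure lborel (cball (fst i) (5 * snd i)) \<partial>count_space C')"
      using C'(1) by (intro emeasure_UN_countable_le) auto
    also have "\<dots> \<le> (\<integral>\<^sup>+i. ennreal (\<omega> * 5 ^ ?n / b\<^sup>2) * emeasure M (?B i) \<partial>count_space C')"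
      using five by (intro nn_integral_mono) auto
    also have "\<dots> = ennreal (\<omega> * 5 ^ ?n / b\<^sup>2) * (\<integral>\<^sup>+i. emeasure M (?B i) \<partial>count_space C')"
      by (intro nn_integral_cmult) auto
    also have "(\<integral>\<^sup>+i. emeasure M (?B i) \<partial>count_space C') = emeasure M (\<Union>i\<in>C'. ?B i)"
      using C'(1) dis by (intro emeasure_UN_countable[symmetric]) (auto simp: M_def)
    also have "\<dots> \<le> emeasure M UNIV"
      using C'(1) by (intro emeasure_mono) (auto simp: M_def)
    also have "\<dots> \<le> ennreal (\<Gamma>\<^sup>2)" using E by (subst M) auto
    also have "ennreal (\<omega> * 5 ^ ?n / b\<^sup>2) * ennreal (\<Gamma>\<^sup>2) = ennreal (C * (\<Gamma> / t) powr (2 * ?n / (?n - 2)))"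
    proof -
      have "R\<^sup>2 = c powr (2 / m) * (\<Gamma> / t) powr (2 / m)"
        using c \<Gamma> t powr_mult[of c "\<Gamma> / t" "2 / m"] by (simp add: R_def power2_eq_square flip: powr_add)
      moreover have "(\<Gamma> / t)\<^sup>2 * (\<Gamma> / t) powr (2 / m) = (\<Gamma> / t) powr (2 * ?n / (?n - 2))"
      proof -
        have e: "2 + 2 / m = 2 * ?n / (?n - 2)" using dim by (simp add: m_def field_simps)
        show ?thesis unfolding e[symmetric] using \<Gamma> t by (simp add: powr_add)
      qed
      moreover have "\<omega> * 5 ^ ?n / b\<^sup>2 * \<Gamma>\<^sup>2 = \<omega> * 5 ^ ?n * (4 * \<kappa> / \<omega>)\<^sup>2 * ((\<Gamma> / t)\<^sup>2 * R\<^sup>2)"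
        using \<omega> \<kappa> t R by (simp add: b_def power_divide power_mult_distrib)
      ultimately have "\<omega> * 5 ^ ?n / b\<^sup>2 * \<Gamma>\<^sup>2 = C * (\<Gamma> / t) powr (2 * ?n / (?n - 2))"
        by (simp add: C_def mult_ac)
      then show ?thesis using \<omega> by (simp flip: ennreal_mult)
    qed
    finally show "emeasure lborel ?S \<le> ennreal (C * (\<Gamma> / t) powr (2 * ?n / (?n - 2)))"
      by (simp add: mult_left_mono)
  qed
qed

section \<open>Square roots of symmetric matrices\<close>

text \<open>
  A maximiser \<open>b\<close> of the Rayleigh quotient on the unit sphere of \<open>V\<close> is an eigenvector, and its orthogonal complement
  in \<open>V\<close> is invariant and of smaller dimension.
\<close>

lemma self_adjoint_orthonormal_eigenvectors:
  fixes f :: "'a::euclidean_space \<Rightarrow> 'a"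
  assumes lin: "linear f" and sa: "\<And>x y. f x \<bullet> y = x \<bullet> f y"
    and V: "subspace V" and inv: "\<And>x. x \<in> V \<Longrightarrow> f x \<in> V"
  shows "\<exists>B. finite B \<and> B \<subseteq> V \<and> (\<forall>b\<in>B. \<forall>c\<in>B. b \<bullet> c = (if b = c then 1 else 0)) \<and>
    (\<forall>b\<in>B. f b = (f b \<bullet> b) *\<^sub>R b) \<and> (\<forall>x\<in>V. x = (\<Sum>b\<in>B. (x \<bullet> b) *\<^sub>R b))"
  using V inv
proof (induction "dim V" arbitrary: V rule: less_induct)
  case (less V)
  show ?case
  proof (cases "V = {0}")
    case True
    then show ?thesis by (intro exI[of _ "{}"]) auto
  next
    case False
    then obtain v where v: "v \<in> V" "v \<noteq> 0" using subspace_0[OF less.prems(1)] by auto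
    let ?S = "sphere 0 1 \<inter> V"
    have "compact ?S" using closed_subspace[OF less.prems(1)] by (intro compact_Int_closed) auto
    moreover have "v /\<^sub>R norm v \<in> ?S" using v less.prems(1) by (auto simp: subspace_scale)
    moreover have "continuous_on ?S (\<lambda>x. f x \<bullet> x)"
      using lin by (intro continuous_intros linear_continuous_on) (simp add: linear_conv_bounded_linear)
    ultimately obtain b where b: "b \<in> ?S" and max: "\<And>x. x \<in> ?S \<Longrightarrow> f x \<bullet> x \<le> f b \<bullet> b"
      using continuous_attains_sup[of ?S "\<lambda>x. f x \<bullet> x"] by blast
    define l where "l = f b \<bullet> b"
    have bV: "b \<in> V" and bb: "b \<bullet> b = 1" using b by (auto simp: dot_square_norm)
    have ray: "f x \<bullet> x \<le> l * (x \<bullet> x)" if "x \<in> V" for x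
    proof (cases "x = 0")
      case False
      have "f (x /\<^sub>R norm x) \<bullet> (x /\<^sub>R norm x) \<le> l"
        unfolding l_def using that False less.prems(1) by (intro max) (auto simp: subspace_scale)
      then show ?thesis using False by (simp add: linear_scale[OF lin] dot_square_norm power2_eq_square field_simps)
    qed (simp add: linear_0[OF lin])
    have crit: "f b \<bullet> w = 0" if w: "w \<in> V" "w \<bullet> b = 0" for w
    proof -
      have q: "2 * t * (f b \<bullet> w) \<le> t\<^sup>2 * (l * (w \<bullet> w) - f w \<bullet> w)" for t
      proof -
        have "b + t *\<^sub>R w \<in> V" using bV w less.prems(1) by (simp add: subspace_add subspace_scale)
        from ray[OF this]
        have "f b \<bullet> b + t * (f b \<bullet> w) + t * (f w \<bullet> b) + t\<^sup>2 * (f w \<bullet> w) \<le> l * (1 + t\<^sup>2 * (w \<bullet> w))"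
          using w(2) bb by (simp add: linear_add[OF lin] linear_scale[OF lin] inner_add_left inner_add_right
              inner_commute[of b w] power2_eq_square algebra_simps)
        moreover have "f w \<bullet> b = f b \<bullet> w" using sa[of w b] by (simp add: inner_commute)
        ultimately show ?thesis by (simp add: l_def algebra_simps)
      qed
      \<comment> \<open>For small \<open>t\<close> the linear term of \<open>q\<close> would win; \<open>t = f b \<bullet> w / K\<close> is small enough.\<close>
      define K where "K = \<bar>l * (w \<bullet> w) - f w \<bullet> w\<bar> + 1"
      have K: "0 < K" by (simp add: K_def)
      have "2 * (f b \<bullet> w / K) * (f b \<bullet> w) \<le> (f b \<bullet> w / K)\<^sup>2 * (l * (w \<bullet> w) - f w \<bullet> w)" by (rule q)
      also have "\<dots> \<le> (f b \<bullet> w / K)\<^sup>2 * K" by (intro mult_left_mono) (auto simp: K_def)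
      finally have "2 * (f b \<bullet> w)\<^sup>2 \<le> (f b \<bullet> w)\<^sup>2" using K by (simp add: power2_eq_square field_simps)
      then show ?thesis by simp
    qed
    have eig: "f b = l *\<^sub>R b"
    proof -
      let ?w = "f b - l *\<^sub>R b"
      have "?w \<in> V" using bV less.prems by (simp add: subspace_diff subspace_scale)
      moreover have "?w \<bullet> b = 0" using bb by (simp add: l_def inner_diff_left)
      ultimately have "f b \<bullet> ?w = 0" by (rule crit)
      moreover have "b \<bullet> ?w = 0" using \<open>?w \<bullet> b = 0\<close> by (simp add: inner_commute)
      ultimately have "?w \<bullet> ?w = 0" by (simp add: inner_diff_left)
      then show ?thesis by simp
    qed
    define V' where "V' = {x \<in> V. x \<bullet> b = 0}"
    have V': "subspace V'" using less.prems(1) unfolding V'_def subspace_def by (auto simp: inner_add_left)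
    have inv': "f x \<in> V'" if "x \<in> V'" for x
      using that less.prems(2) unfolding V'_def by (auto simp: sa eig)
    have "b \<notin> V'" using bb unfolding V'_def by simp
    then have "V' \<subset> V" using bV unfolding V'_def by blast
    then have "dim V' < dim V" using V' less.prems(1) by (intro dim_psubset) (simp add: span_eq_iff[THEN iffD2])
    from less.hyps[OF this V' inv'] obtain B where B: "finite B" "B \<subseteq> V'"
      "\<forall>b\<in>B. \<forall>c\<in>B. b \<bullet> c = (if b = c then 1 else 0)" "\<forall>b\<in>B. f b = (f b \<bullet> b) *\<^sub>R b"
      "\<forall>x\<in>V'. x = (\<Sum>b\<in>B. (x \<bullet> b) *\<^sub>R b)" by blast
    have orth: "c \<bullet> b = 0" "b \<bullet> c = 0" if "c \<in> B" for c
      using that B(2) unfolding V'_def by (auto simp: inner_commute)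
    have nb: "b \<notin> B" using orth(1)[of b] bb by auto
    have "x = (\<Sum>c\<in>insert b B. (x \<bullet> c) *\<^sub>R c)" if x: "x \<in> V" for x
    proof -
      let ?y = "x - (x \<bullet> b) *\<^sub>R b"
      have "?y \<in> V'" unfolding V'_def using x bV bb less.prems(1) by (simp add: subspace_diff subspace_scale inner_diff_left)
      then have "?y = (\<Sum>c\<in>B. (?y \<bullet> c) *\<^sub>R c)" using B(5) by blast
      also have "\<dots> = (\<Sum>c\<in>B. (x \<bullet> c) *\<^sub>R c)" using orth by (intro sum.cong) (auto simp: inner_diff_left)
      finally show ?thesis using B(1) nb by (simp add: algebra_simps)
    qed
    then show ?thesis
      using B orth bb bV nb eig unfolding V'_def l_def
      by (intro exI[of _ "insert b B"]) auto
  qed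
qed

lemma psd_square_root_exists:
  fixes M :: "real ^ 'n ^ 'n"
  assumes sym: "transpose M = M" and psd: "\<And>\<xi>. 0 \<le> (M *v \<xi>) \<bullet> \<xi>"
  shows "\<exists>S. transpose S = S \<and> (\<forall>\<xi>. 0 \<le> (S *v \<xi>) \<bullet> \<xi>) \<and> S ** S = M"
proof -
  let ?f = "\<lambda>x. M *v x"
  have sa: "?f x \<bullet> y = x \<bullet> ?f y" for x y
    using dot_lmul_matrix[of x M y] transpose_matrix_vector[of M x] sym by simp
  obtain B where B: "finite B" "\<forall>b\<in>B. \<forall>c\<in>B. b \<bullet> c = (if b = c then 1 else 0)"
      "\<forall>b\<in>B. ?f b = (?f b \<bullet> b) *\<^sub>R b" "\<And>x. x = (\<Sum>b\<in>B. (x \<bullet> b) *\<^sub>R b)"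
    using self_adjoint_orthonormal_eigenvectors[of ?f UNIV] sa by auto
  define g where "g x = (\<Sum>b\<in>B. (sqrt (?f b \<bullet> b) * (x \<bullet> b)) *\<^sub>R b)" for x
  have gl: "linear g"
    unfolding g_def by (intro linearI) (simp_all add: inner_add_left algebra_simps sum.distrib scaleR_sum_right)
  let ?S = "matrix g"
  have S: "?S *v x = g x" for x using gl by (simp add: matrix_works linear_def scalar_mult_eq_scaleR[abs_def])
  have gb: "g x \<bullet> c = sqrt (?f c \<bullet> c) * (x \<bullet> c)" if "c \<in> B" for x c
  proof -
    have "g x \<bullet> c = (\<Sum>b\<in>B. if b = c then sqrt (?f c \<bullet> c) * (x \<bullet> c) else 0)"
      unfolding g_def inner_sum_left using B(2) that by (intro sum.cong) auto
    then show ?thesis using B(1) that by simp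
  qed
  have gsa: "g x \<bullet> y = x \<bullet> g y" for x y
    unfolding g_def by (simp add: inner_sum_left inner_sum_right inner_commute mult_ac)
  have "transpose ?S = ?S"
  proof (subst matrix_eq, rule allI)
    fix x
    have "(transpose ?S *v x) \<bullet> y = (?S *v x) \<bullet> y" for y by (simp add: dot_lmul_matrix S gsa)
    then show "transpose ?S *v x = ?S *v x" using vector_eq_rdot by blast
  qed
  moreover have "0 \<le> (?S *v x) \<bullet> x" for x
  proof -
    have "g x \<bullet> x = (\<Sum>b\<in>B. sqrt (?f b \<bullet> b) * (x \<bullet> b)\<^sup>2)"
      unfolding g_def inner_sum_left by (intro sum.cong) (simp_all add: inner_commute power2_eq_square)
    then show ?thesis unfolding S using psd by (simp add: sum_nonneg)
  qed
  moreover have "?S ** ?S = M"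
  proof (subst matrix_eq, rule allI)
    fix x
    have "(?S ** ?S) *v x = g (g x)" by (simp only: matrix_vector_mul_assoc[symmetric] S)
    also have "\<dots> = (\<Sum>b\<in>B. ((?f b \<bullet> b) * (x \<bullet> b)) *\<^sub>R b)"
      unfolding g_def[of "g x"] using psd by (intro sum.cong) (auto simp: gb simp flip: mult.assoc)
    also have "\<dots> = (\<Sum>b\<in>B. (x \<bullet> b) *\<^sub>R ?f b)"
      using B(3) by (intro sum.cong) (metis mult.commute scaleR_scaleR)+
    also have "\<dots> = ?f (\<Sum>b\<in>B. (x \<bullet> b) *\<^sub>R b)"
      by (simp add: linear_sum[OF matrix_vector_mul_linear] linear_scale[OF matrix_vector_mul_linear])
    also have "\<dots> = ?f x" by (rule arg_cong[OF B(4)[of x, symmetric]])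
    finally show "(?S ** ?S) *v x = M *v x" .
  qed
  ultimately show ?thesis by blast
qed

text \<open>
  This removes the choice operator: the energy depends on the quadratic form of \<open>M\<close> only.
\<close>

lemma inner_matrix_sqrt:
  assumes "transpose M = M" and "\<And>\<xi>. 0 \<le> (M *v \<xi>) \<bullet> \<xi>"
  shows "(matrix_sqrt M *v a) \<bullet> (matrix_sqrt M *v b) = a \<bullet> (M *v b)"
proof -
  let ?S = "matrix_sqrt M"
  have S: "transpose ?S = ?S" "?S ** ?S = M"
    using someI_ex[OF psd_square_root_exists[OF assms]] unfolding matrix_sqrt_def by auto
  have "(?S *v a) \<bullet> (?S *v b) = a \<bullet> (?S *v (?S *v b))"
    using dot_lmul_matrix[of a ?S "?S *v b"] transpose_matrix_vector[of ?S a] S(1) by simp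
  then show ?thesis by (simp add: S(2) matrix_vector_mul_assoc)
qed

section \<open>Lipschitz functions with compact support\<close>

definition zero_extension :: "'a set \<Rightarrow> ('a \<Rightarrow> real) \<Rightarrow> 'a \<Rightarrow> real" where
  "zero_extension \<Omega> \<psi> x = (if x \<in> \<Omega> then \<psi> x else 0)"

text \<open>
  The support of \<open>\<psi>\<close> has positive distance from the complement of \<open>\<Omega>\<close> and \<open>\<psi>\<close> is bounded, which controls the
  increments between the support and the complement.
\<close>

lemma Lip0_zero_extension:
  assumes \<psi>: "\<psi> \<in> Lip0 \<Omega>" and \<Omega>: "open \<Omega>"
  obtains L K where "L-lipschitz_on UNIV (zero_extension \<Omega> \<psi>)" "compact K" "K \<subseteq> \<Omega>"
    "\<forall>x. x \<notin> K \<longrightarrow> zero_extension \<Omega> \<psi> x = 0"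
proof -
  let ?K = "closure (support_on \<Omega> \<psi>)" and ?\<psi> = "zero_extension \<Omega> \<psi>"
  obtain L where L: "L-lipschitz_on \<Omega> \<psi>" and K: "compact ?K" "?K \<subseteq> \<Omega>"
    using \<psi> unfolding Lip0_def by blast
  have z: "\<forall>x. x \<notin> ?K \<longrightarrow> ?\<psi> x = 0"
    using closure_subset[of "support_on \<Omega> \<psi>"] by (auto simp: zero_extension_def support_on_def)
  obtain d where d: "0 < d" "\<And>x y. x \<in> ?K \<Longrightarrow> y \<in> - \<Omega> \<Longrightarrow> d \<le> dist x y"
  proof -
    have "?K \<inter> - \<Omega> = {}" using K(2) by blast
    then show ?thesis using separate_compact_closed[of ?K "- \<Omega>"] K(1) \<Omega> that by blast
  qed
  have "continuous_on ?K \<psi>" using L K by (meson continuous_on_subset lipschitz_on_continuous_on)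
  then have "bounded (\<psi> ` ?K)" using K by (intro compact_imp_bounded compact_continuous_image)
  then obtain M where "\<forall>v\<in>\<psi> ` ?K. norm v \<le> M" unfolding bounded_iff by blast
  then have M: "\<bar>\<psi> x\<bar> \<le> \<bar>M\<bar>" if "x \<in> ?K" for x using that by fastforce
  have L0: "0 \<le> L" using L by (rule lipschitz_on_nonneg)
  define L' where "L' = L + \<bar>M\<bar> / d"
  have L': "L \<le> L'" "\<bar>M\<bar> / d \<le> L'" using L0 d by (auto simp: L'_def)
  have out: "dist (?\<psi> x) (?\<psi> y) \<le> L' * dist x y" if "y \<notin> \<Omega>" for x y
  proof (cases "x \<in> ?K")
    case True
    then have "d \<le> dist x y" using d that by auto
    then have "\<bar>M\<bar> / d * d \<le> L' * dist x y" using L' d L0 by (intro mult_mono) auto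
    moreover have "0 \<le> L' * dist x y" using L' L0 by (intro mult_nonneg_nonneg) auto
    ultimately show ?thesis using M[OF True] d that by (auto simp: zero_extension_def dist_real_def)
  qed (use z that L0 d in \<open>simp add: zero_extension_def L'_def\<close>)
  have "L'-lipschitz_on UNIV ?\<psi>"
  proof (rule lipschitz_onI)
    fix x y
    consider "x \<in> \<Omega>" "y \<in> \<Omega>" | "y \<notin> \<Omega>" | "x \<notin> \<Omega>" by blast
    then show "dist (?\<psi> x) (?\<psi> y) \<le> L' * dist x y"
    proof cases
      case 1
      have "dist (\<psi> x) (\<psi> y) \<le> L * dist x y" using lipschitz_onD[OF L] 1 by auto
      also have "\<dots> \<le> L' * dist x y" using L' by (intro mult_right_mono) auto
      finally show ?thesis using 1 by (simp add: zero_extension_def)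
    next
      case 2
      then show ?thesis by (rule out)
    next
      case 3
      from out[OF this, of y] show ?thesis by (simp add: dist_commute)
    qed
  qed (use L0 L' in auto)
  then show ?thesis by (rule that[OF _ K z])
qed

lemma gradient_eqI:
  assumes "(\<psi> has_derivative (\<lambda>h. g \<bullet> h)) (at x)"
  shows "gradient \<psi> x = g"
proof -
  have "(THE D. GDERIV \<psi> x :> D) = g"
  proof (rule the_equality)
    show "GDERIV \<psi> x :> g" using assms by (simp add: gderiv_def inner_commute)
    fix D assume "GDERIV \<psi> x :> D"
    then have "(\<lambda>h. h \<bullet> D) = (\<lambda>h. g \<bullet> h)" using assms unfolding gderiv_def by (rule has_derivative_unique)
    then have "h \<bullet> D = h \<bullet> g" for h by (metis inner_commute)
    then show "D = g" using vector_eq_ldot by blast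
  qed
  moreover have "\<psi> differentiable (at x)" using assms by (auto simp: differentiable_def)
  ultimately show ?thesis by (simp add: gradient_def)
qed

lemma AE_lebesgue_on_if_AE_lborel:
  assumes "AE x in lborel. P x" and "open (\<Omega> :: 'a::euclidean_space set)"
  shows "AE x in lebesgue_on \<Omega>. P x"
proof -
  have "AE x in lebesgue. x \<in> \<Omega> \<longrightarrow> P x" using AE_completion[OF assms(1)] by eventually_elim simp
  then show ?thesis using assms(2) by (subst AE_restrict_space_iff) auto
qed

text \<open>
  The results on the whole space apply to the zero extension. As \<open>G\<close> vanishes outside \<open>\<Omega>\<close>, its
  integrals over the space are the integrals of the gradient over \<open>\<Omega>\<close>.
\<close>

lemma Lip0_gradient:
  fixes \<Omega> :: "(real ^ 'n) set"
  assumes \<psi>: "\<psi> \<in> Lip0 \<Omega>" and \<Omega>: "open \<Omega>"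
  obtains L K G where "L-lipschitz_on UNIV (zero_extension \<Omega> \<psi>)" "compact K" "K \<subseteq> \<Omega>"
    "\<forall>x. x \<notin> K \<longrightarrow> zero_extension \<Omega> \<psi> x = 0" "G \<in> borel_measurable borel"
    "AE x in lborel. (zero_extension \<Omega> \<psi> has_derivative (\<lambda>h. G x \<bullet> h)) (at x)"
    "AE x in lborel. norm (G x) \<le> L" "AE x in lborel. x \<notin> \<Omega> \<longrightarrow> G x = 0"
    "AE x in lebesgue_on \<Omega>. (\<psi> has_derivative (\<lambda>h. G x \<bullet> h)) (at x) \<and> gradient \<psi> x = G x"
proof -
  let ?\<psi> = "zero_extension \<Omega> \<psi>"
  obtain L K where LK: "L-lipschitz_on UNIV ?\<psi>" "compact K" "K \<subseteq> \<Omega>" "\<forall>x. x \<notin> K \<longrightarrow> ?\<psi> x = 0"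
    by (rule Lip0_zero_extension[OF assms])
  obtain G where G: "G \<in> borel_measurable borel" "AE x in lborel. (?\<psi> has_derivative (\<lambda>h. G x \<bullet> h)) (at x)"
    by (rule Rademacher[OF LK(1)])
  have 1: "AE x in lborel. norm (G x) \<le> L"
    using G(2) by eventually_elim (rule norm_derivative_le_lipschitz[OF LK(1)])
  have 2: "AE x in lborel. x \<notin> \<Omega> \<longrightarrow> G x = 0"
    using G(2)
  proof eventually_elim
    case (elim x)
    show ?case
    proof
      assume "x \<notin> \<Omega>"
      then have x: "x \<in> - K" using LK(3) by auto
      have "(?\<psi> has_derivative (\<lambda>h. 0)) (at x)"
        by (rule has_derivative_transform_within_open[OF has_derivative_const[of 0], of "- K"])
          (use x LK(2,4) in \<open>auto simp: compact_imp_closed open_Compl\<close>)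
      from has_derivative_unique[OF this elim] have "G x \<bullet> G x = 0" by metis
      then show "G x = 0" by simp
    qed
  qed
  have 3: "AE x in lebesgue_on \<Omega>. (\<psi> has_derivative (\<lambda>h. G x \<bullet> h)) (at x) \<and> gradient \<psi> x = G x"
  proof -
    have "AE x in lebesgue_on \<Omega>. x \<in> \<Omega>" using AE_space[of "lebesgue_on \<Omega>"] by simp
    with AE_lebesgue_on_if_AE_lborel[OF G(2) \<Omega>] show ?thesis
    proof eventually_elim
      case (elim x)
      have "(\<psi> has_derivative (\<lambda>h. G x \<bullet> h)) (at x)"
        by (rule has_derivative_transform_within_open[OF elim(1) \<Omega> elim(2)]) (simp add: zero_extension_def)
      then show ?case using gradient_eqI by blast
    qed
  qed
  show ?thesis by (rule that[OF LK G 1 2 3])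
qed

text \<open>
  Lebesgue measure is complete. This makes pointwise gradients and \<open>|\<surd>Q v|\<^sup>2\<close> measurable: each agrees almost
  everywhere with a function whose measurability is clear, while the chosen square root itself gives no handle.
\<close>

lemma borel_measurable_lebesgue_on_AE:
  fixes f g :: "'a::euclidean_space \<Rightarrow> 'b::euclidean_space"
  assumes f: "f \<in> borel_measurable (lebesgue_on \<Omega>)" and \<Omega>: "open \<Omega>" and eq: "AE x in lebesgue_on \<Omega>. f x = g x"
  shows "g \<in> borel_measurable (lebesgue_on \<Omega>)"
proof -
  have S: "\<Omega> \<in> sets lebesgue" using \<Omega> by auto
  have "AE x in lebesgue. (if x \<in> \<Omega> then f x else 0) = (if x \<in> \<Omega> then g x else 0)"
    using eq S by (subst (asm) AE_restrict_space_iff) (auto elim!: eventually_mono)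
  from borel_measurable_AE[OF borel_measurable_if_I[OF f S] this] show ?thesis
    by (rule borel_measurable_if_D)
qed

lemma Lip0_borel_measurable:
  assumes "\<psi> \<in> Lip0 \<Omega>" "open \<Omega>"
  shows "\<psi> \<in> borel_measurable (lebesgue_on \<Omega>)"
proof -
  obtain L where "L-lipschitz_on \<Omega> \<psi>" using assms unfolding Lip0_def by blast
  then show ?thesis using assms
    by (intro continuous_imp_measurable_on_sets_lebesgue lipschitz_on_continuous_on) auto
qed

lemma Lip0_bounded:
  assumes "\<psi> \<in> Lip0 \<Omega>" "open \<Omega>"
  obtains M where "\<And>x. x \<in> \<Omega> \<Longrightarrow> \<bar>\<psi> x\<bar> \<le> M"
proof -
  obtain L K where LK: "L-lipschitz_on UNIV (zero_extension \<Omega> \<psi>)" "compact K" "\<forall>x. x \<notin> K \<longrightarrow> zero_extension \<Omega> \<psi> x = 0"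
    by (rule Lip0_zero_extension[OF assms]) (rule that)
  have "continuous_on K (zero_extension \<Omega> \<psi>)" using LK by (meson continuous_on_subset lipschitz_on_continuous_on subset_UNIV)
  then have "bounded (zero_extension \<Omega> \<psi> ` K)" using LK by (intro compact_imp_bounded compact_continuous_image)
  then obtain M where "\<forall>v\<in>zero_extension \<Omega> \<psi> ` K. norm v \<le> M" unfolding bounded_iff by blast
  then have "\<bar>zero_extension \<Omega> \<psi> x\<bar> \<le> \<bar>M\<bar>" for x 
  proof (cases "x \<in> K")
    case True
    then have "norm (zero_extension \<Omega> \<psi> x) \<le> M" using \<open>\<forall>v\<in>_. _\<close> by blast
    then show ?thesis by simp
  qed (simp add: LK(3))
  then show ?thesis using that[of "\<bar>M\<bar>"] by (metis zero_extension_def)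
qed

lemma gradient_borel_measurable:
  assumes "\<psi> \<in> Lip0 \<Omega>" "open \<Omega>"
  shows "gradient \<psi> \<in> borel_measurable (lebesgue_on \<Omega>)"
proof -
  obtain G where G: "G \<in> borel_measurable borel"
    "AE x in lebesgue_on \<Omega>. (\<psi> has_derivative (\<lambda>h. G x \<bullet> h)) (at x) \<and> gradient \<psi> x = G x"
    by (rule Lip0_gradient[OF assms]) (rule that)
  have "G \<in> borel_measurable (lebesgue_on \<Omega>)"
    using G(1) by (intro measurable_restrict_space1 measurable_completion) simp
  then show ?thesis
  proof (rule borel_measurable_lebesgue_on_AE[OF _ assms(2)])
    show "AE x in lebesgue_on \<Omega>. G x = gradient \<psi> x" using G(2) by eventually_elim simp
  qed
qed

lemma gradient_bounded:
  assumes "\<psi> \<in> Lip0 \<Omega>" "open \<Omega>"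
  obtains L where "AE x in lebesgue_on \<Omega>. norm (gradient \<psi> x) \<le> L"
proof -
  obtain L G where "AE x in lborel. norm (G x) \<le> L"
    and "AE x in lebesgue_on \<Omega>. (\<psi> has_derivative (\<lambda>h. G x \<bullet> h)) (at x) \<and> gradient \<psi> x = G x"
    by (rule Lip0_gradient[OF assms]) (rule that)
  from AE_lebesgue_on_if_AE_lborel[OF this(1) assms(2)] this(2)
  have "AE x in lebesgue_on \<Omega>. norm (gradient \<psi> x) \<le> L" by eventually_elim simp
  then show ?thesis by (rule that)
qed

lemma gradient_AE:
  assumes "\<psi> \<in> Lip0 \<Omega>" "open \<Omega>"
  shows "AE x in lebesgue_on \<Omega>. (\<psi> has_derivative (\<lambda>h. gradient \<psi> x \<bullet> h)) (at x)"
proof -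
  obtain G where
    "AE x in lebesgue_on \<Omega>. (\<psi> has_derivative (\<lambda>h. G x \<bullet> h)) (at x) \<and> gradient \<psi> x = G x"
    by (rule Lip0_gradient[OF assms]) (rule that)
  then show ?thesis by eventually_elim auto
qed

lemma Lip0_weak_Sobolev:
  assumes dim: "3 \<le> CARD('n::finite)"
  shows "\<exists>C>0. \<forall>(\<Omega> :: (real ^ 'n) set) \<psi> \<Gamma> t. open \<Omega> \<and> \<psi> \<in> Lip0 \<Omega> \<and>
    0 < \<Gamma> \<and> (\<integral>\<^sup>+x. ennreal ((norm (gradient \<psi> x))\<^sup>2) \<partial>lebesgue_on \<Omega>) \<le> ennreal (\<Gamma>\<^sup>2) \<and> 0 < t \<longrightarrow>
    emeasure (lebesgue_on \<Omega>) {x \<in> \<Omega>. t \<le> \<bar>\<psi> x\<bar>} \<le> ennreal (C * (\<Gamma> / t) powr (2 * CARD('n) / (CARD('n) - 2)))"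
proof -
  have dim': "3 \<le> DIM(real ^ 'n)" using dim by simp
  obtain C :: real where C: "0 < C"
    "\<forall>(f :: real ^ 'n \<Rightarrow> real) G L \<rho> \<Gamma> t.
    L-lipschitz_on UNIV f \<and> (\<forall>z. z \<notin> cball 0 \<rho> \<longrightarrow> f z = 0) \<and>
    G \<in> borel_measurable borel \<and> (AE x in lborel. (f has_derivative (\<lambda>h. G x \<bullet> h)) (at x)) \<and>
    0 < \<Gamma> \<and> (\<integral>\<^sup>+z. ennreal ((norm (G z))\<^sup>2) \<partial>lborel) \<le> ennreal (\<Gamma>\<^sup>2) \<and> 0 < t \<longrightarrow>
    emeasure lborel {x. t \<le> \<bar>f x\<bar>} \<le> ennreal (C * (\<Gamma> / t) powr (2 * DIM(real ^ 'n) / (DIM(real ^ 'n) - 2)))"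
    using weak_Sobolev_inequality[OF dim'] by blast
  show ?thesis
  proof (intro exI[of _ C] conjI C(1) allI impI, elim conjE)
    fix \<Omega> :: "(real ^ 'n) set" and \<psi> and \<Gamma> t :: real
    assume \<Omega>: "open \<Omega>" and \<psi>: "\<psi> \<in> Lip0 \<Omega>" and \<Gamma>: "0 < \<Gamma>" and t: "0 < t"
      and E: "(\<integral>\<^sup>+x. ennreal ((norm (gradient \<psi> x))\<^sup>2) \<partial>lebesgue_on \<Omega>) \<le> ennreal (\<Gamma>\<^sup>2)"
    let ?\<psi> = "zero_extension \<Omega> \<psi>"
    obtain L K G where L: "L-lipschitz_on UNIV ?\<psi>" and K: "compact K" "K \<subseteq> \<Omega>" "\<forall>x. x \<notin> K \<longrightarrow> ?\<psi> x = 0"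
      and G[measurable]: "G \<in> borel_measurable borel" and der: "AE x in lborel. (?\<psi> has_derivative (\<lambda>h. G x \<bullet> h)) (at x)"
      and bd: "AE x in lborel. norm (G x) \<le> L" and out: "AE x in lborel. x \<notin> \<Omega> \<longrightarrow> G x = 0"
      and gr: "AE x in lebesgue_on \<Omega>. (\<psi> has_derivative (\<lambda>h. G x \<bullet> h)) (at x) \<and> gradient \<psi> x = G x"
      by (rule Lip0_gradient[OF \<psi> \<Omega>])
    obtain \<rho> where \<rho>: "K \<subseteq> cball 0 \<rho>" 
      using compact_imp_bounded[OF K(1)] unfolding bounded_iff by (auto simp: subset_iff)
    have "(\<integral>\<^sup>+z. ennreal ((norm (G z))\<^sup>2) \<partial>lborel) = (\<integral>\<^sup>+z. ennreal ((norm (G z))\<^sup>2) * indicator \<Omega> z \<partial>lborel)"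
    proof (rule nn_integral_cong_AE)
      show "AE z in lborel. ennreal ((norm (G z))\<^sup>2) = ennreal ((norm (G z))\<^sup>2) * indicator \<Omega> z"
        using out by eventually_elim (simp add: indicator_def)
    qed
    also have "\<dots> = (\<integral>\<^sup>+z. ennreal ((norm (G z))\<^sup>2) * indicator \<Omega> z \<partial>lebesgue)"
      by (simp add: nn_integral_completion)
    also have "\<dots> = (\<integral>\<^sup>+z. ennreal ((norm (G z))\<^sup>2) \<partial>lebesgue_on \<Omega>)"
      using \<Omega> by (subst nn_integral_restrict_space) auto
    also have "\<dots> = (\<integral>\<^sup>+x. ennreal ((norm (gradient \<psi> x))\<^sup>2) \<partial>lebesgue_on \<Omega>)"
    proof (rule nn_integral_cong_AE)
      show "AE x in lebesgue_on \<Omega>. ennreal ((norm (G x))\<^sup>2) = ennreal ((norm (gradient \<psi> x))\<^sup>2)"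
        using gr by eventually_elim simp
    qed
    finally have E': "(\<integral>\<^sup>+z. ennreal ((norm (G z))\<^sup>2) \<partial>lborel) \<le> ennreal (\<Gamma>\<^sup>2)" using E by simp
    have cl: "closed {x. t \<le> \<bar>?\<psi> x\<bar>}"
      using lipschitz_on_continuous_on[OF L] by (intro closed_Collect_le continuous_intros)
    have "emeasure (lebesgue_on \<Omega>) {x \<in> \<Omega>. t \<le> \<bar>\<psi> x\<bar>} = emeasure lebesgue {x \<in> \<Omega>. t \<le> \<bar>\<psi> x\<bar>}"
      using \<Omega> by (intro emeasure_restrict_space) auto
    also have "\<dots> \<le> emeasure lebesgue {x. t \<le> \<bar>?\<psi> x\<bar>}"
      using cl by (intro emeasure_mono) (auto simp: zero_extension_def borel_closed)
    also have "\<dots> = emeasure lborel {x. t \<le> \<bar>?\<psi> x\<bar>}"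
      using cl by (simp add: borel_closed)
    also have "\<dots> \<le> ennreal (C * (\<Gamma> / t) powr (2 * DIM(real ^ 'n) / (DIM(real ^ 'n) - 2)))"
      using K(3) \<rho> L G der \<Gamma> E' t by (intro C(2)[rule_format, of L ?\<psi> \<rho> G]) blast
    finally show "emeasure (lebesgue_on \<Omega>) {x \<in> \<Omega>. t \<le> \<bar>\<psi> x\<bar>} \<le> ennreal (C * (\<Gamma> / t) powr (2 * CARD('n) / (CARD('n) - 2)))"
      by simp
  qed
qed

section \<open>Truncation to a slab of values\<close>

definition slab :: "real \<Rightarrow> real \<Rightarrow> real \<Rightarrow> real" where
  "slab k \<tau> s = min (max (s - k) 0) \<tau>"

lemma slab_bounds:
  assumes "0 < \<tau>"
  shows "0 \<le> slab k \<tau> s" "slab k \<tau> s \<le> \<tau>"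
  using assms by (auto simp: slab_def)

lemma slab_Lip0:
  assumes \<psi>: "\<psi> \<in> Lip0 \<Omega>" and k: "0 \<le> k" and \<tau>: "0 < \<tau>"
  shows "(\<lambda>x. slab k \<tau> (\<psi> x)) \<in> Lip0 \<Omega>"
proof -
  obtain L where L: "L-lipschitz_on \<Omega> \<psi>" and K: "compact (closure (support_on \<Omega> \<psi>))" "closure (support_on \<Omega> \<psi>) \<subseteq> \<Omega>"
    using \<psi> unfolding Lip0_def by blast
  have "support_on \<Omega> (\<lambda>x. slab k \<tau> (\<psi> x)) \<subseteq> support_on \<Omega> \<psi>"
    using k \<tau> by (auto simp: support_on_def slab_def)
  then have sub: "closure (support_on \<Omega> (\<lambda>x. slab k \<tau> (\<psi> x))) \<subseteq> closure (support_on \<Omega> \<psi>)"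
    by (rule closure_mono)
  have "L-lipschitz_on \<Omega> (\<lambda>x. slab k \<tau> (\<psi> x))"
  proof (rule lipschitz_onI)
    fix x y assume "x \<in> \<Omega>" "y \<in> \<Omega>"
    then have "\<bar>\<psi> x - \<psi> y\<bar> \<le> L * dist x y" using lipschitz_onD[OF L] by (simp add: dist_real_def)
    moreover have "\<bar>slab k \<tau> (\<psi> x) - slab k \<tau> (\<psi> y)\<bar> \<le> \<bar>\<psi> x - \<psi> y\<bar>"
      by (simp add: slab_def)
    ultimately show "dist (slab k \<tau> (\<psi> x)) (slab k \<tau> (\<psi> y)) \<le> L * dist x y" by (simp add: dist_real_def)
  qed (use L in \<open>rule lipschitz_on_nonneg\<close>)
  moreover have "compact (closure (support_on \<Omega> (\<lambda>x. slab k \<tau> (\<psi> x))))"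
    using K(1) sub by (meson closed_closure compact_Int_closed compact_closure bounded_subset closure_subset compact_eq_bounded_closed)
  ultimately show ?thesis using sub K(2) unfolding Lip0_def by blast
qed

text \<open>
  The truncated function is minimal where \<open>\<psi> \<le> k\<close> and maximal where \<open>k + \<tau> \<le> \<psi>\<close>, so its derivative vanishes there,
  also on the level sets \<open>{\<psi> = k}\<close> and \<open>{\<psi> = k + \<tau>}\<close>, which may have positive measure.
\<close>

lemma derivative_slab_cases:
  fixes \<psi> :: "'a::euclidean_space \<Rightarrow> real"
  assumes \<tau>: "0 < \<tau>" and 1: "(\<psi> has_derivative (\<lambda>h. a \<bullet> h)) (at x)"
    and 2: "((\<lambda>x. slab k \<tau> (\<psi> x)) has_derivative (\<lambda>h. b \<bullet> h)) (at x)"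
  shows "b = 0 \<or> b = a"
proof -
  let ?w = "\<lambda>x. slab k \<tau> (\<psi> x)"
  consider "\<psi> x \<le> k" | "k + \<tau> \<le> \<psi> x" | "k < \<psi> x" "\<psi> x < k + \<tau>" by linarith
  then show ?thesis
  proof cases
    case 1
    then have "\<forall>y\<in>UNIV. ?w x \<le> ?w y" using \<tau> by (auto simp: slab_def)
    then have "(\<lambda>h. b \<bullet> h) = (\<lambda>h. 0)"
      using differential_zero_maxmin[OF _ _ 2, of UNIV] by auto
    then have "b \<bullet> b = 0" by metis
    then show ?thesis by simp
  next
    case 2
    then have "\<forall>y\<in>UNIV. ?w y \<le> ?w x" using \<tau> by (auto simp: slab_def)
    then have "(\<lambda>h. b \<bullet> h) = (\<lambda>h. 0)"
      using differential_zero_maxmin[OF _ _ assms(3), of UNIV] by auto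
    then have "b \<bullet> b = 0" by metis
    then show ?thesis by simp
  next
    case 3
    have "isCont \<psi> x" using 1 by (rule has_derivative_continuous)
    then have "(\<psi> \<longlongrightarrow> \<psi> x) (at x)" by (simp add: isCont_def)
    then have "\<forall>\<^sub>F y in at x. k < \<psi> y \<and> \<psi> y < k + \<tau>"
      using 3 by (intro eventually_conj order_tendstoD)
    then have ev: "\<forall>\<^sub>F y in at x. \<psi> y - k = ?w y" by eventually_elim (simp add: slab_def)
    have "((\<lambda>y. \<psi> y - k) has_derivative (\<lambda>h. a \<bullet> h)) (at x)"
      using has_derivative_diff[OF 1 has_derivative_const[of k]] by simp
    then have "(?w has_derivative (\<lambda>h. a \<bullet> h)) (at x)"
      by (rule has_derivative_transform_eventually[OF _ ev]) (use 3 in \<open>simp_all add: slab_def\<close>)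
    from has_derivative_unique[OF this assms(3)] have "\<forall>h. a \<bullet> h = b \<bullet> h" by metis
    then have "a = b" by (simp only: vector_eq_rdot)
    then show ?thesis by simp
  qed
qed

lemma gradient_slab_AE:
  assumes \<psi>: "\<psi> \<in> Lip0 \<Omega>" and \<Omega>: "open \<Omega>" and k: "0 \<le> k" and \<tau>: "0 < \<tau>"
  shows "AE x in lebesgue_on \<Omega>. gradient (\<lambda>x. slab k \<tau> (\<psi> x)) x = 0 \<or>
    gradient (\<lambda>x. slab k \<tau> (\<psi> x)) x = gradient \<psi> x"
  using gradient_AE[OF \<psi> \<Omega>] gradient_AE[OF slab_Lip0[OF \<psi> k \<tau>] \<Omega>]
  by eventually_elim (rule derivative_slab_cases[OF \<tau>])

section \<open>The energy estimate\<close>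

lemma borel_measurable_bilinear_form:
  fixes Q :: "'a \<Rightarrow> real ^ 'n ^ 'n"
  assumes [measurable]: "Q \<in> borel_measurable M" "a \<in> borel_measurable M" "b \<in> borel_measurable M"
  shows "(\<lambda>x. a x \<bullet> (Q x *v b x)) \<in> borel_measurable M"
proof -
  have comp: "(\<lambda>x. h x $ i) \<in> borel_measurable M" if "h \<in> borel_measurable M"
    for h :: "'a \<Rightarrow> 'b::euclidean_space ^ 'm" and i
    using measurable_compose[OF that borel_measurable_continuous_onI[of "\<lambda>v. v $ i"]]
    by (simp add: continuous_on_component)
  note [measurable] = comp
  have "(\<lambda>x. a x \<bullet> (Q x *v b x)) = (\<lambda>x. \<Sum>i\<in>UNIV. a x $ i * (\<Sum>j\<in>UNIV. Q x $ i $ j * b x $ j))"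
    by (simp add: inner_vec_def matrix_vector_mult_def)
  also have "\<dots> \<in> borel_measurable M" by measurable
  finally show ?thesis .
qed

lemma norm_diff_sq_le: "(norm (a - b))\<^sup>2 \<le> 2 * (norm a)\<^sup>2 + 2 * (norm (b :: 'a::real_inner))\<^sup>2"
proof -
  have "0 \<le> (norm (a + b))\<^sup>2" by simp
  moreover have "(norm (a + b))\<^sup>2 + (norm (a - b))\<^sup>2 = 2 * (norm a)\<^sup>2 + 2 * (norm b)\<^sup>2"
    by (simp add: power2_norm_eq_inner inner_add_left inner_add_right inner_diff_left inner_diff_right)
  ultimately show ?thesis by linarith
qed

locale elliptic_matrix =
  fixes \<Omega> :: "(real ^ 'n) set" and Q :: "real ^ 'n \<Rightarrow> real ^ 'n ^ 'n" and l \<Lambda> :: real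
  assumes \<Omega>: "open \<Omega>" "bounded \<Omega>"
    and Q_measurable [measurable]: "Q \<in> borel_measurable (lebesgue_on \<Omega>)"
    and Q_self_adjoint: "\<And>x. x \<in> \<Omega> \<Longrightarrow> transpose (Q x) = Q x"
    and l: "0 < l"
    and elliptic: "AE x in lebesgue_on \<Omega>. \<forall>\<xi>. l * (norm \<xi>)\<^sup>2 \<le> (Q x *v \<xi>) \<bullet> \<xi> \<and> (Q x *v \<xi>) \<bullet> \<xi> \<le> \<Lambda> * (norm \<xi>)\<^sup>2"
begin

abbreviation S where "S x \<equiv> matrix_sqrt (Q x)"

lemma finite_measure_\<Omega>: "finite_measure (lebesgue_on \<Omega>)"
proof
  have "emeasure lebesgue \<Omega> < \<infinity>"
    using bounded_set_imp_lmeasurable[OF \<Omega>(2)] \<Omega>(1) by (auto simp: fmeasurable_def)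
  then show "emeasure (lebesgue_on \<Omega>) (space (lebesgue_on \<Omega>)) \<noteq> \<infinity>"
    using \<Omega> by (simp add: emeasure_restrict_space)
qed

lemma sqrt_AE: "AE x in lebesgue_on \<Omega>. (\<forall>a b. (S x *v a) \<bullet> (S x *v b) = a \<bullet> (Q x *v b)) \<and>
   (\<forall>a. l * (norm a)\<^sup>2 \<le> (norm (S x *v a))\<^sup>2 \<and> (norm (S x *v a))\<^sup>2 \<le> \<Lambda> * (norm a)\<^sup>2)"
proof -
  have "AE x in lebesgue_on \<Omega>. x \<in> \<Omega>" using AE_space[of "lebesgue_on \<Omega>"] by simp
  with elliptic show ?thesis
  proof eventually_elim
    case (elim x)
    have psd: "0 \<le> (Q x *v \<xi>) \<bullet> \<xi>" for \<xi>
      using elim(1) l by (meson mult_nonneg_nonneg order_trans less_imp_le zero_le_power2)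
    have 1: "(S x *v a) \<bullet> (S x *v b) = a \<bullet> (Q x *v b)" for a b
      using inner_matrix_sqrt[OF Q_self_adjoint[OF elim(2)] psd] .
    have "(norm (S x *v a))\<^sup>2 = (Q x *v a) \<bullet> a" for a
      using 1[of a a] by (simp add: power2_norm_eq_inner inner_commute)
    then show ?case using 1 elim(1) by simp
  qed
qed

lemma integrable_sqrt_sq:
  assumes [measurable]: "v \<in> borel_measurable (lebesgue_on \<Omega>)"
    and b: "AE x in lebesgue_on \<Omega>. (norm (S x *v v x))\<^sup>2 \<le> h x" and h: "integrable (lebesgue_on \<Omega>) h"
  shows "integrable (lebesgue_on \<Omega>) (\<lambda>x. (norm (S x *v v x))\<^sup>2)"
proof (rule Bochner_Integration.integrable_bound[OF h])
  have "(\<lambda>x. v x \<bullet> (Q x *v v x)) \<in> borel_measurable (lebesgue_on \<Omega>)"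
    by (rule borel_measurable_bilinear_form) auto
  then show "(\<lambda>x. (norm (S x *v v x))\<^sup>2) \<in> borel_measurable (lebesgue_on \<Omega>)"
  proof (rule borel_measurable_lebesgue_on_AE[OF _ \<Omega>(1)])
    show "AE x in lebesgue_on \<Omega>. v x \<bullet> (Q x *v v x) = (norm (S x *v v x))\<^sup>2"
      using sqrt_AE by eventually_elim (simp add: power2_norm_eq_inner)
  qed
  show "AE x in lebesgue_on \<Omega>. norm ((norm (S x *v v x))\<^sup>2) \<le> norm (h x)"
    using b by eventually_elim simp
qed

lemma integrable_gradient_energy:
  assumes \<psi>: "\<psi> \<in> Lip0 \<Omega>"
  shows "integrable (lebesgue_on \<Omega>) (\<lambda>x. (norm (S x *v gradient \<psi> x))\<^sup>2)"
proof -
  interpret finite_measure "lebesgue_on \<Omega>" by (rule finite_measure_\<Omega>)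
  obtain M where M: "AE x in lebesgue_on \<Omega>. norm (gradient \<psi> x) \<le> M" using gradient_bounded[OF \<psi> \<Omega>(1)] .
  show ?thesis
  proof (rule integrable_sqrt_sq[OF gradient_borel_measurable[OF \<psi> \<Omega>(1)]])
    show "AE x in lebesgue_on \<Omega>. (norm (S x *v gradient \<psi> x))\<^sup>2 \<le> \<bar>\<Lambda>\<bar> * M\<^sup>2"
      using sqrt_AE M
    proof eventually_elim
      case (elim x)
      have "(norm (S x *v gradient \<psi> x))\<^sup>2 \<le> \<Lambda> * (norm (gradient \<psi> x))\<^sup>2" using elim(1) by blast
      also have "\<dots> \<le> \<bar>\<Lambda>\<bar> * M\<^sup>2" using elim(2) by (intro mult_mono power_mono) auto
      finally show ?case .
    qed
  qed simp
qed

lemma integrable_energy_diff: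
  assumes \<psi>: "\<psi> \<in> Lip0 \<Omega>" and g: "g \<in> borel_measurable (lebesgue_on \<Omega>)"
    and gi: "integrable (lebesgue_on \<Omega>) (\<lambda>x. (norm (S x *v g x))\<^sup>2)"
  shows "integrable (lebesgue_on \<Omega>) (\<lambda>x. (norm (S x *v (gradient \<psi> x - g x)))\<^sup>2)"
proof (rule integrable_sqrt_sq)
  show "(\<lambda>x. gradient \<psi> x - g x) \<in> borel_measurable (lebesgue_on \<Omega>)"
    using gradient_borel_measurable[OF \<psi> \<Omega>(1)] g by measurable
  show "AE x in lebesgue_on \<Omega>. (norm (S x *v (gradient \<psi> x - g x)))\<^sup>2
      \<le> 2 * (norm (S x *v gradient \<psi> x))\<^sup>2 + 2 * (norm (S x *v g x))\<^sup>2"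
    by (intro AE_I2) (simp add: matrix_vector_mult_diff_distrib norm_diff_sq_le)
  show "integrable (lebesgue_on \<Omega>) (\<lambda>x. 2 * (norm (S x *v gradient \<psi> x))\<^sup>2 + 2 * (norm (S x *v g x))\<^sup>2)"
    using integrable_gradient_energy[OF \<psi>] gi by auto
qed

text \<open>
  Let \<open>w\<close> be the truncation. Where \<open>\<nabla>w\<close> does not vanish it equals \<open>\<nabla>\<psi>\<close>, hence
  \<open>|S \<nabla>w|\<^sup>2 = S \<nabla>w \<bullet> S g + S \<nabla>w \<bullet> S (\<nabla>\<psi> - g)\<close>. The first term integrates to \<open>I\<close> and the second is
  absorbed by Young's inequality.
\<close>

lemma slab_energy_le:
  assumes \<psi>: "\<psi> \<in> Lip0 \<Omega>" and g: "g \<in> borel_measurable (lebesgue_on \<Omega>)"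
    and gi: "integrable (lebesgue_on \<Omega>) (\<lambda>x. (norm (S x *v g x))\<^sup>2)"
    and k: "0 \<le> k" and \<tau>: "0 < \<tau>"
    and weak: "(\<integral>x. gradient (\<lambda>x. slab k \<tau> (\<psi> x)) x \<bullet> (Q x *v g x) \<partial>lebesgue_on \<Omega>) = I"
  shows "(\<integral>\<^sup>+x. ennreal ((norm (gradient (\<lambda>x. slab k \<tau> (\<psi> x)) x))\<^sup>2) \<partial>lebesgue_on \<Omega>)
     \<le> ennreal ((2 * I + (\<integral>x. (norm (S x *v (gradient \<psi> x - g x)))\<^sup>2 \<partial>lebesgue_on \<Omega>)) / l)"
proof -
  let ?w = "\<lambda>x. slab k \<tau> (\<psi> x)"
  let ?M = "lebesgue_on \<Omega>"
  have w: "?w \<in> Lip0 \<Omega>" by (rule slab_Lip0[OF \<psi> k \<tau>])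
  let ?e = "\<lambda>x. gradient ?w x \<bullet> (Q x *v g x)" and ?d = "\<lambda>x. (norm (S x *v (gradient \<psi> x - g x)))\<^sup>2"
  have ei: "integrable ?M ?e"
  proof (rule Bochner_Integration.integrable_bound)
    show "integrable ?M (\<lambda>x. (norm (S x *v gradient ?w x))\<^sup>2 + (norm (S x *v g x))\<^sup>2)"
      using integrable_gradient_energy[OF w] gi by auto
    show "?e \<in> borel_measurable ?M"
      using gradient_borel_measurable[OF w \<Omega>(1)] g by (intro borel_measurable_bilinear_form) auto
    show "AE x in ?M. norm (?e x) \<le> norm ((norm (S x *v gradient ?w x))\<^sup>2 + (norm (S x *v g x))\<^sup>2)"
      using sqrt_AE
    proof eventually_elim
      case (elim x)
      have "?e x = (S x *v gradient ?w x) \<bullet> (S x *v g x)" using elim by simp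
      then have "\<bar>?e x\<bar> \<le> norm (S x *v gradient ?w x) * norm (S x *v g x)"
        using Cauchy_Schwarz_ineq2 by metis
      also have "\<dots> \<le> (norm (S x *v gradient ?w x))\<^sup>2 + (norm (S x *v g x))\<^sup>2"
        using sum_squares_bound[of "norm (S x *v gradient ?w x)" "norm (S x *v g x)"]
          mult_nonneg_nonneg[OF norm_ge_zero[of "S x *v gradient ?w x"] norm_ge_zero[of "S x *v g x"]] by linarith
      finally show ?case by simp
    qed
  qed
  have di: "integrable ?M ?d" by (rule integrable_energy_diff[OF \<psi> g gi])
  have pt: "AE x in ?M. l * (norm (gradient ?w x))\<^sup>2 \<le> 2 * ?e x + ?d x"
    using sqrt_AE gradient_slab_AE[OF \<psi> \<Omega>(1) k \<tau>]
  proof eventually_elim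
    case (elim x)
    let ?a = "S x *v gradient ?w x" and ?p = "S x *v gradient \<psi> x" and ?g = "S x *v g x"
    have form: "(S x *v a) \<bullet> (S x *v b) = a \<bullet> (Q x *v b)" and low: "l * (norm a)\<^sup>2 \<le> (norm (S x *v a))\<^sup>2" for a b
      using elim(1) by blast+
    have "?a \<bullet> ?a = ?a \<bullet> ?p" using elim(2) by auto
    then have "?a \<bullet> ?a = ?a \<bullet> ?g + ?a \<bullet> (?p - ?g)" by (simp add: inner_diff_right)
    moreover have "0 \<le> (?a - (?p - ?g)) \<bullet> (?a - (?p - ?g))" by simp
    then have "2 * (?a \<bullet> (?p - ?g)) \<le> ?a \<bullet> ?a + (?p - ?g) \<bullet> (?p - ?g)"
      by (simp add: inner_diff_left inner_diff_right inner_commute)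
    ultimately have "?a \<bullet> ?a \<le> 2 * (?a \<bullet> ?g) + (?p - ?g) \<bullet> (?p - ?g)" by linarith
    moreover have "l * (norm (gradient ?w x))\<^sup>2 \<le> ?a \<bullet> ?a" using low[of "gradient ?w x"] by (simp only: power2_norm_eq_inner)
    moreover have "?a \<bullet> ?g = ?e x" by (rule form)
    moreover have "(?p - ?g) \<bullet> (?p - ?g) = ?d x" by (simp only: power2_norm_eq_inner matrix_vector_mult_diff_distrib)
    ultimately show ?case by linarith
  qed
  have "(\<integral>\<^sup>+x. ennreal ((norm (gradient ?w x))\<^sup>2) \<partial>?M) \<le> (\<integral>\<^sup>+x. ennreal ((2 * ?e x + ?d x) / l) \<partial>?M)"
  proof (rule nn_integral_mono_AE)
    show "AE x in ?M. ennreal ((norm (gradient ?w x))\<^sup>2) \<le> ennreal ((2 * ?e x + ?d x) / l)"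
      using pt by eventually_elim (use l in \<open>simp add: ennreal_leI pos_le_divide_eq mult.commute\<close>)
  qed
  also have "\<dots> = ennreal (\<integral>x. (2 * ?e x + ?d x) / l \<partial>?M)"
  proof (rule nn_integral_eq_integral)
    show "integrable ?M (\<lambda>x. (2 * ?e x + ?d x) / l)" using ei di by auto
    show "AE x in ?M. 0 \<le> (2 * ?e x + ?d x) / l"
      using pt
    proof eventually_elim
      case (elim x)
      have "0 \<le> l * (norm (gradient ?w x))\<^sup>2" using l by simp
      with elim have "0 \<le> 2 * ?e x + ?d x" by linarith
      then show ?case using l by (rule divide_nonneg_pos)
    qed
  qed
  also have "(\<integral>x. (2 * ?e x + ?d x) / l \<partial>?M) = (2 * I + (\<integral>x. ?d x \<partial>?M)) / l"
    using ei di weak by simp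
  finally show ?thesis .
qed

end

section \<open>Decay of the level sets\<close>

lemma slab_eq_upper: "k + \<tau> \<le> s \<Longrightarrow> 0 < \<tau> \<Longrightarrow> slab k \<tau> s = \<tau>"
  by (simp add: slab_def)

lemma continuous_slab: "continuous_on UNIV (slab k \<tau>)"
  unfolding slab_def by (intro continuous_intros)

lemma tendsto_slab: "(X \<longlongrightarrow> s) F \<Longrightarrow> ((\<lambda>i. slab k \<tau> (X i)) \<longlongrightarrow> slab k \<tau> s) F"
  unfolding slab_def by (intro tendsto_intros)

context elliptic_matrix
begin

lemma Lip0_approximation:
  assumes u: "in_Lip0_closure \<Omega> Q u g"
  obtains \<phi> where "\<forall>j. \<phi> j \<in> Lip0 \<Omega>" "AE x in lebesgue_on \<Omega>. (\<lambda>j::nat. \<phi> j x) \<longlonglongrightarrow> u x"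
    "(\<lambda>j. \<integral>x. (norm (S x *v (gradient (\<phi> j) x - g x)))\<^sup>2 \<partial>lebesgue_on \<Omega>) \<longlonglongrightarrow> 0"
proof -
  interpret finite_measure "lebesgue_on \<Omega>" by (rule finite_measure_\<Omega>)
  let ?M = "lebesgue_on \<Omega>"
  obtain \<psi> where \<psi>: "\<And>j. \<psi> j \<in> Lip0 \<Omega>"
    and lim: "(\<lambda>j. energy_norm \<Omega> Q (\<lambda>x. \<psi> j x - u x) (\<lambda>x. gradient (\<psi> j) x - g x)) \<longlonglongrightarrow> 0"
    and um [measurable]: "u \<in> borel_measurable ?M" and ui: "integrable ?M (\<lambda>x. (u x)\<^sup>2)"
    using u unfolding in_Lip0_closure_def by blast
  let ?a = "\<lambda>j. \<integral>x. (\<psi> j x - u x)\<^sup>2 \<partial>?M"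
  let ?b = "\<lambda>j. \<integral>x. (norm (S x *v (gradient (\<psi> j) x - g x)))\<^sup>2 \<partial>?M"
  have a0: "0 \<le> ?a j" and b0: "0 \<le> ?b j" for j by (auto intro!: integral_nonneg_AE)
  have sa: "(\<lambda>j. sqrt (?a j)) \<longlonglongrightarrow> 0"
    by (rule tendsto_sandwich[OF _ _ tendsto_const lim]) (use a0 b0 in \<open>auto simp: energy_norm_def\<close>)
  have sb: "(\<lambda>j. sqrt (?b j)) \<longlonglongrightarrow> 0"
    by (rule tendsto_sandwich[OF _ _ tendsto_const lim]) (use a0 b0 in \<open>auto simp: energy_norm_def\<close>)
  have a: "?a \<longlonglongrightarrow> 0" using tendsto_power[OF sa, of 2] a0 by simp
  have b: "?b \<longlonglongrightarrow> 0" using tendsto_power[OF sb, of 2] b0 by simp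
  have int: "integrable ?M (\<lambda>x. (\<psi> j x - u x)\<^sup>2)" for j
  proof -
    obtain M where M: "\<And>x. x \<in> \<Omega> \<Longrightarrow> \<bar>\<psi> j x\<bar> \<le> M" using Lip0_bounded[OF \<psi> \<Omega>(1)] by blast
    note [measurable] = Lip0_borel_measurable[OF \<psi> \<Omega>(1)]
    show ?thesis
    proof (rule Bochner_Integration.integrable_bound)
      show "integrable ?M (\<lambda>x. 2 * M\<^sup>2 + 2 * (u x)\<^sup>2)" using ui by auto
      show "(\<lambda>x. (\<psi> j x - u x)\<^sup>2) \<in> borel_measurable ?M" by measurable
      show "AE x in ?M. norm ((\<psi> j x - u x)\<^sup>2) \<le> norm (2 * M\<^sup>2 + 2 * (u x)\<^sup>2)"
      proof (rule AE_I2)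
        fix x assume "x \<in> space ?M"
        then have "\<bar>\<psi> j x\<bar> \<le> \<bar>M\<bar>" using order_trans[OF M abs_ge_self] by simp
        then have "(\<psi> j x)\<^sup>2 \<le> M\<^sup>2" by (simp only: abs_le_square_iff)
        moreover have "(\<psi> j x - u x)\<^sup>2 \<le> 2 * (\<psi> j x)\<^sup>2 + 2 * (u x)\<^sup>2"
          using norm_diff_sq_le[of "\<psi> j x" "u x"] by simp
        ultimately show "norm ((\<psi> j x - u x)\<^sup>2) \<le> norm (2 * M\<^sup>2 + 2 * (u x)\<^sup>2)" by simp
      qed
    qed
  qed
  obtain r :: "nat \<Rightarrow> nat" where r: "strict_mono r" "AE x in ?M. (\<lambda>j. (\<psi> (r j) x - u x)\<^sup>2) \<longlonglongrightarrow> 0"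
    using tendsto_L1_AE_subseq[of ?M "\<lambda>j x. (\<psi> j x - u x)\<^sup>2", OF int] a by auto
  show ?thesis
  proof (rule that[of "\<lambda>j. \<psi> (r j)"])
    show "AE x in ?M. (\<lambda>j. \<psi> (r j) x) \<longlonglongrightarrow> u x"
      using r(2)
    proof eventually_elim
      case (elim x)
      have "(\<lambda>j. sqrt ((\<psi> (r j) x - u x)\<^sup>2)) \<longlonglongrightarrow> sqrt 0" by (intro tendsto_real_sqrt elim)
      then have "(\<lambda>j. \<psi> (r j) x - u x) \<longlonglongrightarrow> 0" by (simp add: tendsto_rabs_zero_iff)
      then show ?case by (simp add: LIM_zero_iff)
    qed
    show "(\<lambda>j. ?b (r j)) \<longlonglongrightarrow> 0" using LIMSEQ_subseq_LIMSEQ[OF b r(1)] by (simp add: comp_def)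
  qed (use \<psi> in blast)
qed

text \<open>
  The truncations of the approximants satisfy the energy estimate, and the weak-type Sobolev inequality at height \<open>\<tau> / 2\<close> bounds
  the sets where they are at least \<open>\<tau> / 2\<close>. Almost every point of \<open>{u > k + \<tau>}\<close> lies in all but finitely many of
  these sets, so Fatou's lemma gives the claim.
\<close>

theorem level_set_decay:
  assumes dim: "3 \<le> CARD('n)"
  shows "\<exists>C>0. \<forall>u g f k \<tau>. in_Lip0_closure \<Omega> Q u g \<and> integrable (lebesgue_on \<Omega>) f \<and>
      (\<forall>\<psi>\<in>Lip0 \<Omega>. (\<integral>x. gradient \<psi> x \<bullet> (Q x *v g x) \<partial>lebesgue_on \<Omega>) = (\<integral>x. f x * \<psi> x \<partial>lebesgue_on \<Omega>)) \<and>
      0 \<le> k \<and> 0 < \<tau> \<longrightarrow>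
      emeasure (lebesgue_on \<Omega>) {x \<in> \<Omega>. k + \<tau> < u x}
        \<le> ennreal (C * ((\<integral>x. indicator {x. k < u x} x * \<bar>f x\<bar> \<partial>lebesgue_on \<Omega>) / \<tau>) powr (CARD('n) / (CARD('n) - 2)))"
proof -
  let ?M = "lebesgue_on \<Omega>"
  define \<sigma> :: real where "\<sigma> = CARD('n) / (CARD('n) - 2)"
  have \<sigma>: "0 < \<sigma>" using dim by (simp add: \<sigma>_def)
  obtain C :: real where C: "0 < C" and Sob: "\<forall>(\<Omega> :: (real ^ 'n) set) \<psi> \<Gamma> t. open \<Omega> \<and> \<psi> \<in> Lip0 \<Omega> \<and>
    0 < \<Gamma> \<and> (\<integral>\<^sup>+x. ennreal ((norm (gradient \<psi> x))\<^sup>2) \<partial>lebesgue_on \<Omega>) \<le> ennreal (\<Gamma>\<^sup>2) \<and> 0 < t \<longrightarrow>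
    emeasure (lebesgue_on \<Omega>) {x \<in> \<Omega>. t \<le> \<bar>\<psi> x\<bar>} \<le> ennreal (C * (\<Gamma> / t) powr (2 * CARD('n) / (CARD('n) - 2)))"
    using Lip0_weak_Sobolev[OF dim] by blast
  show ?thesis
  proof (intro exI[of _ "C * (8 / l) powr \<sigma>"] conjI allI impI, goal_cases)
    case 1
    show ?case using C l by simp
  next
    case (2 u g f k \<tau>)
    then have u: "in_Lip0_closure \<Omega> Q u g" and f: "integrable ?M f" and k: "0 \<le> k" and \<tau>: "0 < \<tau>"
      and weak: "\<And>\<psi>. \<psi> \<in> Lip0 \<Omega> \<Longrightarrow> (\<integral>x. gradient \<psi> x \<bullet> (Q x *v g x) \<partial>?M) = (\<integral>x. f x * \<psi> x \<partial>?M)"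
      by auto
    have um [measurable]: "u \<in> borel_measurable ?M" and gm: "g \<in> borel_measurable ?M"
      and gi: "integrable ?M (\<lambda>x. (norm (S x *v g x))\<^sup>2)"
      using u unfolding in_Lip0_closure_def by auto
    have fm [measurable]: "f \<in> borel_measurable ?M" using f by auto
    obtain \<phi> where \<phi>': "\<forall>j. \<phi> j \<in> Lip0 \<Omega>" and lim: "AE x in ?M. (\<lambda>j::nat. \<phi> j x) \<longlonglongrightarrow> u x"
      and \<delta>: "(\<lambda>j. \<integral>x. (norm (S x *v (gradient (\<phi> j) x - g x)))\<^sup>2 \<partial>?M) \<longlonglongrightarrow> 0"
      by (rule Lip0_approximation[OF u])
    have \<phi>: "\<phi> j \<in> Lip0 \<Omega>" for j using \<phi>' by blast
    let ?\<delta> = "\<lambda>j. \<integral>x. (norm (S x *v (gradient (\<phi> j) x - g x)))\<^sup>2 \<partial>?M"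
    let ?w = "\<lambda>j x. slab k \<tau> (\<phi> j x)"
    have w: "?w j \<in> Lip0 \<Omega>" for j by (rule slab_Lip0[OF \<phi> k \<tau>])
    note [measurable] = Lip0_borel_measurable[OF w \<Omega>(1)]
    have [measurable]: "slab k \<tau> \<in> borel_measurable borel"
      using continuous_slab by (rule borel_measurable_continuous_onI)
    let ?I = "\<lambda>j. \<integral>x. f x * ?w j x \<partial>?M" and ?J = "\<integral>x. f x * slab k \<tau> (u x) \<partial>?M"
    have fb: "norm (f x * slab k \<tau> s) \<le> \<tau> * \<bar>f x\<bar>" for x s
      using mult_left_mono[OF slab_bounds(2)[OF \<tau>], of "\<bar>f x\<bar>" k s] slab_bounds(1)[OF \<tau>, of k s]
      by (simp add: abs_mult mult.commute)
    have I: "?I \<longlonglongrightarrow> ?J"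
    proof (rule integral_dominated_convergence[where w="\<lambda>x. \<tau> * \<bar>f x\<bar>"])
      show "integrable ?M (\<lambda>x. \<tau> * \<bar>f x\<bar>)" using f by auto
      show "AE x in ?M. (\<lambda>j. f x * ?w j x) \<longlonglongrightarrow> f x * slab k \<tau> (u x)"
        using lim by eventually_elim (intro tendsto_mult_left tendsto_slab)
      show "AE x in ?M. norm (f x * ?w j x) \<le> \<tau> * \<bar>f x\<bar>" for j
        using fb by (intro AE_I2)
    qed measurable
    \<comment> \<open>The summand \<open>1 / (j + 1)\<close> keeps \<open>\<Gamma>2 j\<close> positive.\<close>
    define \<Gamma>2 where "\<Gamma>2 j = max 0 ((2 * ?I j + ?\<delta> j) / l) + 1 / real (Suc j)" for j
    have \<Gamma>pos: "0 < \<Gamma>2 j" for j unfolding \<Gamma>2_def by (intro add_nonneg_pos) auto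
    have "\<Gamma>2 \<longlonglongrightarrow> max 0 ((2 * ?J + 0) / l) + 0"
      unfolding \<Gamma>2_def using l LIMSEQ_inverse_real_of_nat
      by (intro tendsto_intros I \<delta>) (auto simp: inverse_eq_divide)
    then have \<Gamma>lim: "\<Gamma>2 \<longlonglongrightarrow> max 0 (2 * ?J / l)" by simp
    have bound: "emeasure ?M {x \<in> \<Omega>. \<tau> / 2 \<le> ?w j x} \<le> ennreal (C * (4 * \<Gamma>2 j / \<tau>\<^sup>2) powr \<sigma>)" for j
    proof -
      have "(\<integral>\<^sup>+x. ennreal ((norm (gradient (?w j) x))\<^sup>2) \<partial>?M) \<le> ennreal ((2 * ?I j + ?\<delta> j) / l)"
        by (rule slab_energy_le[OF \<phi> gm gi k \<tau> weak[OF w]])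
      also have "\<dots> \<le> ennreal ((sqrt (\<Gamma>2 j))\<^sup>2)" 
      proof (rule ennreal_leI)
        have "(2 * ?I j + ?\<delta> j) / l \<le> \<Gamma>2 j" unfolding \<Gamma>2_def by (intro add_increasing2) auto
        then show "(2 * ?I j + ?\<delta> j) / l \<le> (sqrt (\<Gamma>2 j))\<^sup>2" using \<Gamma>pos[of j] by simp
      qed
      finally have "emeasure ?M {x \<in> \<Omega>. \<tau> / 2 \<le> \<bar>?w j x\<bar>}
          \<le> ennreal (C * (sqrt (\<Gamma>2 j) / (\<tau> / 2)) powr (2 * CARD('n) / (CARD('n) - 2)))"
        using Sob[rule_format, of \<Omega> "?w j" "sqrt (\<Gamma>2 j)" "\<tau> / 2"] \<Omega>(1) w \<Gamma>pos \<tau> by simp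
      also have "(sqrt (\<Gamma>2 j) / (\<tau> / 2)) powr (2 * CARD('n) / (CARD('n) - 2)) = (4 * \<Gamma>2 j / \<tau>\<^sup>2) powr \<sigma>"
      proof -
        have "(sqrt (\<Gamma>2 j) / (\<tau> / 2)) powr (2 * CARD('n) / (CARD('n) - 2)) = ((sqrt (\<Gamma>2 j) / (\<tau> / 2)) powr 2) powr \<sigma>"
          by (simp add: powr_powr \<sigma>_def)
        also have "(sqrt (\<Gamma>2 j) / (\<tau> / 2)) powr 2 = (sqrt (\<Gamma>2 j) / (\<tau> / 2))\<^sup>2"
          using \<Gamma>pos[of j] \<tau> by (simp add: powr_numeral)
        also have "\<dots> = 4 * \<Gamma>2 j / \<tau>\<^sup>2"
          using \<Gamma>pos[of j] by (simp add: power_divide power_mult_distrib)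
        finally show ?thesis .
      qed
      finally show ?thesis using slab_bounds(1)[OF \<tau>] by simp
    qed
    let ?F = "\<integral>x. indicator {x. k < u x} x * \<bar>f x\<bar> \<partial>?M"
    have "emeasure ?M {x \<in> \<Omega>. k + \<tau> < u x} = (\<integral>\<^sup>+x. indicator {x \<in> \<Omega>. k + \<tau> < u x} x \<partial>?M)"
    proof (rule nn_integral_indicator[symmetric])
      have "{x \<in> space ?M. k + \<tau> < u x} \<in> sets ?M" by measurable
      then show "{x \<in> \<Omega>. k + \<tau> < u x} \<in> sets ?M" by simp
    qed
    also have "\<dots> \<le> (\<integral>\<^sup>+x. liminf (\<lambda>j. indicator {x \<in> \<Omega>. \<tau> / 2 \<le> ?w j x} x) \<partial>?M)"
    proof (rule nn_integral_mono_AE)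
      show "AE x in ?M. indicator {x \<in> \<Omega>. k + \<tau> < u x} x \<le> liminf (\<lambda>j. indicator {x \<in> \<Omega>. \<tau> / 2 \<le> ?w j x} x :: ennreal)"
        using lim
      proof eventually_elim
        case (elim x)
        show ?case
        proof (cases "x \<in> \<Omega> \<and> k + \<tau> < u x")
          case True
          have "(\<lambda>j. ?w j x) \<longlonglongrightarrow> slab k \<tau> (u x)" by (rule tendsto_slab[OF elim])
          then have "(\<lambda>j. ?w j x) \<longlonglongrightarrow> \<tau>" using True \<tau> by (simp add: slab_eq_upper)
          then have "\<forall>\<^sub>F j in sequentially. \<tau> / 2 < ?w j x" using \<tau> by (intro order_tendstoD) auto
          then have "\<forall>\<^sub>F j in sequentially. (1::ennreal) \<le> indicator {x \<in> \<Omega>. \<tau> / 2 \<le> ?w j x} x"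
            by eventually_elim (use True in simp)
          then have "1 \<le> liminf (\<lambda>j. indicator {x \<in> \<Omega>. \<tau> / 2 \<le> ?w j x} x :: ennreal)"
            by (rule Liminf_bounded)
          then show ?thesis using True by simp
        qed simp
      qed
    qed
    also have "\<dots> \<le> liminf (\<lambda>j. \<integral>\<^sup>+x. indicator {x \<in> \<Omega>. \<tau> / 2 \<le> ?w j x} x \<partial>?M)"
    proof (rule nn_integral_liminf)
      have "{x \<in> space ?M. \<tau> / 2 \<le> ?w j x} \<in> sets ?M" for j by measurable
      then show "(\<lambda>x. indicator {x \<in> \<Omega>. \<tau> / 2 \<le> ?w j x} x :: ennreal) \<in> borel_measurable ?M" for j
        by (intro borel_measurable_indicator) simp
    qed
    also have "\<dots> \<le> liminf (\<lambda>j. ennreal (C * (4 * \<Gamma>2 j / \<tau>\<^sup>2) powr \<sigma>))"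
    proof (intro Liminf_mono always_eventually allI)
      fix j
      have "{x \<in> space ?M. \<tau> / 2 \<le> ?w j x} \<in> sets ?M" by measurable
      then have "(\<integral>\<^sup>+x. indicator {x \<in> \<Omega>. \<tau> / 2 \<le> ?w j x} x \<partial>?M) = emeasure ?M {x \<in> \<Omega>. \<tau> / 2 \<le> ?w j x}"
        by (intro nn_integral_indicator) simp
      with bound[of j] show "(\<integral>\<^sup>+x. indicator {x \<in> \<Omega>. \<tau> / 2 \<le> ?w j x} x \<partial>?M) \<le> ennreal (C * (4 * \<Gamma>2 j / \<tau>\<^sup>2) powr \<sigma>)" by simp
    qed
    also have "\<dots> = ennreal (C * (4 * max 0 (2 * ?J / l) / \<tau>\<^sup>2) powr \<sigma>)"
    proof (rule lim_imp_Liminf)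
      have "(\<lambda>j. (4 * \<Gamma>2 j / \<tau>\<^sup>2) powr \<sigma>) \<longlonglongrightarrow> (4 * max 0 (2 * ?J / l) / \<tau>\<^sup>2) powr \<sigma>"
      proof (rule tendsto_powr')
        show "(\<lambda>j. 4 * \<Gamma>2 j / \<tau>\<^sup>2) \<longlonglongrightarrow> 4 * max 0 (2 * ?J / l) / \<tau>\<^sup>2"
          using \<tau> by (intro tendsto_intros \<Gamma>lim) auto
        show "4 * max 0 (2 * ?J / l) / \<tau>\<^sup>2 \<noteq> 0 \<or> 0 < \<sigma> \<and> (\<forall>\<^sub>F j in sequentially. 0 \<le> 4 * \<Gamma>2 j / \<tau>\<^sup>2)"
          using \<sigma> \<Gamma>pos by (auto simp: less_imp_le)
      qed auto
      then show "(\<lambda>j. ennreal (C * (4 * \<Gamma>2 j / \<tau>\<^sup>2) powr \<sigma>)) \<longlonglongrightarrow> ennreal (C * (4 * max 0 (2 * ?J / l) / \<tau>\<^sup>2) powr \<sigma>)"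
        by (intro tendsto_ennrealI tendsto_mult_left)
    qed simp
    also have "\<dots> \<le> ennreal (C * (8 / l * (?F / \<tau>)) powr \<sigma>)"
    proof -
      have F: "0 \<le> ?F" by (intro integral_nonneg_AE AE_I2) auto
      have "?J \<le> (\<integral>x. \<tau> * (indicator {x. k < u x} x * \<bar>f x\<bar>) \<partial>?M)"
      proof (rule integral_mono)
        show "integrable ?M (\<lambda>x. f x * slab k \<tau> (u x))"
        proof (rule Bochner_Integration.integrable_bound)
          show "integrable ?M (\<lambda>x. \<tau> * f x)" using f by auto
          show "AE x in ?M. norm (f x * slab k \<tau> (u x)) \<le> norm (\<tau> * f x)"
            using fb \<tau> by (intro AE_I2) (simp add: abs_mult)
        qed measurable
        have "(\<lambda>x. if k < u x then \<bar>f x\<bar> else 0) \<in> borel_measurable ?M" by measurable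
        moreover have "(\<lambda>x. if k < u x then \<bar>f x\<bar> else 0) = (\<lambda>x. indicator {x. k < u x} x * \<bar>f x\<bar>)"
          by (auto simp: fun_eq_iff indicator_def)
        ultimately have "integrable ?M (\<lambda>x. indicator {x. k < u x} x * \<bar>f x\<bar>)"
          by (intro Bochner_Integration.integrable_bound[OF f] AE_I2) (auto simp: indicator_def)
        then show "integrable ?M (\<lambda>x. \<tau> * (indicator {x. k < u x} x * \<bar>f x\<bar>))" by auto
        fix x
        show "f x * slab k \<tau> (u x) \<le> \<tau> * (indicator {x. k < u x} x * \<bar>f x\<bar>)"
        proof (cases "k < u x")
          case True
          have "f x * slab k \<tau> (u x) \<le> \<bar>f x\<bar> * \<tau>"
            using slab_bounds[OF \<tau>] by (intro mult_mono) auto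
          then show ?thesis using True by (simp add: mult.commute)
        qed (use \<tau> in \<open>simp add: slab_def\<close>)
      qed
      also have "\<dots> = \<tau> * ?F" by simp
      finally have "2 * ?J / l \<le> 2 * (\<tau> * ?F) / l" using l by (intro divide_right_mono mult_left_mono) auto
      moreover have "0 \<le> 2 * (\<tau> * ?F) / l" using l \<tau> F by simp
      ultimately have "max 0 (2 * ?J / l) \<le> 2 * (\<tau> * ?F) / l" by simp
      then have "4 * max 0 (2 * ?J / l) / \<tau>\<^sup>2 \<le> 4 * (2 * (\<tau> * ?F) / l) / \<tau>\<^sup>2"
        by (intro divide_right_mono mult_left_mono) auto
      also have "\<dots> = 8 / l * (?F / \<tau>)" using \<tau> l by (simp add: power2_eq_square field_simps)
      finally show ?thesis using C \<sigma>
        by (intro ennreal_leI mult_left_mono powr_mono2) auto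
    qed
    also have "C * (8 / l * (?F / \<tau>)) powr \<sigma> = C * (8 / l) powr \<sigma> * (?F / \<tau>) powr \<sigma>"
      using l \<tau> by (subst powr_mult) (auto intro!: divide_nonneg_pos integral_nonneg_AE)
    finally show ?case unfolding \<sigma>_def .
  qed
qed

end

section \<open>Integrals over small sets\<close>

definition log_young :: "real \<Rightarrow> real \<Rightarrow> real \<Rightarrow> real" where
  "log_young p q t = t powr p * ln (exp 1 + t) powr q"

lemma log_young_nonneg: "0 \<le> log_young p q t"
  by (simp add: log_young_def)

lemma ln_exp_1_add_ge_1:
  assumes "0 \<le> t"
  shows "1 \<le> ln (exp 1 + t :: real)"
  using ln_mono[of "exp 1" "exp 1 + t"] assms by (simp add: add_pos_nonneg)

text \<open>
  For \<open>t > T\<close>, write \<open>t = t\<^sup>p t\<^sup>1\<^sup>-\<^sup>p\<close>; the factor \<open>t\<^sup>1\<^sup>-\<^sup>p\<close> and the inverse power of the logarithm decrease in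
  \<open>t\<close>, so they are bounded by their values at \<open>T\<close>.
\<close>

lemma le_add_log_young:
  assumes p: "1 \<le> p" and q: "0 \<le> q" and T: "0 < T" and t: "0 \<le> t"
  shows "t \<le> T + T powr (1 - p) * ln (exp 1 + T) powr (- q) * log_young p q t"
proof (cases "t \<le> T")
  case True
  then show ?thesis using log_young_nonneg[of p q t] by (simp add: add_increasing2)
next
  case False
  let ?l = "ln (exp 1 + T)" and ?m = "ln (exp 1 + t)"
  have lm: "1 \<le> ?l" "?l \<le> ?m" using False T ln_exp_1_add_ge_1[of T] by (auto simp: add_pos_pos)
  have "t = t powr (1 - p) * t powr p" using False T by (simp flip: powr_add)
  also have "\<dots> \<le> T powr (1 - p) * t powr p"
    using False T p by (intro mult_right_mono powr_mono2') auto
  also have "\<dots> = T powr (1 - p) * t powr p * (?l powr (- q) * ?l powr q)"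
    using lm by (simp flip: powr_add)
  also have "\<dots> \<le> T powr (1 - p) * t powr p * (?l powr (- q) * ?m powr q)"
    using lm q by (intro mult_left_mono powr_mono2) auto
  also have "\<dots> = T powr (1 - p) * ?l powr (- q) * log_young p q t" by (simp add: log_young_def)
  finally show ?thesis using T by simp
qed

text \<open>
  The power of \<open>y\<close> is at most a multiple \<open>K\<close> of \<open>exp (y / (2 p))\<close>, so the argument of the logarithm still grows
  exponentially. The summand \<open>exp 1\<close> keeps the logarithm above \<open>1\<close>, which absorbs \<open>ln K\<close>.
\<close>

lemma linear_le_log_growth:
  fixes p \<theta> :: real
  assumes p: "0 < p" and \<theta>: "0 < \<theta>"
  shows "\<exists>c>0. \<forall>y\<ge>1. c * y \<le> ln (exp 1 + exp (y / p) * y powr (- \<theta>))"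
proof -
  \<comment> \<open>With this \<open>a\<close> the power \<open>\<theta>\<close> of \<open>exp (y / a)\<close> is \<open>exp (y / (2 p))\<close>.\<close>
  define a where "a = 2 * p * \<theta>"
  define K where "K = max 1 (a powr \<theta>)"
  have a: "0 < a" using p \<theta> by (simp add: a_def)
  have K: "1 \<le> K" "a powr \<theta> \<le> K" by (auto simp: K_def)
  have c: "0 < 1 / (2 * p * (1 + ln K))" using p K by (auto intro!: mult_pos_pos add_pos_nonneg)
  show ?thesis
  proof (intro exI[of _ "1 / (2 * p * (1 + ln K))"] conjI c allI impI)
    fix y :: real assume y: "1 \<le> y"
    let ?T = "exp (y / p) * y powr (- \<theta>)"
    have T0: "0 < ?T" using y by simp
    have "y / a \<le> exp (y / a)" using exp_ge_add_one_self[of "y / a"] by linarith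
    then have "y \<le> a * exp (y / a)" using a by (simp add: field_simps)
    then have "y powr \<theta> \<le> (a * exp (y / a)) powr \<theta>" using y \<theta> by (intro powr_mono2) auto
    also have "\<dots> = a powr \<theta> * exp (y / (2 * p))"
      using a p \<theta> by (simp add: powr_mult exp_powr_real a_def)
    also have "\<dots> \<le> K * exp (y / (2 * p))" using K by (intro mult_right_mono) auto
    finally have 1: "y powr \<theta> \<le> K * exp (y / (2 * p))" .
    have "\<theta> * ln y \<le> ln K + y / (2 * p)"
    proof -
      have "ln (y powr \<theta>) \<le> ln (K * exp (y / (2 * p)))" using 1 y K by (subst ln_le_cancel_iff) auto
      then show ?thesis using y K by (simp add: ln_powr ln_mult)
    qed
    moreover have "ln ?T = y / p - \<theta> * ln y" using y by (simp add: ln_mult ln_powr)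
    moreover have "y / p = y / (2 * p) + y / (2 * p)" using p by (simp add: field_simps)
    ultimately have "y / (2 * p) - ln K \<le> ln ?T" by linarith
    also have "ln ?T \<le> ln (exp 1 + ?T)" using T0 by (subst ln_le_cancel_iff) (auto simp: add_pos_pos)
    finally have "y / (2 * p) \<le> ln K + ln (exp 1 + ?T)" by simp
    also have "\<dots> \<le> ln K * ln (exp 1 + ?T) + ln (exp 1 + ?T)"
      using mult_left_mono[OF ln_exp_1_add_ge_1[of ?T], of "ln K"] K T0 by simp
    finally have "y / (2 * p) \<le> (1 + ln K) * ln (exp 1 + ?T)" by (simp add: algebra_simps)
    then show "1 / (2 * p * (1 + ln K)) * y \<le> ln (exp 1 + ?T)"
      using K p by (simp add: field_simps add_pos_nonneg)
  qed
qed

text \<open>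
  Splitting \<open>g\<close> at the height \<open>T = exp (y / p) y\<^sup>-\<^sup>\<theta>\<close> with \<open>\<theta> = q / p\<close> balances both parts: below \<open>T\<close> the integral over \<open>E\<close> is at
  most \<open>T exp (- y)\<close>, and above \<open>T\<close> the factor \<open>T\<^sup>1\<^sup>-\<^sup>p\<close> and the logarithm \<open>\<ge> c y\<close> give the same power of \<open>y\<close>,
  because \<open>- \<theta> (1 - p) - q = - \<theta>\<close>.
\<close>

lemma log_young_small_set_bound:
  assumes p: "1 < p" and q: "0 < q"
  shows "\<exists>B>0. \<forall>(M :: 'a measure) g E y. g \<in> borel_measurable M \<and> (\<forall>x. 0 \<le> g x) \<and>
      (\<integral>\<^sup>+x. ennreal (log_young p q (g x)) \<partial>M) \<le> 1 \<and> E \<in> sets M \<and> 1 \<le> y \<and> emeasure M E \<le> ennreal (exp (- y)) \<longrightarrow>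
      (\<integral>\<^sup>+x. indicator E x * ennreal (g x) \<partial>M) \<le> ennreal (B * exp (- (y * (1 - 1 / p))) * y powr (- (q / p)))"
proof -
  obtain c where c: "0 < c" "\<And>y. 1 \<le> y \<Longrightarrow> c * y \<le> ln (exp 1 + exp (y / p) * y powr (- (q / p)))"
    using linear_le_log_growth[of p "q / p"] p q by auto
  show ?thesis
  proof (intro exI[of _ "1 + c powr (- q)"] conjI allI impI, goal_cases)
    case 1
    show ?case by (simp add: add_pos_nonneg)
  next
    case (2 M g E y)
    then have [measurable]: "g \<in> borel_measurable M" "E \<in> sets M" and g: "\<And>x. 0 \<le> g x"
      and A: "(\<integral>\<^sup>+x. ennreal (log_young p q (g x)) \<partial>M) \<le> 1" and y: "1 \<le> y" and E: "emeasure M E \<le> ennreal (exp (- y))"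
      by auto
    define T where "T = exp (y / p) * y powr (- (q / p))"
    have T: "0 < T" using y by (simp add: T_def)
    define d where "d = T powr (1 - p) * ln (exp 1 + T) powr (- q)"
    have d0: "0 \<le> d" by (simp add: d_def)
    have [measurable]: "(\<lambda>x. log_young p q (g x)) \<in> borel_measurable M" unfolding log_young_def by measurable
    have "(\<integral>\<^sup>+x. indicator E x * ennreal (g x) \<partial>M)
        \<le> (\<integral>\<^sup>+x. ennreal T * indicator E x + ennreal d * ennreal (log_young p q (g x)) \<partial>M)"
    proof (rule nn_integral_mono)
      fix x
      have "g x \<le> T + d * log_young p q (g x)"
        unfolding d_def using p q T g by (intro le_add_log_young) auto
      then have "ennreal (g x) \<le> ennreal T + ennreal d * ennreal (log_young p q (g x))"
        using T d0 log_young_nonneg[of p q "g x"] by (simp flip: ennreal_mult ennreal_plus add: ennreal_leI)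
      then show "indicator E x * ennreal (g x) \<le> ennreal T * indicator E x + ennreal d * ennreal (log_young p q (g x))"
        by (simp add: indicator_def)
    qed
    also have "\<dots> = ennreal T * emeasure M E + ennreal d * (\<integral>\<^sup>+x. ennreal (log_young p q (g x)) \<partial>M)"
      by (simp add: nn_integral_add nn_integral_cmult)
    also have "\<dots> \<le> ennreal T * ennreal (exp (- y)) + ennreal d * 1"
      using A E by (intro add_mono mult_left_mono) auto
    also have "\<dots> = ennreal (T * exp (- y) + d)" using T d0 by (simp flip: ennreal_mult ennreal_plus)
    also have "\<dots> \<le> ennreal ((1 + c powr (- q)) * exp (- (y * (1 - 1 / p))) * y powr (- (q / p)))"
    proof (rule ennreal_leI)
      let ?e = "exp (- (y * (1 - 1 / p)))" and ?y = "y powr (- (q / p))"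
      have "exp (y / p) * exp (- y) = ?e" by (simp add: algebra_simps flip: exp_add)
      then have 1: "T * exp (- y) = ?e * ?y" by (simp add: T_def mult.commute mult.left_commute)
      have "d \<le> T powr (1 - p) * (c * y) powr (- q)"
        unfolding d_def using c y q by (intro mult_left_mono powr_mono2') (auto simp: T_def)
      also have "\<dots> = c powr (- q) * (exp (y / p) powr (1 - p)) * ((y powr (- (q / p))) powr (1 - p) * y powr (- q))"
        using c y by (simp add: T_def powr_mult mult_ac)
      also have "exp (y / p) powr (1 - p) = ?e" using p by (simp add: exp_powr_real field_simps)
      also have "(y powr (- (q / p))) powr (1 - p) * y powr (- q) = ?y"
        using p by (simp add: powr_powr field_simps flip: powr_add)
      finally show "T * exp (- y) + d \<le> (1 + c powr (- q)) * ?e * ?y" using 1 by (simp add: algebra_simps)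
    qed
    finally show ?case .
  qed
qed

section \<open>Iteration over the levels\<close>

text \<open>
  The levels \<open>k j\<close> are chosen so that \<open>a (k j) \<le> exp (- (j + 1))\<close>. The step from \<open>k j\<close> to \<open>k (j + 1)\<close> then needs a
  height proportional to \<open>(j + 1)\<close> to the power \<open>- \<theta>\<close>, and these heights are summable.
\<close>

lemma level_iteration:
  fixes a \<Phi> :: "real \<Rightarrow> real" and C \<mu> B B0 \<sigma> \<theta> :: real
  assumes pos: "0 < C" "0 < \<mu>" "0 < B" "0 < B0" "0 < \<sigma>" and \<theta>: "1 < \<theta>"
    and a: "\<And>k. 0 \<le> a k" "\<And>k k'. k \<le> k' \<Longrightarrow> a k' \<le> a k" and \<Phi>: "\<And>k. 0 \<le> \<Phi> k"
    and decay: "\<And>k \<tau>. 0 \<le> k \<Longrightarrow> 0 < \<tau> \<Longrightarrow> a (k + \<tau>) \<le> C * (\<Phi> k / \<tau>) powr \<sigma>"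
    and start: "\<Phi> 0 \<le> \<mu> * B0"
    and small: "\<And>k y. 1 \<le> y \<Longrightarrow> a k \<le> exp (- y) \<Longrightarrow> \<Phi> k \<le> \<mu> * (B * exp (- (y / \<sigma>)) * y powr (- \<theta>))"
  shows "a (\<mu> * ((C * exp 1) powr (1 / \<sigma>) * (B0 + B * (\<Sum>i. real (Suc i) powr (- \<theta>))))) = 0"
proof -
  \<comment> \<open>The power \<open>\<sigma>\<close> of \<open>D\<close> absorbs \<open>C\<close> and the factor \<open>exp (- 1)\<close> that is gained in every step.\<close>
  define D where "D = (C * exp 1) powr (1 / \<sigma>)"
  have D: "0 < D" using pos by (simp add: D_def)
  have D\<sigma>: "D powr \<sigma> = C * exp 1" using pos by (simp add: D_def powr_powr)
  define s where "s i = real (Suc i) powr (- \<theta>)" for i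
  have sum: "summable s" unfolding s_def
    using \<theta> summable_Suc_iff[of "\<lambda>i. real i powr (- \<theta>)"] by (simp add: summable_real_powr_iff)
  have s0: "0 < s i" for i by (simp add: s_def)
  define k where "k j = \<mu> * (D * (B0 + B * (\<Sum>i<j. s i)))" for j
  have k0: "0 \<le> k j" for j
    unfolding k_def using pos D s0 by (intro mult_nonneg_nonneg add_nonneg_nonneg sum_nonneg) (auto intro: less_imp_le)
  have step: "a (k' + \<mu> * D * h) \<le> exp (- (y + 1))" if "0 \<le> k'" "0 < h" "\<Phi> k' \<le> \<mu> * (h * exp (- (y / \<sigma>)))" for k' h y
  proof -
    have \<tau>: "0 < \<mu> * D * h" using pos D that by simp
    have "a (k' + \<mu> * D * h) \<le> C * (\<Phi> k' / (\<mu> * D * h)) powr \<sigma>" using decay[OF that(1) \<tau>] .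
    also have "\<dots> \<le> C * (exp (- (y / \<sigma>)) / D) powr \<sigma>"
    proof (intro mult_left_mono powr_mono2)
      have "\<Phi> k' / (\<mu> * D * h) \<le> \<mu> * (h * exp (- (y / \<sigma>))) / (\<mu> * D * h)"
        using that(3) \<tau> by (intro divide_right_mono) auto
      also have "\<dots> = exp (- (y / \<sigma>)) / D" using pos D that by simp
      finally show "\<Phi> k' / (\<mu> * D * h) \<le> exp (- (y / \<sigma>)) / D" .
    qed (use pos \<Phi> \<tau> in auto)
    also have "(exp (- (y / \<sigma>)) / D) powr \<sigma> = exp (- y) / (C * exp 1)"
      using D pos by (simp add: powr_divide D\<sigma> exp_powr_real)
    also have "C * (exp (- y) / (C * exp 1)) = exp (- (y + 1))" using pos by (simp add: exp_diff exp_minus field_simps exp_add)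
    finally show ?thesis .
  qed
  have ak: "a (k j) \<le> exp (- real (Suc j))" for j
  proof (induction j)
    case 0
    show ?case using step[of 0 B0 0] pos start by (simp add: k_def mult.assoc)
  next
    case (Suc j)
    have "a (k j + \<mu> * D * (B * s j)) \<le> exp (- (real (Suc j) + 1))"
    proof (rule step[OF k0])
      show "0 < B * s j" using pos s0 by simp
      show "\<Phi> (k j) \<le> \<mu> * (B * s j * exp (- (real (Suc j) / \<sigma>)))"
        using small[OF _ Suc.IH] by (simp add: s_def mult_ac)
    qed
    moreover have "k j + \<mu> * D * (B * s j) = k (Suc j)" by (simp add: k_def algebra_simps)
    ultimately show ?case by (simp add: add.commute)
  qed
  let ?K = "\<mu> * (D * (B0 + B * suminf s))"
  have "k j \<le> ?K" for j
    unfolding k_def using pos D s0 sum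
    by (intro mult_left_mono add_left_mono sum_le_suminf) (auto intro: less_imp_le)
  then have "a ?K \<le> exp (- real (Suc j))" for j using order_trans[OF a(2) ak] by blast
  moreover have "(\<lambda>j. exp (- real (Suc j))) \<longlonglongrightarrow> 0"
  proof -
    have "(\<lambda>j. exp (- real j)) \<longlonglongrightarrow> 0"
      by (intro filterlim_compose[OF exp_at_bot] filterlim_uminus_at_bot_at_top[THEN filterlim_compose] filterlim_real_sequentially)
    then show ?thesis by (rule LIMSEQ_Suc)
  qed
  ultimately have "a ?K \<le> 0" by (intro LIMSEQ_le_const[of _ 0]) auto
  then have "a ?K = 0" using a(1)[of ?K] by simp
  then show ?thesis by (simp add: D_def s_def[abs_def])
qed

section \<open>Boundedness of weak solutions\<close>

context elliptic_matrix
begin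

text \<open>
  The hypotheses of the iteration are met with \<open>\<theta> = q / p\<close> and \<open>p = n / 2\<close>; the exponents match because
  \<open>1 - 1 / p = 1 / \<sigma>\<close>. The iteration starts from \<open>\<integral> |f| \<le> \<mu> (|\<Omega>| + 1)\<close>.
\<close>

theorem essential_bound:
  assumes dim: "3 \<le> CARD('n)" and q: "real CARD('n) / 2 < q"
  shows "\<exists>K>0. \<forall>u f \<mu>. weak_solution \<Omega> Q f u \<and> f \<in> borel_measurable (lebesgue_on \<Omega>) \<and> 0 < \<mu> \<and>
     (\<integral>\<^sup>+x. ennreal (log_young (real CARD('n) / 2) q (\<bar>f x\<bar> / \<mu>)) \<partial>lebesgue_on \<Omega>) \<le> 1 \<longrightarrow>
     (AE x in lebesgue_on \<Omega>. u x \<le> K * \<mu>)"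
proof -
  let ?M = "lebesgue_on \<Omega>"
  interpret finite_measure ?M by (rule finite_measure_\<Omega>)
  define p where "p = real CARD('n) / 2"
  define \<sigma> :: real where "\<sigma> = CARD('n) / (CARD('n) - 2)"
  define \<theta> where "\<theta> = q / p"
  have p: "1 < p" using dim by (simp add: p_def)
  have pq: "p < q" and q0: "0 < q" using q p by (auto simp: p_def)
  have \<theta>: "1 < \<theta>" using pq p by (simp add: \<theta>_def)
  have \<sigma>: "0 < \<sigma>" using dim by (simp add: \<sigma>_def)
  have \<sigma>p: "1 - 1 / p = 1 / \<sigma>" using dim by (simp add: p_def \<sigma>_def field_simps of_nat_diff)
  obtain C where C: "0 < C" and decay: "\<forall>u g f k \<tau>. in_Lip0_closure \<Omega> Q u g \<and> integrable ?M f \<and>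
      (\<forall>\<psi>\<in>Lip0 \<Omega>. (\<integral>x. gradient \<psi> x \<bullet> (Q x *v g x) \<partial>?M) = (\<integral>x. f x * \<psi> x \<partial>?M)) \<and>
      0 \<le> k \<and> 0 < \<tau> \<longrightarrow>
      emeasure ?M {x \<in> \<Omega>. k + \<tau> < u x} \<le> ennreal (C * ((\<integral>x. indicator {x. k < u x} x * \<bar>f x\<bar> \<partial>?M) / \<tau>) powr \<sigma>)"
    unfolding \<sigma>_def using level_set_decay[OF dim] by blast
  obtain B where B: "0 < B" and small: "\<forall>(M :: (real ^ 'n) measure) g E y. g \<in> borel_measurable M \<and> (\<forall>x. 0 \<le> g x) \<and>
      (\<integral>\<^sup>+x. ennreal (log_young p q (g x)) \<partial>M) \<le> 1 \<and> E \<in> sets M \<and> 1 \<le> y \<and> emeasure M E \<le> ennreal (exp (- y)) \<longrightarrow>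
      (\<integral>\<^sup>+x. indicator E x * ennreal (g x) \<partial>M) \<le> ennreal (B * exp (- (y * (1 - 1 / p))) * y powr (- (q / p)))"
    using log_young_small_set_bound[OF p q0] by blast
  define B0 where "B0 = measure ?M \<Omega> + 1"
  have B0: "0 < B0" by (simp add: B0_def add_nonneg_pos)
  define K where "K = (C * exp 1) powr (1 / \<sigma>) * (B0 + B * (\<Sum>i. real (Suc i) powr (- \<theta>)))"
  have K: "0 < K"
  proof -
    have "summable (\<lambda>i. real (Suc i) powr (- \<theta>))"
      using \<theta> summable_Suc_iff[of "\<lambda>i. real i powr (- \<theta>)"] by (simp add: summable_real_powr_iff)
    then have "0 \<le> (\<Sum>i. real (Suc i) powr (- \<theta>))" by (intro suminf_nonneg) auto
    then show ?thesis unfolding K_def using C B B0 by (intro mult_pos_pos add_pos_nonneg) auto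
  qed
  show ?thesis
  proof (intro exI[of _ K] conjI K allI impI, goal_cases)
    case (1 u f \<mu>)
    then obtain g where u: "in_Lip0_closure \<Omega> Q u g"
      and weak: "\<forall>\<psi>\<in>Lip0 \<Omega>. (\<integral>x. gradient \<psi> x \<bullet> (Q x *v g x) \<partial>?M) = (\<integral>x. f x * \<psi> x \<partial>?M)"
      and fm [measurable]: "f \<in> borel_measurable ?M" and \<mu>: "0 < \<mu>"
      and A: "(\<integral>\<^sup>+x. ennreal (log_young p q (\<bar>f x\<bar> / \<mu>)) \<partial>?M) \<le> 1"
      unfolding weak_solution_def p_def by blast
    have [measurable]: "u \<in> borel_measurable ?M" using u unfolding in_Lip0_closure_def by blast
    define h where "h x = \<bar>f x\<bar> / \<mu>" for x
    have h0: "0 \<le> h x" for x using \<mu> by (simp add: h_def)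
    have fh: "\<bar>f x\<bar> = \<mu> * h x" for x using \<mu> by (simp add: h_def)
    have [measurable]: "h \<in> borel_measurable ?M" unfolding h_def by measurable
    have [measurable]: "(\<lambda>x. log_young p q (h x)) \<in> borel_measurable ?M" unfolding log_young_def by measurable
    have "(\<integral>\<^sup>+x. ennreal (h x) \<partial>?M) \<le> (\<integral>\<^sup>+x. 1 + ennreal (log_young p q (h x)) \<partial>?M)"
    proof (rule nn_integral_mono)
      fix x
      have "h x \<le> 1 + 1 powr (1 - p) * ln (exp 1 + 1) powr (- q) * log_young p q (h x)"
        using p q0 h0 by (intro le_add_log_young) auto
      also have "ln (exp 1 + 1) powr (- q) \<le> (1::real) powr (- q)"
        using ln_exp_1_add_ge_1[of 1] q0 by (intro powr_mono2') auto
      finally have "h x \<le> 1 + log_young p q (h x)"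
        using log_young_nonneg[of p q "h x"] by (simp add: mult_right_mono)
      then have "ennreal (h x) \<le> ennreal (1 + log_young p q (h x))" by (rule ennreal_leI)
      also have "\<dots> = 1 + ennreal (log_young p q (h x))" using log_young_nonneg[of p q "h x"] by (simp add: ennreal_plus)
      finally show "ennreal (h x) \<le> 1 + ennreal (log_young p q (h x))" .
    qed
    also have "\<dots> = emeasure ?M \<Omega> + (\<integral>\<^sup>+x. ennreal (log_young p q (h x)) \<partial>?M)"
      by (simp add: nn_integral_add)
    also have "\<dots> \<le> ennreal (measure ?M \<Omega>) + 1"
      using A unfolding h_def by (intro add_mono) (auto simp: emeasure_eq_measure)
    also have "\<dots> = ennreal B0" by (simp add: B0_def ennreal_plus)
    finally have hB0: "(\<integral>\<^sup>+x. ennreal (h x) \<partial>?M) \<le> ennreal B0" .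
    have hi: "integrable ?M h"
      using hB0 h0 by (intro integrableI_nonneg) (auto intro: le_less_trans)
    have fi: "integrable ?M f"
      by (rule Bochner_Integration.integrable_bound[of _ "\<lambda>x. \<mu> * h x"]) (use hi fh h0 \<mu> in auto)
    let ?a = "\<lambda>k. measure ?M {x \<in> \<Omega>. k < u x}"
    let ?\<Phi> = "\<lambda>k. \<integral>x. indicator {x. k < u x} x * \<bar>f x\<bar> \<partial>?M"
    have lev: "{x \<in> \<Omega>. k < u x} \<in> sets ?M" for k
    proof -
      have "{x \<in> space ?M. k < u x} \<in> sets ?M" by measurable
      then show ?thesis by simp
    qed
    have \<Phi>eq: "?\<Phi> k = \<mu> * (\<integral>x. indicator {x \<in> \<Omega>. k < u x} x * h x \<partial>?M)" for k
    proof -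
      have "?\<Phi> k = (\<integral>x. \<mu> * (indicator {x \<in> \<Omega>. k < u x} x * h x) \<partial>?M)"
        by (intro Bochner_Integration.integral_cong) (auto simp: fh indicator_def)
      then show ?thesis by simp
    qed
    have hint: "integrable ?M (\<lambda>x. indicator {x \<in> \<Omega>. k < u x} x * h x)" for k
    proof (rule Bochner_Integration.integrable_bound[OF hi])
      note [measurable] = lev
      show "(\<lambda>x. indicator {x \<in> \<Omega>. k < u x} x * h x) \<in> borel_measurable ?M" by measurable
    qed (auto simp: indicator_def h0)
    have "?a (\<mu> * K) = 0"
      unfolding K_def
    proof (rule level_iteration[OF C \<mu> B B0 \<sigma> \<theta>, where \<Phi>="?\<Phi>"])
      show "?a k' \<le> ?a k" if "k \<le> k'" for k k'
        using that lev by (intro finite_measure_mono) auto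
      show "0 \<le> ?\<Phi> k" for k by (intro integral_nonneg_AE AE_I2) auto
      show "?a (k + \<tau>) \<le> C * (?\<Phi> k / \<tau>) powr \<sigma>" if "0 \<le> k" "0 < \<tau>" for k \<tau>
      proof -
        have "ennreal (?a (k + \<tau>)) \<le> ennreal (C * (?\<Phi> k / \<tau>) powr \<sigma>)"
          using decay u fi weak that unfolding emeasure_eq_measure by blast
        then show ?thesis using C by (subst (asm) ennreal_le_iff) auto
      qed
      show "?\<Phi> 0 \<le> \<mu> * B0"
      proof -
        have "(\<integral>x. indicator {x \<in> \<Omega>. 0 < u x} x * h x \<partial>?M) \<le> (\<integral>x. h x \<partial>?M)"
          using hint hi h0 by (intro integral_mono) (auto simp: indicator_def)
        also have "ennreal (\<integral>x. h x \<partial>?M) \<le> ennreal B0"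
          using hB0 hi h0 by (subst nn_integral_eq_integral[symmetric]) auto
        then have "(\<integral>x. h x \<partial>?M) \<le> B0" using B0 by (subst (asm) ennreal_le_iff) auto
        finally show ?thesis unfolding \<Phi>eq using \<mu> by (intro mult_left_mono) auto
      qed
      show "?\<Phi> k \<le> \<mu> * (B * exp (- (y / \<sigma>)) * y powr (- \<theta>))" if y: "1 \<le> y" and ak: "?a k \<le> exp (- y)" for k y
      proof -
        let ?E = "{x \<in> \<Omega>. k < u x}"
        have "ennreal (\<integral>x. indicator ?E x * h x \<partial>?M) = (\<integral>\<^sup>+x. ennreal (indicator ?E x * h x) \<partial>?M)"
          using hint h0 by (intro nn_integral_eq_integral[symmetric]) auto
        also have "\<dots> = (\<integral>\<^sup>+x. indicator ?E x * ennreal (h x) \<partial>?M)"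
          by (intro nn_integral_cong) (simp add: indicator_def)
        also have "\<dots> \<le> ennreal (B * exp (- (y * (1 - 1 / p))) * y powr (- (q / p)))"
        proof -
          have "emeasure ?M ?E \<le> ennreal (exp (- y))" using ak by (simp add: emeasure_eq_measure ennreal_leI)
          moreover have "(\<integral>\<^sup>+x. ennreal (log_young p q (h x)) \<partial>?M) \<le> 1" using A unfolding h_def .
          moreover have "h \<in> borel_measurable ?M" by measurable
          ultimately show ?thesis using small lev[of k] h0 y by blast
        qed
        finally have "(\<integral>x. indicator ?E x * h x \<partial>?M) \<le> B * exp (- (y * (1 - 1 / p))) * y powr (- (q / p))"
          using B by (subst (asm) ennreal_le_iff) auto
        then show ?thesis unfolding \<Phi>eq \<sigma>p \<theta>_def using \<mu> by (intro mult_left_mono) auto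
      qed
    qed simp
    then have "{x \<in> \<Omega>. \<mu> * K < u x} \<in> null_sets ?M" using lev by (auto simp: null_sets_def emeasure_eq_measure)
    then show ?case
      by (rule AE_I') (auto simp: mult.commute)
  qed
qed

end

theorem theorem1p2:
  fixes \<Omega> :: "(real ^ 'n) set" and Q :: "real ^ 'n \<Rightarrow> real ^ 'n ^ 'n"
    and q :: real and A :: "real \<Rightarrow> real"
  assumes dim: "CARD('n) \<ge> 3"
    and Omega: "bounded \<Omega>" "open \<Omega>" "connected \<Omega>"
    and Q_measurable: "Q \<in> borel_measurable (lebesgue_on \<Omega>)"
    and Q_self_adjoint: "\<forall>x\<in>\<Omega>. transpose (Q x) = Q x"
    and Q_elliptic: "uniformly_elliptic \<Omega> Q"
    and q: "q > real CARD('n) / 2"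
    and A: "\<forall>t\<ge>0. A t = t powr (real CARD('n) / 2) * ln (exp 1 + t) powr q"
  shows "\<exists>C>0. \<forall>f \<in> orlicz_space \<Omega> A. \<forall>u. weak_solution \<Omega> Q f u \<and> (AE x in lebesgue_on \<Omega>. 0 \<le> u x) \<longrightarrow>
           Linf_norm \<Omega> u \<le> ennreal C * orlicz_norm \<Omega> A f"
proof -
  let ?M = "lebesgue_on \<Omega>"
  obtain l \<Lambda> where "0 < l"
    and "AE x in ?M. \<forall>\<xi>. l * (norm \<xi>)\<^sup>2 \<le> (Q x *v \<xi>) \<bullet> \<xi> \<and> (Q x *v \<xi>) \<bullet> \<xi> \<le> \<Lambda> * (norm \<xi>)\<^sup>2"
    using Q_elliptic unfolding uniformly_elliptic_def by blast
  then interpret elliptic_matrix \<Omega> Q l \<Lambda>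
    using Omega Q_measurable Q_self_adjoint by unfold_locales auto
  obtain K where K: "0 < K" and bound: "\<forall>u f \<mu>. weak_solution \<Omega> Q f u \<and> f \<in> borel_measurable ?M \<and> 0 < \<mu> \<and>
     (\<integral>\<^sup>+x. ennreal (log_young (real CARD('n) / 2) q (\<bar>f x\<bar> / \<mu>)) \<partial>?M) \<le> 1 \<longrightarrow> (AE x in ?M. u x \<le> K * \<mu>)"
    using essential_bound[OF dim q] by blast
  show ?thesis
  proof (intro exI[of _ K] conjI K ballI allI impI)
    fix f u assume f: "f \<in> orlicz_space \<Omega> A" and u: "weak_solution \<Omega> Q f u \<and> (AE x in ?M. 0 \<le> u x)"
    have fm: "f \<in> borel_measurable ?M" using f by (simp add: orlicz_space_def)
    have um [measurable]: "u \<in> borel_measurable ?M"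
      using u unfolding weak_solution_def in_Lip0_closure_def by blast
    have "Linf_norm \<Omega> u / ennreal K \<le> orlicz_norm \<Omega> A f"
      unfolding orlicz_norm_def
    proof (rule Inf_greatest, clarify)
      fix \<mu> :: real assume \<mu>: "0 < \<mu>" and le: "(\<integral>\<^sup>+x. ennreal (A (\<bar>f x\<bar> / \<mu>)) \<partial>?M) \<le> 1"
      have Aeq: "A (\<bar>f x\<bar> / \<mu>) = log_young (real CARD('n) / 2) q (\<bar>f x\<bar> / \<mu>)" for x
        using A \<mu> by (simp add: log_young_def)
      have "(\<integral>\<^sup>+x. ennreal (log_young (real CARD('n) / 2) q (\<bar>f x\<bar> / \<mu>)) \<partial>?M) \<le> 1"
        using le by (simp only: Aeq)
      then have ae: "AE x in ?M. u x \<le> K * \<mu>" using bound u fm \<mu> by blast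
      have "AE x in ?M. 0 \<le> u x" using u by blast
      with ae have "AE x in ?M. ennreal \<bar>u x\<bar> \<le> ennreal (K * \<mu>)"
        by eventually_elim (simp add: ennreal_leI)
      then have "Linf_norm \<Omega> u \<le> ennreal (K * \<mu>)"
        unfolding Linf_norm_def by (intro esssup_I) measurable
      also have "ennreal (K * \<mu>) = ennreal K * ennreal \<mu>" using K \<mu> by (simp flip: ennreal_mult)
      finally show "Linf_norm \<Omega> u / ennreal K \<le> ennreal \<mu>"
        using K by (intro divide_le_posI_ennreal) auto
    qed
    then have "ennreal K * (Linf_norm \<Omega> u / ennreal K) \<le> ennreal K * orlicz_norm \<Omega> A f"
      by (rule mult_left_mono) simp
    moreover have "ennreal K * (Linf_norm \<Omega> u / ennreal K) = Linf_norm \<Omega> u * ennreal K / ennreal K"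
      by (simp add: ennreal_times_divide mult.commute)
    moreover have "\<dots> = Linf_norm \<Omega> u" using K by (intro mult_divide_eq_ennreal) auto
    ultimately show "Linf_norm \<Omega> u \<le> ennreal K * orlicz_norm \<Omega> A f" by simp
  qed
qed


end
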